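(* Let $A$ be a finite-dimensional algebra over an algebraically closed field $\Bbbk$, given by a quiver $Q$ with vertex set $\mathbf{N}=\{1,\dots,n\}$ and relations $R$. Let $\tilde A$ be the algebra obtained from $A$ by attaching to each vertex $k$ a new vertex $\tilde k$ and an arrow $k\to\tilde k$, let $N$ be the nilpotency degree of $\mathrm{Rad}\,\tilde A$, let $\mathfrak{C}=\mathfrak{C}(\tilde A)$ (with respect to the radical filtration of $\tilde A$), and let $\mathfrak{D}=\mathfrak{D}(\tilde A)$ be the trivial extension of $\mathfrak{C}$ by its restricted dual $\mathfrak{C}^*$ (all defined in the context). Then $A$ is an idempotent subquotient of $\mathfrak{D}$: for every $i\in\mathbb{Z}$, $$A\cong 1_{\tilde A_i}\mathfrak{D}1_{\tilde A_i}\big/1_{\tilde A_i}\mathfrak{D}\tilde e_i\mathfrak{D}1_{\tilde A_i},\qquad\text{where}\quad \tilde e_i=\sum_{k=1}^n e_{\tilde k,i}\in\mathfrak{D}.$$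
   Context: $\tilde A$: the quiver of $A$ with, for each $k\in\mathbf{N}$, an additional vertex $\tilde k$ and an additional arrow $\alpha_k:k\to\tilde k$, with the same relations $R$ and no new ones. Paths are composed from right to left, so $\alpha_k\in e_{\tilde k}\tilde Ae_k$; thus $e_k\tilde A=e_kA$ and $e_{\tilde k}\tilde A=\Bbbk e_{\tilde k}\oplus\alpha_kA$ with $\alpha_kA\cong e_kA$. Put $\overline{\mathbf{N}}=\{1,\dots,n,\tilde 1,\dots,\tilde n\}$. Let $I_j=\mathrm{Rad}^j\tilde A$, so $I_{N-1}\neq0=I_N$. $\mathfrak{C}=\mathfrak{C}(\tilde A)=\bigoplus_{r,c\in\mathbb{Z}}\mathfrak{C}_{r,c}$ is the algebra of $\mathbb{Z}\times\mathbb{Z}$-matrices with finitely many nonzero entries, where the entry in row $r$, column $c$ lies in $\mathfrak{C}_{r,c}=I_{r-c}$ if $r>c$, $\tilde A/I_{N-(c-r)}$ if $0\le c-r<N$, and $0$ if $c-r\ge N$, with multiplication induced from $\tilde A$. Let $e_{k,i}$ be the idempotent $e_k$ in matrix position $(i,i)$, $k\in\overline{\mathbf{N}}$, $i\in\mathbb{Z}$; and let $1_{\tilde A_i}=\sum_{k\in\overline{\mathbf{N}}}e_{k,i}$ be the identity of $\tilde A$ placed in matrix position $(i,i)$. $\mathfrak{C}^*=\bigoplus_{i,j\in\mathbb{Z};\,x,y\in\overline{\mathbf{N}}}\mathrm{Hom}_\Bbbk(e_{y,j}\mathfrak{C}e_{x,i},\Bbbk)$ with its natural $\mathfrak{C}$-bimodule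 structure, and $\mathfrak{D}=\mathfrak{C}\oplus\mathfrak{C}^*$ is the trivial extension, with product $(a,f)(b,g)=(ab,ag+fb)$. Elements of $\mathfrak{C}$ are regarded as elements of $\mathfrak{D}$. *)

theory Defs
  imports
    "HOL-Library.Poly_Mapping"
    "HOL-Computational_Algebra.Polynomial"
    "HOL-Algebra.Module"
    "HOL-Algebra.QuotRing"
    "HOL-Algebra.Ideal_Product"
    "HOL-Algebra.Generated_Groups"
    "Graph_Theory.Arc_Walk"
begin

section \<open>Algebras over a field\<close>

text \<open>
  An associative algebra over the field \<open>'k\<close> is a record of type \<open>('k, 'b) module\<close>; the locale
  \<open>algebra\<close> of HOL-Algebra is not used because it is restricted to commutative algebras. The record
  field \<open>one\<close> is meaningful for unital algebras only: the two infinite algebras below have no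
  identity element, and their \<open>one\<close> is \<open>undefined\<close>.
\<close>

definition alg_quot :: "('k, 'b) module \<Rightarrow> 'b set \<Rightarrow> ('k, 'b set) module" where
  "alg_quot A I =
     \<lparr>carrier = carrier (A Quot I), mult = mult (A Quot I), one = one (A Quot I),
      zero = zero (A Quot I), add = add (A Quot I),
      smult = (\<lambda>c X. \<Union>x\<in>X. I +>\<^bsub>A\<^esub> (c \<odot>\<^bsub>A\<^esub> x))\<rparr>"

definition alg_iso :: "('k, 'b) module \<Rightarrow> ('k, 'c) module \<Rightarrow> ('b \<Rightarrow> 'c) set" where
  "alg_iso A B =
     {h \<in> ring_iso A B. \<forall>c. \<forall>x\<in>carrier A. h (c \<odot>\<^bsub>A\<^esub> x) = c \<odot>\<^bsub>B\<^esub> h x}"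

definition alg_isomorphic :: "('k, 'b) module \<Rightarrow> ('k, 'c) module \<Rightarrow> bool"  (infix \<open>\<cong>\<^sub>a\<^sub>l\<^sub>g\<close> 50) where
  "A \<cong>\<^sub>a\<^sub>l\<^sub>g B \<longleftrightarrow> alg_iso A B \<noteq> {}"

definition finite_dim_alg :: "('k, 'b) module \<Rightarrow> bool" where
  "finite_dim_alg A \<longleftrightarrow>
     (\<exists>B. finite B \<and> B \<subseteq> carrier A \<and>
        (\<forall>x\<in>carrier A. \<exists>c. x = finsum A (\<lambda>b. c b \<odot>\<^bsub>A\<^esub> b) B))"

definition corner :: "('k, 'b) module \<Rightarrow> 'b \<Rightarrow> ('k, 'b) module" where
  "corner B e = B\<lparr>carrier := {e \<otimes>\<^bsub>B\<^esub> x \<otimes>\<^bsub>B\<^esub> e | x. x \<in> carrier B}, one := e\<rparr>"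

text \<open>The ideal \<open>e B f B e\<close> of \<open>e B e\<close>: the additive span of all products \<open>e x f y e\<close>.\<close>

definition corner_ideal :: "('k, 'b) module \<Rightarrow> 'b \<Rightarrow> 'b \<Rightarrow> 'b set" where
  "corner_ideal B e f =
     generate (add_monoid B)
       {e \<otimes>\<^bsub>B\<^esub> x \<otimes>\<^bsub>B\<^esub> f \<otimes>\<^bsub>B\<^esub> y \<otimes>\<^bsub>B\<^esub> e | x y. x \<in> carrier B \<and> y \<in> carrier B}"


section \<open>The radical filtration\<close>

definition left_ideal :: "'b set \<Rightarrow> ('b, 'm) ring_scheme \<Rightarrow> bool" where
  "left_ideal I A \<longleftrightarrow>
     additive_subgroup I A \<and> (\<forall>a\<in>carrier A. \<forall>x\<in>I. a \<otimes>\<^bsub>A\<^esub> x \<in> I)"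

definition maximal_left_ideal :: "'b set \<Rightarrow> ('b, 'm) ring_scheme \<Rightarrow> bool" where
  "maximal_left_ideal M A \<longleftrightarrow>
     left_ideal M A \<and> M \<noteq> carrier A \<and>
     (\<forall>J. left_ideal J A \<and> M \<subseteq> J \<and> J \<noteq> carrier A \<longrightarrow> J = M)"

text \<open>The Jacobson radical; the intersection with the carrier settles the zero algebra.\<close>

definition Rad :: "('b, 'm) ring_scheme \<Rightarrow> 'b set" where
  "Rad A = carrier A \<inter> \<Inter>{M. maximal_left_ideal M A}"

primrec Rad_power :: "('b, 'm) ring_scheme \<Rightarrow> nat \<Rightarrow> 'b set" where
  "Rad_power A 0 = carrier A"
| "Rad_power A (Suc j) = ideal_prod A (Rad A) (Rad_power A j)"

definition Rad_nilpotency :: "('b, 'm) ring_scheme \<Rightarrow> nat" where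
  "Rad_nilpotency A = (LEAST m. Rad_power A m = {\<zero>\<^bsub>A\<^esub>})"


section \<open>Path algebras and quivers with relations\<close>

text \<open>
  A quiver is a (multi-)digraph. A path is a triple of its source, its list of arrows in the order
  in which they are traversed, and its target; the trivial path at \<open>v\<close> is \<open>(v, [], v)\<close>.
\<close>

type_synonym ('v, 'a) qpath = "'v \<times> 'a list \<times> 'v"

definition qpaths :: "('v, 'a) pre_digraph \<Rightarrow> ('v, 'a) qpath set" where
  "qpaths Q = {(u, p, v). pre_digraph.awalk Q u p v}"

text \<open>Paths are composed from right to left: in the product \<open>p q\<close> the path \<open>q\<close> comes first.\<close>

fun path_single_mult ::
    "('v, 'a) qpath \<Rightarrow> 'k::field \<Rightarrow> ('v, 'a) qpath \<Rightarrow> 'k \<Rightarrow> ('v, 'a) qpath \<Rightarrow>\<^sub>0 'k" where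
  "path_single_mult (u', p, v') c (u, q, v) d =
     (if v = u' then Poly_Mapping.single (u, q @ p, v') (c * d) else 0)"

definition path_algebra ::
    "('v, 'a) pre_digraph \<Rightarrow> ('k::field, ('v, 'a) qpath \<Rightarrow>\<^sub>0 'k) module" where
  "path_algebra Q =
     \<lparr>carrier = {x. Poly_Mapping.keys x \<subseteq> qpaths Q},
      mult = (\<lambda>x y. \<Sum>p\<in>Poly_Mapping.keys x. \<Sum>q\<in>Poly_Mapping.keys y.
                path_single_mult p (Poly_Mapping.lookup x p) q (Poly_Mapping.lookup y q)),
      one = (\<Sum>v\<in>verts Q. Poly_Mapping.single (v, [], v) 1),
      zero = 0,
      add = (+),
      smult = (\<lambda>c. Poly_Mapping.map ((*) c))\<rparr>"

definition relation_ideal ::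
    "('v, 'a) pre_digraph \<Rightarrow> (('v, 'a) qpath \<Rightarrow>\<^sub>0 'k::field) set \<Rightarrow> (('v, 'a) qpath \<Rightarrow>\<^sub>0 'k) set" where
  "relation_ideal Q R = Idl\<^bsub>path_algebra Q\<^esub> R"

definition quiver_algebra ::
    "('v, 'a) pre_digraph \<Rightarrow> (('v, 'a) qpath \<Rightarrow>\<^sub>0 'k::field) set \<Rightarrow>
     ('k, (('v, 'a) qpath \<Rightarrow>\<^sub>0 'k) set) module" where
  "quiver_algebra Q R = alg_quot (path_algebra Q) (relation_ideal Q R)"

definition vertex_idem ::
    "('v, 'a) pre_digraph \<Rightarrow> (('v, 'a) qpath \<Rightarrow>\<^sub>0 'k::field) set \<Rightarrow> 'v \<Rightarrow>
     (('v, 'a) qpath \<Rightarrow>\<^sub>0 'k) set" where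
  "vertex_idem Q R v = relation_ideal Q R +>\<^bsub>path_algebra Q\<^esub> Poly_Mapping.single (v, [], v) 1"


section \<open>Attaching a new vertex and a new arrow to each vertex\<close>

text \<open>
  \<open>Inl\<close> marks the vertices and arrows of the given quiver; \<open>Inr k\<close> is the new vertex
  attached to \<open>k\<close>, respectively the new arrow \<open>\<alpha>\<^sub>k : Inl k \<rightarrow> Inr k\<close>.
\<close>

definition tilde_quiver :: "('v, 'a) pre_digraph \<Rightarrow> ('v + 'v, 'a + 'v) pre_digraph" where
  "tilde_quiver Q =
     \<lparr>verts = Inl ` verts Q \<union> Inr ` verts Q,
      arcs = Inl ` arcs Q \<union> Inr ` verts Q,
      tail = case_sum (Inl \<circ> tail Q) Inl,
      head = case_sum (Inl \<circ> head Q) Inr\<rparr>"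

fun tilde_path :: "('v, 'a) qpath \<Rightarrow> ('v + 'v, 'a + 'v) qpath" where
  "tilde_path (u, p, v) = (Inl u, map Inl p, Inl v)"

definition tilde_elem ::
    "(('v, 'a) qpath \<Rightarrow>\<^sub>0 'k::field) \<Rightarrow> (('v + 'v, 'a + 'v) qpath \<Rightarrow>\<^sub>0 'k)" where
  "tilde_elem x =
     (\<Sum>p\<in>Poly_Mapping.keys x. Poly_Mapping.single (tilde_path p) (Poly_Mapping.lookup x p))"

type_synonym ('v, 'a, 'k) tilde_alg_elem = "(('v + 'v, 'a + 'v) qpath \<Rightarrow>\<^sub>0 'k) set"

definition tilde_algebra ::
    "('v, 'a) pre_digraph \<Rightarrow> (('v, 'a) qpath \<Rightarrow>\<^sub>0 'k::field) set \<Rightarrow>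
     ('k, ('v, 'a, 'k) tilde_alg_elem) module" where
  "tilde_algebra Q R = quiver_algebra (tilde_quiver Q) (tilde_elem ` R)"


section \<open>The algebra of matrices \<open>\<CC>(A)\<close>\<close>

text \<open>
  The entry in row \<open>r\<close> and column \<open>c\<close> lies in a subquotient of \<open>A\<close>. All entries are written as
  cosets \<open>mat_den A r c +> x\<close> with \<open>x \<in> mat_num A r c\<close>. Thus \<open>x \<in> I\<^sub>r\<^sub>-\<^sub>c\<close> stands as the singleton
  \<open>{x}\<close> below the diagonal, and for \<open>c - r \<ge> N\<close> the only coset is \<open>A\<close> itself, the zero entry.
\<close>

definition mat_num :: "('k, 'b) module \<Rightarrow> int \<Rightarrow> int \<Rightarrow> 'b set" where
  "mat_num A r c = (if r > c then Rad_power A (nat (r - c)) else carrier A)"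

definition mat_den :: "('k, 'b) module \<Rightarrow> int \<Rightarrow> int \<Rightarrow> 'b set" where
  "mat_den A r c =
     (if r > c then {\<zero>\<^bsub>A\<^esub>}
      else if c - r < int (Rad_nilpotency A) then Rad_power A (Rad_nilpotency A - nat (c - r))
      else carrier A)"

definition mat_entries :: "('k, 'b) module \<Rightarrow> int \<Rightarrow> int \<Rightarrow> 'b set set" where
  "mat_entries A r c = (\<lambda>x. mat_den A r c +>\<^bsub>A\<^esub> x) ` mat_num A r c"

type_synonym 'b zmat = "int \<Rightarrow> int \<Rightarrow> 'b set"

definition entry_mult :: "('k, 'b) module \<Rightarrow> int \<Rightarrow> int \<Rightarrow> 'b set \<Rightarrow> 'b set \<Rightarrow> 'b set" where
  "entry_mult A r c X Y = (\<Union>x\<in>X. \<Union>y\<in>Y. mat_den A r c +>\<^bsub>A\<^esub> (x \<otimes>\<^bsub>A\<^esub> y))"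

definition mat_algebra :: "('k, 'b) module \<Rightarrow> ('k, 'b zmat) module" where
  "mat_algebra A =
     \<lparr>carrier = {X. (\<forall>r c. X r c \<in> mat_entries A r c) \<and>
                    finite {(r, c). X r c \<noteq> mat_den A r c}},
      mult = (\<lambda>X Y r c. finsum (alg_quot A (mat_den A r c))
                (\<lambda>m. entry_mult A r c (X r m) (Y m c))
                {m. X r m \<noteq> mat_den A r m \<and> Y m c \<noteq> mat_den A m c}),
      one = undefined,
      zero = mat_den A,
      add = (\<lambda>X Y r c. add (alg_quot A (mat_den A r c)) (X r c) (Y r c)),
      smult = (\<lambda>a X r c. smult (alg_quot A (mat_den A r c)) a (X r c))\<rparr>"

definition mat_elem :: "('k, 'b) module \<Rightarrow> 'b \<Rightarrow> int \<Rightarrow> int \<Rightarrow> 'b zmat" where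
  "mat_elem A x i j =
     (\<lambda>r c. if r = i \<and> c = j then mat_den A r c +>\<^bsub>A\<^esub> x else mat_den A r c)"


section \<open>Trivial extension by the restricted dual\<close>

text \<open>
  For an algebra \<open>C\<close> that is the direct sum of the spaces \<open>e\<^sub>\<mu> C e\<^sub>\<nu>\<close>, for idempotents \<open>e\<^sub>\<mu>\<close> with
  \<open>\<mu> \<in> K\<close>, the direct sum of the spaces \<open>Hom (e\<^sub>\<mu> C e\<^sub>\<nu>, k)\<close> is taken inside \<open>Hom (C, k)\<close>: it consists
  of the linear functionals that vanish on all but finitely many of the \<open>e\<^sub>\<mu> C e\<^sub>\<nu>\<close>. Functionals are
  extended by \<open>0\<close> outside the carrier.
\<close>

definition restricted_dual ::
    "('k::field, 'c) module \<Rightarrow> 'x set \<Rightarrow> ('x \<Rightarrow> 'c) \<Rightarrow> ('c \<Rightarrow> 'k) set" where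
  "restricted_dual C K e =
     {f. (\<forall>x\<in>carrier C. \<forall>y\<in>carrier C. f (x \<oplus>\<^bsub>C\<^esub> y) = f x + f y) \<and>
         (\<forall>a. \<forall>x\<in>carrier C. f (a \<odot>\<^bsub>C\<^esub> x) = a * f x) \<and>
         (\<forall>x. x \<notin> carrier C \<longrightarrow> f x = 0) \<and>
         finite {(\<mu>, \<nu>) \<in> K \<times> K. \<exists>x\<in>carrier C. f (e \<mu> \<otimes>\<^bsub>C\<^esub> x \<otimes>\<^bsub>C\<^esub> e \<nu>) \<noteq> 0}}"

definition dual_lact :: "('k::field, 'c) module \<Rightarrow> 'c \<Rightarrow> ('c \<Rightarrow> 'k) \<Rightarrow> ('c \<Rightarrow> 'k)" where
  "dual_lact C a f = (\<lambda>x. if x \<in> carrier C then f (x \<otimes>\<^bsub>C\<^esub> a) else 0)"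

definition dual_ract :: "('k::field, 'c) module \<Rightarrow> ('c \<Rightarrow> 'k) \<Rightarrow> 'c \<Rightarrow> ('c \<Rightarrow> 'k)" where
  "dual_ract C f b = (\<lambda>x. if x \<in> carrier C then f (b \<otimes>\<^bsub>C\<^esub> x) else 0)"

definition trivial_extension ::
    "('k::field, 'c) module \<Rightarrow> 'x set \<Rightarrow> ('x \<Rightarrow> 'c) \<Rightarrow> ('k, 'c \<times> ('c \<Rightarrow> 'k)) module" where
  "trivial_extension C K e =
     \<lparr>carrier = carrier C \<times> restricted_dual C K e,
      mult = (\<lambda>(a, f) (b, g). (a \<otimes>\<^bsub>C\<^esub> b, \<lambda>x. dual_lact C a g x + dual_ract C f b x)),
      one = undefined,
      zero = (\<zero>\<^bsub>C\<^esub>, \<lambda>x. 0),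
      add = (\<lambda>(a, f) (b, g). (a \<oplus>\<^bsub>C\<^esub> b, \<lambda>x. f x + g x)),
      smult = (\<lambda>c (a, f). (c \<odot>\<^bsub>C\<^esub> a, \<lambda>x. c * f x))\<rparr>"

definition to_triv_ext :: "'c \<Rightarrow> 'c \<times> ('c \<Rightarrow> 'k::field)" where
  "to_triv_ext a = (a, \<lambda>x. 0)"


section \<open>The algebras \<open>\<CC>\<close> and \<open>\<DD>\<close> of a quiver with relations\<close>

definition frakC ::
    "('v, 'a) pre_digraph \<Rightarrow> (('v, 'a) qpath \<Rightarrow>\<^sub>0 'k::field) set \<Rightarrow>
     ('k, ('v, 'a, 'k) tilde_alg_elem zmat) module" where
  "frakC Q R = mat_algebra (tilde_algebra Q R)"

text \<open>The idempotent \<open>e\<^sub>k\<^sub>,\<^sub>i\<close>, indexed by the pair \<open>(k, i)\<close> of a vertex of the new quiver and a position.\<close>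

definition matrix_idem ::
    "('v, 'a) pre_digraph \<Rightarrow> (('v, 'a) qpath \<Rightarrow>\<^sub>0 'k::field) set \<Rightarrow> ('v + 'v) \<times> int \<Rightarrow>
     ('v, 'a, 'k) tilde_alg_elem zmat" where
  "matrix_idem Q R = (\<lambda>(k, i).
     mat_elem (tilde_algebra Q R) (vertex_idem (tilde_quiver Q) (tilde_elem ` R) k) i i)"

type_synonym ('v, 'a, 'k) frakD_elem =
  "('v, 'a, 'k) tilde_alg_elem zmat \<times> (('v, 'a, 'k) tilde_alg_elem zmat \<Rightarrow> 'k)"

definition frakD ::
    "('v, 'a) pre_digraph \<Rightarrow> (('v, 'a) qpath \<Rightarrow>\<^sub>0 'k::field) set \<Rightarrow>
     ('k, ('v, 'a, 'k) frakD_elem) module" where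
  "frakD Q R = trivial_extension (frakC Q R) (verts (tilde_quiver Q) \<times> UNIV) (matrix_idem Q R)"

definition unit_at ::
    "('v, 'a) pre_digraph \<Rightarrow> (('v, 'a) qpath \<Rightarrow>\<^sub>0 'k::field) set \<Rightarrow> int \<Rightarrow> ('v, 'a, 'k) frakD_elem" where
  "unit_at Q R i =
     (\<Oplus>\<^bsub>frakD Q R\<^esub>k\<in>verts (tilde_quiver Q). to_triv_ext (matrix_idem Q R (k, i)))"

definition tilde_idem ::
    "('v, 'a) pre_digraph \<Rightarrow> (('v, 'a) qpath \<Rightarrow>\<^sub>0 'k::field) set \<Rightarrow> int \<Rightarrow> ('v, 'a, 'k) frakD_elem" where
  "tilde_idem Q R i =
     (\<Oplus>\<^bsub>frakD Q R\<^esub>k\<in>verts Q. to_triv_ext (matrix_idem Q R (Inr k, i)))"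

end

theory Submission
  imports Defs
begin

text \<open>
  Write \<open>A'\<close> for the algebra of the enlarged quiver. Its radical is nilpotent, so the entries of \<open>\<CC>\<close> at the
  position \<open>(i, i)\<close> form \<open>A'\<close> itself, and the restricted dual contributes all linear functionals on \<open>A'\<close>
  to the corner of \<open>\<DD>\<close> at this position. The corner is therefore the trivial extension \<open>A' \<oplus> Hom (A', k)\<close>,
  and the ideal in question is its two-sided ideal generated by the sum \<open>\<epsilon>\<close> of the new vertices.

  No arrow starts at a new vertex. Hence \<open>A' = A \<oplus> \<epsilon> A'\<close>, where \<open>\<epsilon> A'\<close> is the two-sided ideal generated by
  \<open>\<epsilon>\<close> and the kernel of a projection of \<open>A'\<close> onto \<open>A\<close>. It remains to see that the ideal contains every
  functional. A functional that factors through \<open>x \<mapsto> \<epsilon> x\<close> belongs to it. A functional that vanishes on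
  \<open>\<epsilon> A'\<close> depends only on \<open>\<alpha> x\<close>, where \<open>\<alpha>\<close> is the sum of the new arrows, because left multiplication by
  \<open>\<alpha>\<close> is injective on \<open>A\<close>; and \<open>\<alpha> = \<epsilon> \<alpha>\<close>. This is what the new arrows are for. The quotient is
  \<open>A' / \<epsilon> A' = A\<close>.

  The argument is carried by \<open>Rad_power_Rad_nilpotency\<close> (the radical of a finite-dimensional algebra is
  nilpotent), \<open>corner_carrier\<close> and \<open>corner_ideal_product\<close> (the corner and the generators of the ideal),
  \<open>alg_isomorphic_corner_quotient\<close> (the quotient for an abstract pair \<open>\<epsilon>\<close>, \<open>\<alpha>\<close>), and \<open>coeff_maps_I'\<close>, which
  determines the ideal of relations of the enlarged quiver in terms of that of the given one.
\<close>

section \<open>Algebras over a field and their quotients\<close>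

text \<open>
  The scalars form a type class here, whereas the algebra lives on an explicit carrier inside a record
  of the type \<open>module\<close>.
\<close>

locale field_algebra = ring A for A :: "('k::field, 'b) module" (structure) +
  assumes smult_closed [simp, intro]: "x \<in> carrier A \<Longrightarrow> c \<odot> x \<in> carrier A"
    and smult_add_right: "x \<in> carrier A \<Longrightarrow> y \<in> carrier A \<Longrightarrow> c \<odot> (x \<oplus> y) = c \<odot> x \<oplus> c \<odot> y"
    and smult_add_left: "x \<in> carrier A \<Longrightarrow> (c + d) \<odot> x = c \<odot> x \<oplus> d \<odot> x"
    and smult_smult: "x \<in> carrier A \<Longrightarrow> c \<odot> (d \<odot> x) = (c * d) \<odot> x"
    and one_smult: "x \<in> carrier A \<Longrightarrow> 1 \<odot> x = x"
    and smult_mult_left: "x \<in> carrier A \<Longrightarrow> y \<in> carrier A \<Longrightarrow> (c \<odot> x) \<otimes> y = c \<odot> (x \<otimes> y)"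
    and smult_mult_right: "x \<in> carrier A \<Longrightarrow> y \<in> carrier A \<Longrightarrow> x \<otimes> (c \<odot> y) = c \<odot> (x \<otimes> y)"
begin

lemma zero_smult [simp]: "x \<in> carrier A \<Longrightarrow> 0 \<odot> x = \<zero>"
proof -
  assume x: "x \<in> carrier A"
  have "0 \<odot> x \<oplus> 0 \<odot> x = 0 \<odot> x" using smult_add_left[OF x, of 0 0] by simp
  then show ?thesis using x by (simp add: add.l_cancel_one)
qed

lemma smult_zero [simp]: "c \<odot> \<zero> = \<zero>"
  using smult_smult[of \<zero> c 0] by simp

lemma smult_eq_mult: "x \<in> carrier A \<Longrightarrow> c \<odot> x = (c \<odot> \<one>) \<otimes> x"
  by (simp add: smult_mult_left)

lemma smult_minus: "x \<in> carrier A \<Longrightarrow> (- 1) \<odot> x = \<ominus> x"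
proof -
  assume x: "x \<in> carrier A"
  have "(- 1) \<odot> x \<oplus> x = (- 1 + 1) \<odot> x" using x by (simp only: smult_add_left one_smult)
  then show ?thesis using x by (simp add: minus_equality[symmetric])
qed

lemma left_ideal_smult: "left_ideal I A \<Longrightarrow> x \<in> I \<Longrightarrow> c \<odot> x \<in> I"
  by (metis additive_subgroup.a_Hcarr left_ideal_def one_closed smult_closed smult_eq_mult)

lemma ideal_left_ideal: "ideal I A \<Longrightarrow> left_ideal I A"
  by (simp add: left_ideal_def ideal.axioms(1) ideal.I_l_closed)

end

lemma alg_quot_simps [simp]:
  "carrier (alg_quot A I) = a_rcosets\<^bsub>A\<^esub> I"
  "mult (alg_quot A I) = rcoset_mult A I"
  "one (alg_quot A I) = I +>\<^bsub>A\<^esub> \<one>\<^bsub>A\<^esub>"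
  "zero (alg_quot A I) = I"
  "add (alg_quot A I) = set_add A"
  "smult (alg_quot A I) = (\<lambda>c X. \<Union>x\<in>X. I +>\<^bsub>A\<^esub> (c \<odot>\<^bsub>A\<^esub> x))"
  by (simp_all add: alg_quot_def FactRing_def)

lemma a_rcosets_eq: "a_rcosets\<^bsub>A\<^esub> I = (\<lambda>x. I +>\<^bsub>A\<^esub> x) ` carrier A"
  by (auto simp: A_RCOSETS_def RCOSETS_def a_r_coset_def)

lemma UN_eq_constI: "y \<in> S \<Longrightarrow> (\<And>x. x \<in> S \<Longrightarrow> g x = Z) \<Longrightarrow> (\<Union>x\<in>S. g x) = Z"
  by blast

lemma mem_a_r_coset: "z \<in> I +>\<^bsub>A\<^esub> x \<longleftrightarrow> (\<exists>i\<in>I. z = i \<oplus>\<^bsub>A\<^esub> x)"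
  by (auto simp: a_r_coset_def r_coset_def)

lemma alg_quot_abelian_group:
  assumes "abelian_subgroup I A"
  shows "abelian_group (alg_quot A I)"
proof -
  interpret abelian_subgroup I A by fact
  have I: "I = I +>\<^bsub>A\<^esub> \<zero>\<^bsub>A\<^esub>" by (simp add: a_rcos_const)
  show ?thesis
  proof (rule abelian_groupI)
    fix X assume "X \<in> carrier (alg_quot A I)"
    then obtain x where "x \<in> carrier A" "X = I +>\<^bsub>A\<^esub> x" by (auto simp: a_rcosets_eq)
    then show "\<zero>\<^bsub>alg_quot A I\<^esub> \<oplus>\<^bsub>alg_quot A I\<^esub> X = X"
      and "\<exists>Y\<in>carrier (alg_quot A I). Y \<oplus>\<^bsub>alg_quot A I\<^esub> X = \<zero>\<^bsub>alg_quot A I\<^esub>"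
      using a_rcos_sum[of "\<zero>\<^bsub>A\<^esub>" x] a_rcos_sum[of "\<ominus>\<^bsub>A\<^esub> x" x] I
      by (auto simp: a_rcosets_eq l_neg intro!: bexI[of _ "\<ominus>\<^bsub>A\<^esub> x"])
  qed (use I in \<open>auto simp: a_rcosets_eq a_rcos_sum a_ac\<close>)
qed


text \<open>
  A linear map that respects two ideals acts on cosets by collecting the values on all
  representatives, so that no representative has to be chosen.
\<close>

definition coset_map :: "('k, 'c) module \<Rightarrow> 'c set \<Rightarrow> ('b \<Rightarrow> 'c) \<Rightarrow> 'b set \<Rightarrow> 'c set" where
  "coset_map B J f X = (\<Union>x\<in>X. J +>\<^bsub>B\<^esub> f x)"

lemma coset_map_coset:
  assumes "abelian_subgroup I A" "abelian_subgroup J B"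
    and f: "\<And>x. x \<in> carrier A \<Longrightarrow> f x \<in> carrier B"
      "\<And>x y. x \<in> carrier A \<Longrightarrow> y \<in> carrier A \<Longrightarrow> f (x \<oplus>\<^bsub>A\<^esub> y) = f x \<oplus>\<^bsub>B\<^esub> f y"
      "\<And>x. x \<in> I \<Longrightarrow> f x \<in> J"
    and x: "x \<in> carrier A"
  shows "coset_map B J f (I +>\<^bsub>A\<^esub> x) = J +>\<^bsub>B\<^esub> f x"
proof -
  interpret A: abelian_subgroup I A by fact
  interpret B: abelian_subgroup J B by fact
  show ?thesis
    unfolding coset_map_def
  proof (rule UN_eq_constI)
    show "x \<in> I +>\<^bsub>A\<^esub> x" using x by (rule A.a_rcos_self)
    fix y assume "y \<in> I +>\<^bsub>A\<^esub> x"
    then obtain i where i: "i \<in> I" "y = i \<oplus>\<^bsub>A\<^esub> x" by (auto simp: mem_a_r_coset)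
    then have "f y \<in> J +>\<^bsub>B\<^esub> f x" using f x by (auto simp: mem_a_r_coset)
    with f(1)[OF x] show "J +>\<^bsub>B\<^esub> f y = J +>\<^bsub>B\<^esub> f x"
      by (metis B.a_repr_independence')
  qed
qed

context field_algebra
begin

lemma smult_coset:
  assumes "abelian_subgroup I A" "\<And>i. i \<in> I \<Longrightarrow> c \<odot> i \<in> I" "x \<in> carrier A"
  shows "(\<Union>y\<in>I +> x. I +> c \<odot> y) = I +> c \<odot> x"
  using coset_map_coset[of I A I A "\<lambda>x. c \<odot> x"] assms
  by (auto simp: coset_map_def smult_add_right)

lemma left_ideal_smult_coset:
  assumes "left_ideal I A" "x \<in> carrier A"
  shows "(\<Union>y\<in>I +> x. I +> c \<odot> y) = I +> c \<odot> x"
  using assms left_ideal_smult abelian_subgroupI3 abelian_group_axioms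
  by (intro smult_coset) (auto simp: left_ideal_def)

lemma quotient_field_algebra:
  assumes "ideal I A"
  shows "field_algebra (alg_quot A I)"
proof -
  interpret I: ideal I A by fact
  have sm: "c \<odot>\<^bsub>alg_quot A I\<^esub> (I +> x) = I +> c \<odot> x" if "x \<in> carrier A" for x c
    using left_ideal_smult_coset[OF ideal_left_ideal[OF assms] that] by simp
  have 1: "abelian_group (alg_quot A I)"
    by (rule alg_quot_abelian_group) (rule I.abelian_subgroup_axioms)
  have 2: "Group.monoid (alg_quot A I)"
    by (rule monoidI) (auto simp: a_rcosets_eq I.rcoset_mult_add m_assoc)
  have "ring (alg_quot A I)"
    using 1 2 by (rule ringI) (auto simp: a_rcosets_eq I.rcoset_mult_add I.a_rcos_sum l_distr r_distr)
  then show ?thesis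
    by (rule field_algebra.intro)
      (unfold_locales; clarsimp simp: a_rcosets_eq I.rcoset_mult_add I.a_rcos_sum sm smult_add_left
        smult_add_right smult_smult one_smult smult_mult_left smult_mult_right
        simp del: alg_quot_simps(6); auto simp del: alg_quot_simps(6))
qed

end

lemma finsum_coset:
  assumes "ideal I P" "finite S" "\<And>k. k \<in> S \<Longrightarrow> x k \<in> carrier P"
  shows "finsum (alg_quot P I) (\<lambda>k. I +>\<^bsub>P\<^esub> x k) S = I +>\<^bsub>P\<^esub> finsum P x S"
proof -
  interpret I: ideal I P by fact
  interpret Q: abelian_group "alg_quot P I"
    by (rule alg_quot_abelian_group) (rule I.abelian_subgroup_axioms)
  show ?thesis
    using assms(2,3)
  proof (induction S)
    case empty
    show ?case using Q.finsum_empty by (simp add: I.a_rcos_const)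
  next
    case (insert k S)
    have "finsum (alg_quot P I) (\<lambda>k. I +>\<^bsub>P\<^esub> x k) (insert k S)
      = (I +>\<^bsub>P\<^esub> x k) \<oplus>\<^bsub>alg_quot P I\<^esub> finsum (alg_quot P I) (\<lambda>k. I +>\<^bsub>P\<^esub> x k) S"
      using insert by (intro Q.finsum_insert) (auto simp: a_rcosets_eq)
    then show ?case using insert by (simp add: I.a_rcos_sum Pi_def)
  qed
qed

lemma (in ring) two_sided_idealI:
  assumes "I \<subseteq> carrier R" "\<zero> \<in> I" "\<And>x y. x \<in> I \<Longrightarrow> y \<in> I \<Longrightarrow> x \<oplus> y \<in> I"
    and l: "\<And>a x. a \<in> carrier R \<Longrightarrow> x \<in> I \<Longrightarrow> a \<otimes> x \<in> I"
    and r: "\<And>a x. a \<in> carrier R \<Longrightarrow> x \<in> I \<Longrightarrow> x \<otimes> a \<in> I"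
  shows "ideal I R"
proof (rule idealI)
  have "\<ominus> x \<in> I" if "x \<in> I" for x
    using l[of "\<ominus> \<one>" x] that assms(1) by (auto simp: l_minus)
  then show "subgroup I (add_monoid R)"
    using assms(1-3) by (intro add.subgroupI) (auto simp flip: a_inv_def)
qed (use l r ring_axioms in auto)

text \<open>
  The first isomorphism theorem, read backwards: the isomorphism sends an element of \<open>A\<close> to its
  fibre under \<open>\<psi>\<close>. Additivity makes the fibres the cosets of the kernel, and then the product of
  two cosets is again a fibre because \<open>\<psi>\<close> is multiplicative.
\<close>

lemma alg_isomorphic_alg_quot_kernel:
  assumes "abelian_group B" "abelian_group A"
    and \<psi>: "\<psi> ` carrier B = carrier A"
    and add: "\<And>x y. x \<in> carrier B \<Longrightarrow> y \<in> carrier B \<Longrightarrow> \<psi> (x \<oplus>\<^bsub>B\<^esub> y) = \<psi> x \<oplus>\<^bsub>A\<^esub> \<psi> y"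
    and mult_closed: "\<And>x y. x \<in> carrier B \<Longrightarrow> y \<in> carrier B \<Longrightarrow> x \<otimes>\<^bsub>B\<^esub> y \<in> carrier B"
    and mult: "\<And>x y. x \<in> carrier B \<Longrightarrow> y \<in> carrier B \<Longrightarrow> \<psi> (x \<otimes>\<^bsub>B\<^esub> y) = \<psi> x \<otimes>\<^bsub>A\<^esub> \<psi> y"
    and one: "\<one>\<^bsub>B\<^esub> \<in> carrier B" "\<psi> \<one>\<^bsub>B\<^esub> = \<one>\<^bsub>A\<^esub>"
    and smult_closed: "\<And>c x. x \<in> carrier B \<Longrightarrow> c \<odot>\<^bsub>B\<^esub> x \<in> carrier B"
    and smult: "\<And>c x. x \<in> carrier B \<Longrightarrow> \<psi> (c \<odot>\<^bsub>B\<^esub> x) = c \<odot>\<^bsub>A\<^esub> \<psi> x"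
    and K: "K = {x \<in> carrier B. \<psi> x = \<zero>\<^bsub>A\<^esub>}"
  shows "A \<cong>\<^sub>a\<^sub>l\<^sub>g alg_quot B K"
proof -
  interpret B: abelian_group B by fact
  interpret A: abelian_group A by fact
  define F where "F a = {x \<in> carrier B. \<psi> x = a}" for a
  have \<psi>_in: "\<psi> x \<in> carrier A" if "x \<in> carrier B" for x using \<psi> that by blast
  have fibre: "K +>\<^bsub>B\<^esub> x = F (\<psi> x)" if x: "x \<in> carrier B" for x
  proof
    show "K +>\<^bsub>B\<^esub> x \<subseteq> F (\<psi> x)"
      using x \<psi>_in by (auto simp: mem_a_r_coset K F_def add)
    show "F (\<psi> x) \<subseteq> K +>\<^bsub>B\<^esub> x"
    proof
      fix y assume "y \<in> F (\<psi> x)"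
      then have y: "y \<in> carrier B" "\<psi> y = \<psi> x" by (auto simp: F_def)
      have yx: "y = (y \<ominus>\<^bsub>B\<^esub> x) \<oplus>\<^bsub>B\<^esub> x"
        using x y by (simp add: a_minus_def B.a_assoc B.l_neg)
      have "\<psi> (y \<ominus>\<^bsub>B\<^esub> x) \<oplus>\<^bsub>A\<^esub> \<psi> x = \<psi> y"
        using yx x y add[of "y \<ominus>\<^bsub>B\<^esub> x" x] by simp
      then have "\<psi> (y \<ominus>\<^bsub>B\<^esub> x) = \<zero>\<^bsub>A\<^esub>"
        using x y \<psi>_in[OF x] \<psi>_in[of "y \<ominus>\<^bsub>B\<^esub> x"] by (simp add: A.add.r_cancel_one)
      then show "y \<in> K +>\<^bsub>B\<^esub> x" using yx x y by (auto simp: mem_a_r_coset K)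
    qed
  qed
  have pre: "\<exists>x\<in>carrier B. a = \<psi> x" if "a \<in> carrier A" for a using \<psi> that by blast
  have F_add: "F (a \<oplus>\<^bsub>A\<^esub> b) = F a <+>\<^bsub>B\<^esub> F b" if ab: "a \<in> carrier A" "b \<in> carrier A" for a b
  proof
    show "F a <+>\<^bsub>B\<^esub> F b \<subseteq> F (a \<oplus>\<^bsub>A\<^esub> b)"
      by (auto simp: set_add_def' F_def add)
    show "F (a \<oplus>\<^bsub>A\<^esub> b) \<subseteq> F a <+>\<^bsub>B\<^esub> F b"
    proof
      fix z assume "z \<in> F (a \<oplus>\<^bsub>A\<^esub> b)"
      moreover obtain x y where xy: "x \<in> carrier B" "a = \<psi> x" "y \<in> carrier B" "b = \<psi> y"
        using pre[OF ab(1)] pre[OF ab(2)] by blast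
      ultimately have "z \<in> K +>\<^bsub>B\<^esub> (x \<oplus>\<^bsub>B\<^esub> y)" by (simp add: fibre add)
      then obtain k where k: "k \<in> K" "z = k \<oplus>\<^bsub>B\<^esub> (x \<oplus>\<^bsub>B\<^esub> y)" by (auto simp: mem_a_r_coset)
      then have "z = (k \<oplus>\<^bsub>B\<^esub> x) \<oplus>\<^bsub>B\<^esub> y" "k \<oplus>\<^bsub>B\<^esub> x \<in> F a"
        using xy \<psi>_in by (auto simp: K F_def add B.a_assoc)
      then show "z \<in> F a <+>\<^bsub>B\<^esub> F b" using xy by (auto simp: set_add_def' F_def)
    qed
  qed
  have nonempty: "\<exists>x. x \<in> F a" if "a \<in> carrier A" for a using pre[OF that] by (auto simp: F_def)
  have F_mult: "F (a \<otimes>\<^bsub>A\<^esub> b) = rcoset_mult B K (F a) (F b)"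
    if ab: "a \<in> carrier A" "b \<in> carrier A" for a b
  proof -
    have "K +>\<^bsub>B\<^esub> (x \<otimes>\<^bsub>B\<^esub> y) = F (a \<otimes>\<^bsub>A\<^esub> b)" if "x \<in> F a" "y \<in> F b" for x y
      using that by (simp add: F_def[of a] F_def[of b] fibre mult_closed mult)
    note coset = this
    obtain x where x: "x \<in> F a" using nonempty[OF ab(1)] ..
    obtain y where y: "y \<in> F b" using nonempty[OF ab(2)] ..
    have "(\<Union>y\<in>F b. K +>\<^bsub>B\<^esub> (x \<otimes>\<^bsub>B\<^esub> y)) = F (a \<otimes>\<^bsub>A\<^esub> b)" if "x \<in> F a" for x
      using y coset[OF that] by (rule UN_eq_constI)
    with x show ?thesis unfolding rcoset_mult_def by (rule UN_eq_constI[symmetric])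
  qed
  have F_smult: "F (c \<odot>\<^bsub>A\<^esub> a) = (\<Union>x\<in>F a. K +>\<^bsub>B\<^esub> (c \<odot>\<^bsub>B\<^esub> x))" if "a \<in> carrier A" for a c
  proof -
    have "K +>\<^bsub>B\<^esub> (c \<odot>\<^bsub>B\<^esub> x) = F (c \<odot>\<^bsub>A\<^esub> a)" if "x \<in> F a" for x
      using that by (simp add: F_def[of a] fibre smult_closed smult)
    with nonempty that show ?thesis by auto
  qed
  have "bij_betw F (carrier A) (carrier (alg_quot B K))"
  proof (rule bij_betw_imageI)
    show "inj_on F (carrier A)"
      using nonempty by (intro inj_onI) (fastforce simp: F_def)
    show "F ` carrier A = carrier (alg_quot B K)"
      using fibre by (auto simp: a_rcosets_eq \<psi>[symmetric] image_image intro!: image_cong)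
  qed
  moreover have "F \<in> ring_hom A (alg_quot B K)"
    by (rule ring_hom_memI)
      (use calculation fibre[OF one(1)] one in \<open>auto simp: F_add F_mult bij_betw_def simp del: alg_quot_simps(1)\<close>)
  ultimately have "F \<in> alg_iso A (alg_quot B K)"
    by (auto simp: alg_iso_def ring_iso_def F_smult)
  then show ?thesis unfolding alg_isomorphic_def by blast
qed

section \<open>Path algebras\<close>

lemma poly_mapping_eq_sum_single:
  "x = (\<Sum>p\<in>Poly_Mapping.keys x. Poly_Mapping.single p (Poly_Mapping.lookup x p))"
  by (rule poly_mapping_eqI)
    (auto simp: lookup_sum lookup_single in_keys_iff when_def sum.delta split: if_splits)

text \<open>
  Identities that are linear in \<open>x\<close> need only be checked on the basis. The set \<open>S\<close> restricts the basis
  to the paths of a given quiver.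
\<close>

lemma poly_mapping_keys_induct [consumes 1, case_names zero single add]:
  fixes x :: "'p \<Rightarrow>\<^sub>0 'm::comm_monoid_add"
  assumes "Poly_Mapping.keys x \<subseteq> S"
    and zero: "P 0"
    and single: "\<And>p c. p \<in> S \<Longrightarrow> P (Poly_Mapping.single p c)"
    and add: "\<And>x y. P x \<Longrightarrow> P y \<Longrightarrow> P (x + y)"
  shows "P x"
proof -
  have "P (\<Sum>p\<in>F. Poly_Mapping.single p (Poly_Mapping.lookup x p))" if "finite F" "F \<subseteq> S" for F
    using that by (induction F) (auto simp: zero intro!: add single)
  from this[OF finite_keys assms(1)] show ?thesis
    by (subst poly_mapping_eq_sum_single)
qed

lemma map_scale_add:
  "Poly_Mapping.map ((*) (c::'k::semiring_0)) (x + y)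
     = Poly_Mapping.map ((*) c) x + Poly_Mapping.map ((*) c) y"
  by (rule poly_mapping_eqI) (simp add: Poly_Mapping.map.rep_eq lookup_add when_def flip: distrib_left)

lemma map_scale_zero [simp]: "Poly_Mapping.map ((*) (c::'k::semiring_0)) 0 = 0"
  by (rule poly_mapping_eqI) (simp add: Poly_Mapping.map.rep_eq)

lemma map_scale_single [simp]:
  "Poly_Mapping.map ((*) (c::'k::semiring_0)) (Poly_Mapping.single p d) = Poly_Mapping.single p (c * d)"
  by (rule poly_mapping_eqI) (simp add: Poly_Mapping.map.rep_eq lookup_single when_def)

text \<open>The product of a path algebra does not depend on the quiver, hence this name for it.\<close>

definition path_mult ::
    "(('v, 'a) qpath \<Rightarrow>\<^sub>0 'k::field) \<Rightarrow> (('v, 'a) qpath \<Rightarrow>\<^sub>0 'k) \<Rightarrow> (('v, 'a) qpath \<Rightarrow>\<^sub>0 'k)" where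
  "path_mult x y = (\<Sum>p\<in>Poly_Mapping.keys x. \<Sum>q\<in>Poly_Mapping.keys y.
     path_single_mult p (Poly_Mapping.lookup x p) q (Poly_Mapping.lookup y q))"

lemma path_single_mult_zero [simp]:
  "path_single_mult p 0 q d = 0" "path_single_mult p c q 0 = 0"
  by (cases p; cases q; simp)+

lemma path_single_mult_add:
  "path_single_mult p (c + c') q d = path_single_mult p c q d + path_single_mult p c' q d"
  "path_single_mult p c q (d + d') = path_single_mult p c q d + path_single_mult p c q d'"
  by (cases p; cases q; simp add: distrib_right distrib_left single_add)+

lemma path_mult_add_left: "path_mult (x + x') y = path_mult x y + path_mult x' y"
  unfolding path_mult_def
  by (rule setsum_keys_plus_distrib) (simp_all add: path_single_mult_add sum.distrib)

lemma path_mult_add_right: "path_mult x (y + y') = path_mult x y + path_mult x y'"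
  unfolding path_mult_def sum.distrib[symmetric]
  by (rule sum.cong[OF refl], rule setsum_keys_plus_distrib) (simp_all add: path_single_mult_add)

lemma path_mult_zero [simp]: "path_mult 0 y = 0" "path_mult x 0 = 0"
  by (simp_all add: path_mult_def)

lemma path_mult_sum_left: "path_mult (sum f S) y = (\<Sum>i\<in>S. path_mult (f i) y)"
  by (induction S rule: infinite_finite_induct) (simp_all add: path_mult_add_left)

lemma path_mult_sum_right: "path_mult x (sum f S) = (\<Sum>i\<in>S. path_mult x (f i))"
  by (induction S rule: infinite_finite_induct) (simp_all add: path_mult_add_right)

lemma path_mult_single:
  "path_mult (Poly_Mapping.single (u', p, v') c) (Poly_Mapping.single (u, q, v) d)
     = (if v = u' then Poly_Mapping.single (u, q @ p, v') (c * d) else 0)"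
  by (cases "c = 0"; cases "d = 0") (simp_all add: path_mult_def)

lemma path_mult_assoc:
  fixes x :: "('v, 'a) qpath \<Rightarrow>\<^sub>0 'k::field"
  shows "path_mult (path_mult x y) z = path_mult x (path_mult y z)"
proof -
  have "path_mult (path_mult (Poly_Mapping.single p a) (Poly_Mapping.single q b)) (Poly_Mapping.single r c)
      = path_mult (Poly_Mapping.single p a) (path_mult (Poly_Mapping.single q b) (Poly_Mapping.single r c))"
    for p q r :: "('v, 'a) qpath" and a b c :: 'k
    by (cases p; cases q; cases r) (simp add: path_mult_single mult.assoc)
  then have "path_mult (path_mult (Poly_Mapping.single p a) (Poly_Mapping.single q b)) z
      = path_mult (Poly_Mapping.single p a) (path_mult (Poly_Mapping.single q b) z)"
    for p q :: "('v, 'a) qpath" and a b :: 'k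
    by (induction z rule: poly_mapping_keys_induct[OF subset_UNIV]) (simp_all add: path_mult_add_right)
  then have "path_mult (path_mult (Poly_Mapping.single p a) y) z
      = path_mult (Poly_Mapping.single p a) (path_mult y z)"
    for p :: "('v, 'a) qpath" and a :: 'k
    by (induction y rule: poly_mapping_keys_induct[OF subset_UNIV])
      (simp_all add: path_mult_add_right path_mult_add_left)
  then show ?thesis
    by (induction x rule: poly_mapping_keys_induct[OF subset_UNIV])
      (simp_all add: path_mult_add_left)
qed

lemma path_mult_scale:
  fixes x :: "('v, 'a) qpath \<Rightarrow>\<^sub>0 'k::field"
  shows "path_mult (Poly_Mapping.map ((*) c) x) y = Poly_Mapping.map ((*) c) (path_mult x y)"
    and "path_mult x (Poly_Mapping.map ((*) c) y) = Poly_Mapping.map ((*) c) (path_mult x y)"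
proof -
  have "path_mult (Poly_Mapping.single p (c * a)) (Poly_Mapping.single q b)
      = Poly_Mapping.map ((*) c) (path_mult (Poly_Mapping.single p a) (Poly_Mapping.single q b))"
    and "path_mult (Poly_Mapping.single p a) (Poly_Mapping.single q (c * b))
      = Poly_Mapping.map ((*) c) (path_mult (Poly_Mapping.single p a) (Poly_Mapping.single q b))"
    for p q :: "('v, 'a) qpath" and a b :: 'k
    by (cases p; cases q; simp add: path_mult_single mult_ac)+
  then have "path_mult (Poly_Mapping.single p (c * a)) y
      = Poly_Mapping.map ((*) c) (path_mult (Poly_Mapping.single p a) y)"
    and "path_mult (Poly_Mapping.single p a) (Poly_Mapping.map ((*) c) y)
      = Poly_Mapping.map ((*) c) (path_mult (Poly_Mapping.single p a) y)"
    for p :: "('v, 'a) qpath" and a :: 'k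
    by (induction y rule: poly_mapping_keys_induct[OF subset_UNIV])
      (simp_all add: path_mult_add_right map_scale_add)
  then show "path_mult (Poly_Mapping.map ((*) c) x) y = Poly_Mapping.map ((*) c) (path_mult x y)"
    and "path_mult x (Poly_Mapping.map ((*) c) y) = Poly_Mapping.map ((*) c) (path_mult x y)"
    by (induction x rule: poly_mapping_keys_induct[OF subset_UNIV])
      (simp_all add: path_mult_add_left map_scale_add)
qed

lemma path_algebra_simps [simp]:
  "carrier (path_algebra Q) = {x. Poly_Mapping.keys x \<subseteq> qpaths Q}"
  "mult (path_algebra Q) = path_mult"
  "one (path_algebra Q) = (\<Sum>v\<in>verts Q. Poly_Mapping.single (v, [], v) 1)"
  "zero (path_algebra Q) = 0"
  "add (path_algebra Q) = (+)"
  "smult (path_algebra Q) = (\<lambda>c. Poly_Mapping.map ((*) c))"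
  by (simp_all add: path_algebra_def path_mult_def fun_eq_iff)

lemma (in wf_digraph) qpaths_append:
  "(u, p, v) \<in> qpaths G \<Longrightarrow> (v, q, w) \<in> qpaths G \<Longrightarrow> (u, p @ q, w) \<in> qpaths G"
  by (auto simp: qpaths_def intro: awalk_appendI)

lemma (in wf_digraph) qpaths_verts: "(u, p, v) \<in> qpaths G \<Longrightarrow> u \<in> verts G \<and> v \<in> verts G"
  by (auto simp: qpaths_def awalk_last_in_verts)

lemma (in pre_digraph) trivial_qpath [simp]: "v \<in> verts G \<Longrightarrow> (v, [], v) \<in> qpaths G"
  by (simp add: qpaths_def awalk_def)

lemma keys_add_subset: "Poly_Mapping.keys x \<subseteq> S \<Longrightarrow> Poly_Mapping.keys y \<subseteq> S \<Longrightarrow> Poly_Mapping.keys (x + y) \<subseteq> S"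
  using Poly_Mapping.keys_add[of x y] by blast

lemma (in wf_digraph) keys_path_mult:
  assumes x: "Poly_Mapping.keys x \<subseteq> qpaths G" and y: "Poly_Mapping.keys y \<subseteq> qpaths G"
  shows "Poly_Mapping.keys (path_mult x y) \<subseteq> qpaths G"
  using x
proof (induction x rule: poly_mapping_keys_induct)
  case (single p c)
  show ?case
    using y
  proof (induction y rule: poly_mapping_keys_induct)
    case (single q d)
    then show ?case
      using \<open>p \<in> qpaths G\<close> qpaths_append
      by (cases p; cases q) (auto simp: path_mult_single)
  qed (simp_all add: path_mult_add_right keys_add_subset)
qed (simp_all add: path_mult_add_left keys_add_subset)

lemma (in fin_digraph) path_mult_one:
  assumes "Poly_Mapping.keys x \<subseteq> qpaths G"
  shows "path_mult (\<Sum>v\<in>verts G. Poly_Mapping.single (v, [], v) 1) x = x"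
    and "path_mult x (\<Sum>v\<in>verts G. Poly_Mapping.single (v, [], v) 1) = x"
proof -
  show "path_mult (\<Sum>v\<in>verts G. Poly_Mapping.single (v, [], v) 1) x = x"
    using assms
  proof (induction x rule: poly_mapping_keys_induct)
    case (single p c)
    then show ?case
      using qpaths_verts by (cases p) (simp add: path_mult_sum_left path_mult_single sum.delta)
  qed (simp_all add: path_mult_add_right)
  show "path_mult x (\<Sum>v\<in>verts G. Poly_Mapping.single (v, [], v) 1) = x"
    using assms
  proof (induction x rule: poly_mapping_keys_induct)
    case (single p c)
    then show ?case
      using qpaths_verts by (cases p) (simp add: path_mult_sum_right path_mult_single sum.delta')
  qed (simp_all add: path_mult_add_left)
qed

lemma keys_sum_subset:
  "(\<And>i. i \<in> S \<Longrightarrow> Poly_Mapping.keys (f i) \<subseteq> T) \<Longrightarrow> Poly_Mapping.keys (sum f S) \<subseteq> T"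
  by (induction S rule: infinite_finite_induct) (simp_all add: keys_add_subset)

lemma (in fin_digraph) path_algebra_field_algebra:
  "field_algebra (path_algebra G :: ('k::field, ('a, 'b) qpath \<Rightarrow>\<^sub>0 'k) module)"
proof -
  let ?P = "path_algebra G :: ('k, ('a, 'b) qpath \<Rightarrow>\<^sub>0 'k) module"
  have 1: "abelian_group ?P"
  proof (rule abelian_groupI)
    fix x assume "x \<in> carrier ?P"
    then show "\<exists>y\<in>carrier ?P. y \<oplus>\<^bsub>?P\<^esub> x = \<zero>\<^bsub>?P\<^esub>"
      by (intro bexI[of _ "- x"]) auto
  qed (auto simp: keys_add_subset add.assoc add.commute)
  have 2: "Group.monoid ?P"
    by (rule monoidI)
      (auto simp: keys_path_mult path_mult_assoc path_mult_one intro!: keys_sum_subset)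
  have "ring ?P"
    using 1 2 by (rule ringI) (simp_all add: path_mult_add_left path_mult_add_right)
  moreover have "field_algebra_axioms ?P"
  proof
    fix x :: "('a, 'b) qpath \<Rightarrow>\<^sub>0 'k" and c d :: 'k
    assume "x \<in> carrier ?P"
    show "c \<odot>\<^bsub>?P\<^esub> x \<in> carrier ?P"
      using \<open>x \<in> carrier ?P\<close> by (auto simp: in_keys_iff Poly_Mapping.map.rep_eq when_def split: if_splits)
    show "(c + d) \<odot>\<^bsub>?P\<^esub> x = c \<odot>\<^bsub>?P\<^esub> x \<oplus>\<^bsub>?P\<^esub> d \<odot>\<^bsub>?P\<^esub> x"
      and "c \<odot>\<^bsub>?P\<^esub> (d \<odot>\<^bsub>?P\<^esub> x) = (c * d) \<odot>\<^bsub>?P\<^esub> x" and "1 \<odot>\<^bsub>?P\<^esub> x = x"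
      by (auto intro!: poly_mapping_eqI
          simp: Poly_Mapping.map.rep_eq when_def lookup_add distrib_right mult.assoc)
  qed (simp_all add: map_scale_add path_mult_scale)
  ultimately show ?thesis by (rule field_algebra.intro)
qed

section \<open>Nilpotency of the radical\<close>

primrec (in field_algebra) list_span :: "'b list \<Rightarrow> 'b set" where
  "list_span [] = {\<zero>}"
| "list_span (b # bs) = {c \<odot> b \<oplus> v | c v. v \<in> list_span bs}"

context field_algebra
begin

lemma list_span_carrier: "set bs \<subseteq> carrier A \<Longrightarrow> list_span bs \<subseteq> carrier A"
  by (induction bs) auto

lemma zero_in_list_span: "set bs \<subseteq> carrier A \<Longrightarrow> \<zero> \<in> list_span bs"
proof (induction bs)
  case (Cons b bs)
  then have "\<zero> = 0 \<odot> b \<oplus> \<zero>" "\<zero> \<in> list_span bs" by simp_all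
  then show ?case unfolding list_span.simps by blast
qed simp

lemma list_span_add:
  "set bs \<subseteq> carrier A \<Longrightarrow> x \<in> list_span bs \<Longrightarrow> y \<in> list_span bs \<Longrightarrow> x \<oplus> y \<in> list_span bs"
proof (induction bs arbitrary: x y)
  case (Cons b bs)
  then obtain c u d v where xy: "x = c \<odot> b \<oplus> u" "u \<in> list_span bs" "y = d \<odot> b \<oplus> v" "v \<in> list_span bs"
    by auto
  have "u \<in> carrier A" "v \<in> carrier A" "b \<in> carrier A"
    using xy Cons.prems list_span_carrier[of bs] by auto
  then have "x \<oplus> y = (c + d) \<odot> b \<oplus> (u \<oplus> v)"
    unfolding xy by (simp add: smult_add_left a_ac)
  moreover have "u \<oplus> v \<in> list_span bs" using Cons xy by simp
  ultimately show ?case by auto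
qed simp

lemma list_span_smult:
  "set bs \<subseteq> carrier A \<Longrightarrow> x \<in> list_span bs \<Longrightarrow> c \<odot> x \<in> list_span bs"
proof (induction bs arbitrary: x)
  case (Cons b bs)
  then obtain d v where x: "x = d \<odot> b \<oplus> v" "v \<in> list_span bs" by auto
  moreover have "v \<in> carrier A" "b \<in> carrier A"
    using x Cons.prems list_span_carrier[of bs] by auto
  ultimately have "c \<odot> x = (c * d) \<odot> b \<oplus> c \<odot> v" by (simp add: smult_add_right smult_smult)
  moreover have "c \<odot> v \<in> list_span bs" using Cons x by simp
  ultimately show ?case by auto
qed simp

lemma set_subset_list_span: "set bs \<subseteq> carrier A \<Longrightarrow> set bs \<subseteq> list_span bs"
proof (induction bs)
  case (Cons b bs)
  have "b = 1 \<odot> b \<oplus> \<zero>" using Cons.prems by (simp add: one_smult)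
  then have "b \<in> list_span (b # bs)"
    using Cons.prems zero_in_list_span[of bs] unfolding list_span.simps mem_Collect_eq by force
  moreover have "x \<in> list_span (b # bs)" if "x \<in> list_span bs" for x
  proof -
    have "x = 0 \<odot> b \<oplus> x" using that Cons.prems list_span_carrier[of bs] by auto
    then show ?thesis using that by auto
  qed
  ultimately show ?case using Cons by auto
qed simp

lemma list_span_image:
  fixes B :: "('k, 'c) module"
  assumes "field_algebra B"
    and f: "\<And>x. x \<in> carrier A \<Longrightarrow> f x \<in> carrier B"
      "\<And>x y. x \<in> carrier A \<Longrightarrow> y \<in> carrier A \<Longrightarrow> f (x \<oplus> y) = f x \<oplus>\<^bsub>B\<^esub> f y"
      "\<And>c x. x \<in> carrier A \<Longrightarrow> f (c \<odot> x) = c \<odot>\<^bsub>B\<^esub> f x"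
    and bs: "set bs \<subseteq> carrier A" and cs: "set cs \<subseteq> carrier B" "f ` set bs \<subseteq> set cs"
    and x: "x \<in> list_span bs"
  shows "f x \<in> field_algebra.list_span B cs"
proof -
  interpret B: field_algebra B by fact
  show ?thesis
    using bs cs(2) x
  proof (induction bs arbitrary: x)
    case Nil
    have "f \<zero> = \<zero>\<^bsub>B\<^esub>" using f(3)[OF zero_closed, of 0] f(1)[OF zero_closed] by simp
    then show ?case using Nil B.zero_in_list_span[OF cs(1)] by simp
  next
    case (Cons b bs)
    then obtain c v where x: "x = c \<odot> b \<oplus> v" "v \<in> list_span bs" by auto
    have b: "b \<in> carrier A" "v \<in> carrier A" using Cons.prems x list_span_carrier[of bs] by auto
    have "f b \<in> B.list_span cs" using Cons.prems(2) B.set_subset_list_span[OF cs(1)] by auto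
    moreover have "f v \<in> B.list_span cs" using Cons x by simp
    moreover have "f x = c \<odot>\<^bsub>B\<^esub> f b \<oplus>\<^bsub>B\<^esub> f v" using x b f by simp
    ultimately show ?case using cs(1) by (simp add: B.list_span_add B.list_span_smult)
  qed
qed

lemma finite_dim_list_span:
  assumes "finite_dim_alg A"
  obtains bs where "set bs \<subseteq> carrier A" "carrier A \<subseteq> list_span bs"
proof -
  obtain B where B: "finite B" "B \<subseteq> carrier A"
    and span: "\<And>x. x \<in> carrier A \<Longrightarrow> \<exists>c. x = finsum A (\<lambda>b. c b \<odot> b) B"
    using assms unfolding finite_dim_alg_def by blast
  obtain bs where bs: "set bs = B" using \<open>finite B\<close> finite_list by blast
  have "finsum A (\<lambda>b. c b \<odot> b) F \<in> list_span bs" if "F \<subseteq> B" for c F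
    using finite_subset[OF that \<open>finite B\<close>] that
  proof (induction F)
    case empty
    then show ?case using zero_in_list_span bs B by simp
  next
    case (insert b F)
    then have "finsum A (\<lambda>b. c b \<odot> b) (insert b F) = c b \<odot> b \<oplus> finsum A (\<lambda>b. c b \<odot> b) F"
      using B by (intro finsum_insert) auto
    then show ?case
      using insert bs B set_subset_list_span[of bs] by (auto intro!: list_span_add list_span_smult)
  qed
  then have "carrier A \<subseteq> list_span bs" using span by blast
  with bs B that show ?thesis by blast
qed

text \<open>
  The steps at which \<open>U\<close> acquires a new element, in the flag of subspaces spanned by the tails of \<open>bs\<close>.
  Their number \<open>flag_dim\<close> stands for the dimension of \<open>U\<close>.
\<close>

definition jumps :: "'b list \<Rightarrow> 'b set \<Rightarrow> nat set" where
  "jumps bs U = {j. j < length bs \<and> (\<exists>x\<in>U. x \<in> list_span (drop j bs) \<and> x \<notin> list_span (drop (Suc j) bs))}"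

definition flag_dim :: "'b list \<Rightarrow> 'b set \<Rightarrow> nat" where
  "flag_dim bs U = card (jumps bs U)"

lemma finite_jumps [simp]: "finite (jumps bs U)"
  by (rule finite_subset[of _ "{..<length bs}"]) (auto simp: jumps_def)

lemma flag_dim_le: "flag_dim bs U \<le> length bs"
  unfolding flag_dim_def
  by (rule card_mono[of "{..<length bs}", simplified]) (auto simp: jumps_def)

lemma left_idealD:
  assumes "left_ideal I A"
  shows "I \<subseteq> carrier A" and "\<zero> \<in> I" and "x \<in> I \<Longrightarrow> y \<in> I \<Longrightarrow> x \<oplus> y \<in> I"
    and "x \<in> I \<Longrightarrow> \<ominus> x \<in> I" and "x \<in> I \<Longrightarrow> y \<in> I \<Longrightarrow> x \<ominus> y \<in> I"
    and "a \<in> carrier A \<Longrightarrow> x \<in> I \<Longrightarrow> a \<otimes> x \<in> I"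
proof -
  interpret additive_subgroup I A using assms by (simp add: left_ideal_def)
  show "I \<subseteq> carrier A" by (rule a_subset)
  show "\<zero> \<in> I" "x \<in> I \<Longrightarrow> y \<in> I \<Longrightarrow> x \<oplus> y \<in> I" "x \<in> I \<Longrightarrow> \<ominus> x \<in> I" by simp_all
  show "x \<in> I \<Longrightarrow> y \<in> I \<Longrightarrow> x \<ominus> y \<in> I" by (simp add: a_minus_def)
  show "a \<in> carrier A \<Longrightarrow> x \<in> I \<Longrightarrow> a \<otimes> x \<in> I" using assms by (simp add: left_ideal_def)
qed

lemma left_idealI:
  assumes "I \<subseteq> carrier A" "\<zero> \<in> I" "\<And>x y. x \<in> I \<Longrightarrow> y \<in> I \<Longrightarrow> x \<oplus> y \<in> I"
    and l: "\<And>a x. a \<in> carrier A \<Longrightarrow> x \<in> I \<Longrightarrow> a \<otimes> x \<in> I"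
  shows "left_ideal I A"
proof -
  have "\<ominus> x \<in> I" if "x \<in> I" for x
    using l[of "\<ominus> \<one>" x] that assms(1) by (auto simp: l_minus)
  then have "additive_subgroup I A"
    using assms by (intro additive_subgroup.intro add.subgroupI) (auto simp flip: a_inv_def)
  with l show ?thesis by (simp add: left_ideal_def)
qed

text \<open>
  If both ideals jump at the same steps, they agree inside every step of the flag, by induction along it:
  an element of the larger space that lies in some step of the flag is corrected by an element of the
  smaller space, with the same leading coefficient, to lie in the next step.
\<close>

lemma left_ideal_eq_if_jumps_eq:
  assumes bs: "set bs \<subseteq> carrier A" "carrier A \<subseteq> list_span bs"
    and U: "left_ideal U A" and V: "left_ideal V A" and "U \<subseteq> V" and eq: "jumps bs V \<subseteq> jumps bs U"
  shows "U = V"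
proof
  have drop_carrier: "set (drop j bs) \<subseteq> carrier A" for j
    using bs(1) set_drop_subset[of j bs] by blast
  have "x \<in> U" if "x \<in> V" "x \<in> list_span (drop (length bs - k) bs)" for k x
    using that
  proof (induction k arbitrary: x)
    case 0
    then show ?case using left_idealD(2)[OF U] by simp
  next
    case (Suc k)
    show ?case
    proof (cases "Suc k \<le> length bs")
      case False
      then have "length bs - Suc k = length bs - k" by simp
      then show ?thesis using Suc by simp
    next
      case True
      define j where "j = length bs - Suc k"
      then have j: "j < length bs" "Suc j = length bs - k" using True by auto
      have split: "drop j bs = bs ! j # drop (Suc j) bs" by (rule Cons_nth_drop_Suc[OF j(1), symmetric])
      have b: "bs ! j \<in> carrier A" using bs(1) j by auto
      have x: "x \<in> list_span (drop j bs)" using Suc.prems by (simp add: j_def)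
      show ?thesis
      proof (cases "x \<in> list_span (drop (Suc j) bs)")
        case True
        then show ?thesis using Suc j by simp
      next
        case False
        then have "j \<in> jumps bs V" unfolding jumps_def using Suc.prems(1) x j(1) by blast
        then have "j \<in> jumps bs U" using eq by blast
        then obtain y where y: "y \<in> U" "y \<in> list_span (drop j bs)" "y \<notin> list_span (drop (Suc j) bs)"
          by (auto simp: jumps_def)
        obtain c u where cu: "x = c \<odot> bs ! j \<oplus> u" "u \<in> list_span (drop (Suc j) bs)"
          using x by (auto simp: split)
        obtain d v where dv: "y = d \<odot> bs ! j \<oplus> v" "v \<in> list_span (drop (Suc j) bs)"
          using y by (auto simp: split)
        have uv: "u \<in> carrier A" "v \<in> carrier A"
          using cu dv list_span_carrier[OF drop_carrier] by auto
        have "d \<noteq> 0" using y dv b uv by auto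
        \<comment> \<open>the multiple of \<open>y\<close> that cancels the leading coefficient of \<open>x\<close>\<close>
        define e where "e = - (c / d)"
        have xy: "x \<oplus> e \<odot> y = u \<oplus> e \<odot> v"
        proof -
          have "x \<oplus> e \<odot> y = (c \<odot> bs ! j \<oplus> (e * d) \<odot> bs ! j) \<oplus> (u \<oplus> e \<odot> v)"
            unfolding cu dv using b uv by (simp add: smult_add_right smult_smult a_ac)
          also have "c \<odot> bs ! j \<oplus> (e * d) \<odot> bs ! j = (c + e * d) \<odot> bs ! j"
            using b by (simp add: smult_add_left)
          also have "c + e * d = 0" using \<open>d \<noteq> 0\<close> by (simp add: e_def)
          finally show ?thesis using b uv by simp
        qed
        have ey: "e \<odot> y \<in> U" using left_ideal_smult[OF U y(1)] .
        have "x \<oplus> e \<odot> y \<in> U"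
        proof (rule Suc.IH)
          show "x \<oplus> e \<odot> y \<in> V" using left_idealD(3)[OF V Suc.prems(1)] ey \<open>U \<subseteq> V\<close> by blast
          show "x \<oplus> e \<odot> y \<in> list_span (drop (length bs - k) bs)"
            unfolding xy using cu dv list_span_add[OF drop_carrier] list_span_smult[OF drop_carrier]
            by (simp flip: j(2))
        qed
        then have "(x \<oplus> e \<odot> y) \<ominus> e \<odot> y \<in> U" using ey left_idealD(5)[OF U] by blast
        moreover have "(x \<oplus> e \<odot> y) \<ominus> e \<odot> y = x"
          using Suc.prems(1) ey left_idealD(1)[OF U] left_idealD(1)[OF V]
          by (auto simp: a_minus_def a_assoc r_neg subset_iff)
        ultimately show ?thesis by simp
      qed
    qed
  qed
  from this[of _ "length bs"] show "V \<subseteq> U" using left_idealD(1)[OF V] bs(2) by auto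
qed fact

lemma flag_dim_less:
  assumes "set bs \<subseteq> carrier A" "carrier A \<subseteq> list_span bs"
    and "left_ideal U A" "left_ideal V A" "U \<subset> V"
  shows "flag_dim bs U < flag_dim bs V"
proof -
  have "jumps bs U \<subseteq> jumps bs V" using assms(5) by (auto simp: jumps_def)
  moreover have "\<not> jumps bs V \<subseteq> jumps bs U"
    using left_ideal_eq_if_jumps_eq[OF assms(1-4)] assms(5) by blast
  ultimately show ?thesis unfolding flag_dim_def by (intro psubset_card_mono) auto
qed

lemma carrier_left_ideal: "left_ideal (carrier A) A"
  by (rule left_idealI) auto

lemma Rad_left_ideal: "left_ideal (Rad A) A"
proof (rule left_idealI)
  note D = maximal_left_ideal_def left_idealD
  show "\<zero> \<in> Rad A" by (auto simp: Rad_def D)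
  show "x \<oplus> y \<in> Rad A" if "x \<in> Rad A" "y \<in> Rad A" for x y using that by (auto simp: Rad_def D)
  show "a \<otimes> x \<in> Rad A" if "a \<in> carrier A" "x \<in> Rad A" for a x using that by (auto simp: Rad_def D)
qed (simp add: Rad_def)

text \<open>
  Since \<open>flag_dim\<close> is bounded and strictly monotone, a candidate for which it is largest is maximal.
\<close>

lemma maximal_proper_left_ideal:
  assumes bs: "set bs \<subseteq> carrier A" "carrier A \<subseteq> list_span bs"
    and U: "left_ideal U A" "U \<subset> V"
  obtains W where "left_ideal W A" "U \<subseteq> W" "W \<subset> V"
    "\<And>J. left_ideal J A \<Longrightarrow> W \<subseteq> J \<Longrightarrow> J \<subset> V \<Longrightarrow> J = W"
proof -
  let ?P = "\<lambda>W. left_ideal W A \<and> U \<subseteq> W \<and> W \<subset> V"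
  have "?P U" using U by simp
  moreover have "\<forall>W. ?P W \<longrightarrow> flag_dim bs W < Suc (length bs)" by (simp add: flag_dim_le less_Suc_eq_le)
  ultimately have "\<exists>W. ?P W \<and> (\<forall>J. ?P J \<longrightarrow> flag_dim bs J \<le> flag_dim bs W)"
    by (rule ex_has_greatest_nat[where P = ?P and k = U and f = "flag_dim bs" and b = "Suc (length bs)"])
  then obtain W where W: "?P W" "\<forall>J. ?P J \<longrightarrow> flag_dim bs J \<le> flag_dim bs W" 
    by (elim exE) (rule that, erule conjunct1, erule conjunct2)
  have "J = W" if J: "left_ideal J A" "W \<subseteq> J" "J \<subset> V" for J
  proof (rule ccontr)
    assume "J \<noteq> W"
    then have "W \<subset> J" using J(2) by blast
    then have "flag_dim bs W < flag_dim bs J" using flag_dim_less[OF bs] W(1) J(1) by blast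
    moreover have "?P J" using J W(1) by blast
    ultimately show False using W(2) by fastforce
  qed
  then show ?thesis using that W(1) by blast
qed

text \<open>
  If \<open>1 - x\<close> had no left inverse, the left ideal it generates would lie in a maximal one, which would
  also contain \<open>x\<close>, hence \<open>1\<close>.
\<close>

lemma Rad_left_inverse:
  assumes bs: "set bs \<subseteq> carrier A" "carrier A \<subseteq> list_span bs" and x: "x \<in> Rad A"
  obtains u where "u \<in> carrier A" "u \<otimes> (\<one> \<ominus> x) = \<one>"
proof -
  have xc: "x \<in> carrier A" using x by (simp add: Rad_def)
  define L where "L = {u \<otimes> (\<one> \<ominus> x) | u. u \<in> carrier A}"
  have L: "left_ideal L A"
  proof (rule left_idealI)
    have "\<zero> = \<zero> \<otimes> (\<one> \<ominus> x)" using xc by simp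
    then show "\<zero> \<in> L" unfolding L_def by blast
  next
    fix y z assume "y \<in> L" "z \<in> L"
    then obtain u v where *: "u \<in> carrier A" "v \<in> carrier A" "y = u \<otimes> (\<one> \<ominus> x)" "z = v \<otimes> (\<one> \<ominus> x)"
      by (auto simp: L_def)
    then have "y \<oplus> z = (u \<oplus> v) \<otimes> (\<one> \<ominus> x)" using xc by (simp add: l_distr)
    then show "y \<oplus> z \<in> L" using * unfolding L_def by blast
  next
    fix a y assume "a \<in> carrier A" "y \<in> L"
    then obtain u where *: "u \<in> carrier A" "y = u \<otimes> (\<one> \<ominus> x)" by (auto simp: L_def)
    then have "a \<otimes> y = (a \<otimes> u) \<otimes> (\<one> \<ominus> x)" using xc \<open>a \<in> carrier A\<close> by (simp add: m_assoc)
    then show "a \<otimes> y \<in> L" using * \<open>a \<in> carrier A\<close> unfolding L_def by blast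
  qed (use xc in \<open>auto simp: L_def\<close>)
  have "L = carrier A"
  proof (rule ccontr)
    assume "L \<noteq> carrier A"
    then have "L \<subset> carrier A" using left_idealD(1)[OF L] by blast
    then obtain M where M: "left_ideal M A" "L \<subseteq> M" "M \<subset> carrier A"
      and max: "\<And>J. left_ideal J A \<Longrightarrow> M \<subseteq> J \<Longrightarrow> J \<subset> carrier A \<Longrightarrow> J = M"
      using maximal_proper_left_ideal[OF bs L] by metis
    have "maximal_left_ideal M A"
      unfolding maximal_left_ideal_def using M max left_idealD(1) by blast
    then have "x \<in> M" using x by (auto simp: Rad_def)
    moreover have "\<one> \<otimes> (\<one> \<ominus> x) \<in> L" unfolding L_def by blast
    then have "\<one> \<ominus> x \<in> M" using M(2) xc by auto
    ultimately have "(\<one> \<ominus> x) \<oplus> x \<in> M" using left_idealD(3)[OF M(1)] by blast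
    then have "\<one> \<in> M" using xc by (simp add: a_minus_def a_assoc l_neg)
    then have "carrier A \<subseteq> M" using left_idealD(6)[OF M(1), of _ \<one>] by force
    then show False using M(3) by blast
  qed
  then have "\<one> \<in> L" by simp
  then obtain u where "u \<in> carrier A" "\<one> = u \<otimes> (\<one> \<ominus> x)" unfolding L_def by blast
  then show ?thesis using that[of u] by simp
qed

lemma ideal_prod_left_ideal:
  assumes "left_ideal I A" "left_ideal J A"
  shows "left_ideal (ideal_prod A I J) A" and "ideal_prod A I J \<subseteq> J"
proof -
  note ID = left_idealD[OF assms(1)] and JD = left_idealD[OF assms(2)]
  show sub: "ideal_prod A I J \<subseteq> J"
  proof
    fix x assume "x \<in> ideal_prod A I J"
    then show "x \<in> J" by induction (use ID JD in auto)
  qed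
  show "left_ideal (ideal_prod A I J) A"
  proof (rule left_idealI)
    show "ideal_prod A I J \<subseteq> carrier A" using sub JD(1) by blast
    have "\<zero> \<otimes> \<zero> \<in> ideal_prod A I J" using ID(2) JD(2) by (rule ideal_prod.prod)
    then show "\<zero> \<in> ideal_prod A I J" by simp
  next
    fix a x assume a: "a \<in> carrier A" and "x \<in> ideal_prod A I J"
    from this(2) show "a \<otimes> x \<in> ideal_prod A I J"
    proof induction
      case (prod i j)
      then have "a \<otimes> (i \<otimes> j) = (a \<otimes> i) \<otimes> j" using ID(1) JD(1) a by (simp add: m_assoc subset_iff)
      then show ?case using prod ID(6) a by (simp add: ideal_prod.prod)
    next
      case (sum s t)
      then have "s \<in> carrier A" "t \<in> carrier A" using sub JD(1) by blast+
      then show ?case using sum a by (simp add: r_distr ideal_prod.sum)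
    qed
  qed (rule ideal_prod.sum)
qed

lemma Rad_power_left_ideal: "left_ideal (Rad_power A j) A"
  by (induction j) (simp_all add: carrier_left_ideal Rad_left_ideal ideal_prod_left_ideal)

lemma Rad_power_Suc_subset: "Rad_power A (Suc j) \<subseteq> Rad_power A j"
  by (simp add: ideal_prod_left_ideal Rad_left_ideal Rad_power_left_ideal)

lemma Rad_power_antimono: "i \<le> j \<Longrightarrow> Rad_power A j \<subseteq> Rad_power A i"
  by (rule lift_Suc_antimono_le[where f = "Rad_power A", OF Rad_power_Suc_subset])

lemma Rad_power_mult:
  assumes "x \<in> Rad_power A i" "y \<in> Rad_power A j"
  shows "x \<otimes> y \<in> Rad_power A (i + j)"
  using assms
proof (induction i arbitrary: x)
  case 0
  then show ?case using left_idealD(6)[OF Rad_power_left_ideal] by simp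
next
  case (Suc i)
  note sub = left_idealD(1)[OF Rad_left_ideal] left_idealD(1)[OF Rad_power_left_ideal]
  from Suc.prems(1) have "x \<in> ideal_prod A (Rad A) (Rad_power A i)" by simp
  then have "x \<otimes> y \<in> ideal_prod A (Rad A) (Rad_power A (i + j))"
  proof induction
    case (prod r k)
    then have "(r \<otimes> k) \<otimes> y = r \<otimes> (k \<otimes> y)" using sub Suc.prems(2) by (simp add: m_assoc subset_iff)
    then show ?case using prod Suc.IH Suc.prems(2) by (simp add: ideal_prod.prod)
  next
    case (sum s t)
    then have "s \<in> carrier A" "t \<in> carrier A" "y \<in> carrier A"
      using sub(2)[of "Suc i"] sub(2)[of j] Suc.prems(2) by auto
    then show ?case using sum by (simp add: l_distr ideal_prod.sum)
  qed
  then show ?case by simp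
qed

text \<open>
  Nakayama's lemma for a finite-dimensional algebra. If \<open>W\<close> is maximal among the left ideals properly
  inside \<open>U\<close>, then \<open>Rad A \<cdot> U \<subseteq> W\<close>: otherwise \<open>W + Rad A \<cdot> x = U\<close> for some \<open>x \<in> U\<close>, so \<open>x = w + r x\<close> with \<open>r\<close> in the radical and
  \<open>x = (1 - r)\<inverse> w \<in> W\<close>.
\<close>

lemma Rad_prod_psubset:
  assumes bs: "set bs \<subseteq> carrier A" "carrier A \<subseteq> list_span bs"
    and U: "left_ideal U A" "U \<noteq> {\<zero>}"
  shows "ideal_prod A (Rad A) U \<subset> U"
proof -
  note UD = left_idealD[OF U(1)] and RD = left_idealD[OF Rad_left_ideal]
  have "left_ideal {\<zero>} A" by (rule left_idealI) auto
  moreover have "{\<zero>} \<subset> U" using U(2) UD(2) by blast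
  ultimately obtain W where W: "left_ideal W A" "W \<subset> U"
    and max: "\<And>J. left_ideal J A \<Longrightarrow> W \<subseteq> J \<Longrightarrow> J \<subset> U \<Longrightarrow> J = W"
    using maximal_proper_left_ideal[OF bs] by metis
  note WD = left_idealD[OF W(1)]
  have prod: "r \<otimes> x \<in> W" if r: "r \<in> Rad A" and x: "x \<in> U" for r x
  proof (rule ccontr)
    assume not: "r \<otimes> x \<notin> W"
    have xc: "x \<in> carrier A" using x UD by blast
    define V where "V = {w \<oplus> s \<otimes> x | w s. w \<in> W \<and> s \<in> Rad A}"
    have "left_ideal V A"
    proof (rule left_idealI)
      show "V \<subseteq> carrier A" using WD(1) RD(1) xc by (auto simp: V_def)
      have "\<zero> = \<zero> \<oplus> \<zero> \<otimes> x" using xc by simp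
      then show "\<zero> \<in> V" using WD(2) RD(2) unfolding V_def by blast
    next
      fix u v assume "u \<in> V" "v \<in> V"
      then obtain w s w' s' where *: "u = w \<oplus> s \<otimes> x" "w \<in> W" "s \<in> Rad A"
        "v = w' \<oplus> s' \<otimes> x" "w' \<in> W" "s' \<in> Rad A" by (auto simp: V_def)
      then have "w \<in> carrier A" "w' \<in> carrier A" "s \<in> carrier A" "s' \<in> carrier A"
        using WD(1) RD(1) by auto
      then have "u \<oplus> v = (w \<oplus> w') \<oplus> (s \<oplus> s') \<otimes> x" using * xc by (simp add: l_distr a_ac)
      then show "u \<oplus> v \<in> V" using * WD(3) RD(3) unfolding V_def by blast
    next
      fix a u assume a: "a \<in> carrier A" and "u \<in> V"
      then obtain w s where *: "u = w \<oplus> s \<otimes> x" "w \<in> W" "s \<in> Rad A" by (auto simp: V_def)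
      then have "w \<in> carrier A" "s \<in> carrier A" using WD(1) RD(1) by auto
      then have "a \<otimes> u = a \<otimes> w \<oplus> (a \<otimes> s) \<otimes> x" using * xc a by (simp add: r_distr m_assoc)
      then show "a \<otimes> u \<in> V" using * a WD(6) RD(6) unfolding V_def by blast
    qed
    moreover have "W \<subseteq> V"
    proof
      fix w assume "w \<in> W"
      then have "w = w \<oplus> \<zero> \<otimes> x" using WD(1) xc by auto
      then show "w \<in> V" using \<open>w \<in> W\<close> RD(2) unfolding V_def by blast
    qed
    moreover have "V \<noteq> W"
    proof -
      have "r \<otimes> x = \<zero> \<oplus> r \<otimes> x" using r RD(1) xc by auto
      then have "r \<otimes> x \<in> V" using r WD(2) unfolding V_def by blast
      then show ?thesis using not by blast
    qed
    moreover have "V \<subseteq> U" using W(2) UD(3,6) RD(1) x unfolding V_def by blast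
    ultimately have "V = U" using max by blast
    then obtain w s where *: "x = w \<oplus> s \<otimes> x" "w \<in> W" "s \<in> Rad A" using x by (auto simp: V_def)
    then have wc: "w \<in> carrier A" and sc: "s \<in> carrier A" using WD(1) RD(1) by auto
    obtain u where u: "u \<in> carrier A" "u \<otimes> (\<one> \<ominus> s) = \<one>"
      using Rad_left_inverse[OF bs *(3)] .
    have "(\<one> \<ominus> s) \<otimes> x = x \<ominus> s \<otimes> x"
      using sc xc by (simp add: a_minus_def l_distr l_minus)
    also have "\<dots> = (w \<oplus> s \<otimes> x) \<ominus> s \<otimes> x" using *(1) by simp
    also have "\<dots> = w" using wc sc xc by (simp add: a_minus_def a_assoc r_neg)
    finally have "x = u \<otimes> w" using u xc sc by (metis l_one m_assoc minus_closed one_closed)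
    then have "x \<in> W" using u * WD(6) by simp
    then show False using not r RD(1) WD(6) by blast
  qed
  have "ideal_prod A (Rad A) U \<subseteq> W"
  proof
    fix z assume "z \<in> ideal_prod A (Rad A) U"
    then show "z \<in> W" by induction (use prod WD in auto)
  qed
  then show ?thesis using W(2) by blast
qed

text \<open>
  By Nakayama's lemma the powers of the radical decrease strictly until they vanish, and \<open>flag_dim\<close>
  bounds the length of the chain.
\<close>

theorem Rad_power_Rad_nilpotency:
  assumes bs: "set bs \<subseteq> carrier A" "carrier A \<subseteq> list_span bs"
  shows "Rad_power A (Rad_nilpotency A) = {\<zero>}"
proof -
  have "\<exists>m. Rad_power A m = {\<zero>}"
  proof (rule ccontr)
    assume not: "\<nexists>m. Rad_power A m = {\<zero>}"
    then have "Rad_power A (Suc j) \<subset> Rad_power A j" for j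
      using Rad_prod_psubset[OF bs Rad_power_left_ideal, of j] by simp
    then have "flag_dim bs (Rad_power A (Suc j)) < flag_dim bs (Rad_power A j)" for j
      by (rule flag_dim_less[OF bs Rad_power_left_ideal Rad_power_left_ideal])
    then have "flag_dim bs (Rad_power A j) + j \<le> flag_dim bs (Rad_power A 0)" for j
    proof (induction j)
      case (Suc j)
      from Suc.IH[OF Suc.prems] Suc.prems[of j] show ?case by linarith
    qed simp
    from this[of "Suc (flag_dim bs (Rad_power A 0))"] show False by simp
  qed
  then show ?thesis unfolding Rad_nilpotency_def by (rule LeastI_ex)
qed

end

section \<open>Matrices over an algebra with nilpotent radical\<close>

locale nilpotent_radical_algebra = field_algebra A
  for A :: "('k::field, 'b) module" (structure) +
  assumes Rad_power_nilpotency: "Rad_power A (Rad_nilpotency A) = {\<zero>}"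
begin

text \<open>
  With the exponents extended to all integers, both the numerators and the denominators of the
  matrix entries become members of one multiplicative filtration.
\<close>

definition rad_filt :: "int \<Rightarrow> 'b set" where
  "rad_filt j = Rad_power A (nat j)"

lemma rad_filt_left_ideal: "left_ideal (rad_filt j) A"
  by (simp add: rad_filt_def Rad_power_left_ideal)

lemma rad_filt_mult: "x \<in> rad_filt i \<Longrightarrow> y \<in> rad_filt j \<Longrightarrow> k \<le> i + j \<Longrightarrow> x \<otimes> y \<in> rad_filt k"
  proof -
  assume "x \<in> rad_filt i" "y \<in> rad_filt j" "k \<le> i + j"
  then have "x \<otimes> y \<in> Rad_power A (nat i + nat j)" "nat k \<le> nat i + nat j"
    by (auto simp: rad_filt_def Rad_power_mult)
  then show ?thesis unfolding rad_filt_def using Rad_power_antimono by blast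
qed

lemma mat_num_eq: "mat_num A r c = rad_filt (r - c)"
  by (simp add: mat_num_def rad_filt_def)

text \<open>
  Below the diagonal the exponent is at least the nilpotency degree, so the denominator \<open>0\<close> fits the
  same formula; this is where nilpotency of the radical enters.
\<close>

lemma mat_den_eq: "mat_den A r c = rad_filt (int (Rad_nilpotency A) + r - c)"
proof (cases "r > c")
  case True
  then have "Rad_nilpotency A \<le> nat (int (Rad_nilpotency A) + r - c)" by simp
  then have "rad_filt (int (Rad_nilpotency A) + r - c) = {\<zero>}"
    using Rad_power_antimono Rad_power_nilpotency left_idealD(2)[OF Rad_power_left_ideal]
    unfolding rad_filt_def by blast
  then show ?thesis using True by (simp add: mat_den_def)
next
  case False
  then show ?thesis by (auto simp: mat_den_def rad_filt_def nat_diff_distrib nat_add_distrib intro!: arg_cong[of _ _ "Rad_power A"])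
qed

lemma mat_den_left_ideal: "left_ideal (mat_den A r c) A"
  by (simp add: mat_den_eq rad_filt_left_ideal)

lemma mat_num_left_ideal: "left_ideal (mat_num A r c) A"
  by (simp add: mat_num_eq rad_filt_left_ideal)

lemma left_ideal_abelian_subgroup: "left_ideal I A \<Longrightarrow> abelian_subgroup I A"
  by (intro abelian_subgroupI3) (auto simp: left_ideal_def abelian_group_axioms)

sublocale den: abelian_subgroup "mat_den A r c" A for r c
  by (rule left_ideal_abelian_subgroup[OF mat_den_left_ideal])

lemma mat_num_carrier [simp]: "x \<in> mat_num A r c \<Longrightarrow> x \<in> carrier A"
  using left_idealD(1)[OF mat_num_left_ideal] by blast

lemma mat_num_closed [simp]:
  "\<zero> \<in> mat_num A r c"
  "x \<in> mat_num A r c \<Longrightarrow> y \<in> mat_num A r c \<Longrightarrow> x \<oplus> y \<in> mat_num A r c"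
  "x \<in> mat_num A r c \<Longrightarrow> k \<odot> x \<in> mat_num A r c"
  using left_idealD[OF mat_num_left_ideal] left_ideal_smult[OF mat_num_left_ideal] by auto

lemma mat_num_mult: "x \<in> mat_num A r m \<Longrightarrow> y \<in> mat_num A m c \<Longrightarrow> x \<otimes> y \<in> mat_num A r c"
  by (simp add: mat_num_eq rad_filt_mult)

lemma mat_num_diagonal [simp]: "mat_num A i i = carrier A"
  by (simp add: mat_num_def)

lemma mat_den_diagonal [simp]: "mat_den A i i = {\<zero>}"
  by (simp add: mat_den_eq rad_filt_def Rad_power_nilpotency)

abbreviation entry :: "int \<Rightarrow> int \<Rightarrow> 'b \<Rightarrow> 'b set" where
  "entry r c x \<equiv> mat_den A r c +> x"

lemma entry_zero: "entry r c \<zero> = mat_den A r c"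
  by (simp add: den.a_rcos_const)

lemma zero_coset [simp]: "x \<in> carrier A \<Longrightarrow> {\<zero>} +> x = {x}"
  by (auto simp: mem_a_r_coset)

lemma entry_diagonal: "x \<in> carrier A \<Longrightarrow> entry i i x = {x}"
  by simp

lemma mat_entriesE:
  assumes "X \<in> mat_entries A r c"
  obtains x where "x \<in> mat_num A r c" "X = entry r c x"
  using assms by (auto simp: mat_entries_def)

lemma entry_in_mat_entries [simp]: "x \<in> mat_num A r c \<Longrightarrow> entry r c x \<in> mat_entries A r c"
  by (simp add: mat_entries_def)

lemma mat_den_in_mat_entries [simp]: "mat_den A r c \<in> mat_entries A r c"
  using entry_in_mat_entries[of \<zero> r c] by (simp add: entry_zero)

text \<open>
  The product of cosets is well defined because the product of a denominator with a numerator or a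
  denominator stays in the denominator, the exponents of the filtration being additive.
\<close>

lemma entry_mult_entry:
  assumes x: "x \<in> mat_num A r m" and y: "y \<in> mat_num A m c"
  shows "entry_mult A r c (entry r m x) (entry m c y) = entry r c (x \<otimes> y)"
proof -
  have *: "entry r c (x' \<otimes> y') = entry r c (x \<otimes> y)"
    if x': "x' \<in> entry r m x" and y': "y' \<in> entry m c y" for x' y'
  proof -
    obtain d where d: "d \<in> mat_den A r m" "x' = d \<oplus> x" using x' by (auto simp: mem_a_r_coset)
    obtain d' where d': "d' \<in> mat_den A m c" "y' = d' \<oplus> y" using y' by (auto simp: mem_a_r_coset)
    have carr: "d \<in> carrier A" "d' \<in> carrier A" "x \<in> carrier A" "y \<in> carrier A"
      using d d' x y by auto
    then have eq: "x' \<otimes> y' = (d \<otimes> d' \<oplus> d \<otimes> y \<oplus> x \<otimes> d') \<oplus> x \<otimes> y"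
      by (simp add: d d' l_distr r_distr a_ac)
    have "d \<otimes> d' \<in> mat_den A r c" "d \<otimes> y \<in> mat_den A r c" "x \<otimes> d' \<in> mat_den A r c"
      using d d' x y by (auto simp: mat_den_eq mat_num_eq elim!: rad_filt_mult)
    then have "x' \<otimes> y' \<in> entry r c (x \<otimes> y)" unfolding eq mem_a_r_coset by blast
    then show ?thesis using carr by (metis den.a_repr_independence' m_closed)
  qed
  have "(\<Union>y'\<in>entry m c y. entry r c (x' \<otimes> y')) = entry r c (x \<otimes> y)" if "x' \<in> entry r m x" for x'
    using den.a_rcos_self[of y] *[OF that] y by (intro UN_eq_constI) auto
  with den.a_rcos_self[OF mat_num_carrier[OF x]] show ?thesis
    unfolding entry_mult_def by (rule UN_eq_constI)
qed

lemma entry_add: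
  "x \<in> carrier A \<Longrightarrow> y \<in> carrier A \<Longrightarrow> entry r c x <+> entry r c y = entry r c (x \<oplus> y)"
  by (rule den.a_rcos_sum)

lemma entry_smult: "x \<in> carrier A \<Longrightarrow> (\<Union>y\<in>entry r c x. entry r c (k \<odot> y)) = entry r c (k \<odot> x)"
  by (rule left_ideal_smult_coset[OF mat_den_left_ideal])

abbreviation mats :: "('k, 'b zmat) module" where
  "mats \<equiv> mat_algebra A"

lemma mats_simps [simp]:
  "zero mats = mat_den A"
  "add mats X Y = (\<lambda>r c. X r c <+> Y r c)"
  "smult mats k X = (\<lambda>r c. \<Union>x\<in>X r c. entry r c (k \<odot> x))"
  by (simp_all add: mat_algebra_def)

lemma mats_carrier:
  "X \<in> carrier mats \<longleftrightarrow> (\<forall>r c. X r c \<in> mat_entries A r c) \<and> finite {(r, c). X r c \<noteq> mat_den A r c}"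
  by (simp add: mat_algebra_def)

lemma mats_entryE:
  assumes "X \<in> carrier mats"
  obtains x where "x \<in> mat_num A r c" "X r c = entry r c x"
  using assms mat_entriesE unfolding mats_carrier by blast

lemma mats_add_closed:
  assumes X: "X \<in> carrier mats" and Y: "Y \<in> carrier mats"
  shows "X \<oplus>\<^bsub>mats\<^esub> Y \<in> carrier mats"
proof -
  have "(X r c <+> Y r c) \<in> mat_entries A r c" for r c
    by (rule mats_entryE[OF X, of r c], rule mats_entryE[OF Y, of r c]) (simp add: entry_add)
  moreover have "X r c <+> Y r c = mat_den A r c" if "X r c = mat_den A r c" "Y r c = mat_den A r c" for r c
    using entry_add[of \<zero> \<zero> r c] that by (simp add: entry_zero)
  then have "{(r, c). X r c <+> Y r c \<noteq> mat_den A r c}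
      \<subseteq> {(r, c). X r c \<noteq> mat_den A r c} \<union> {(r, c). Y r c \<noteq> mat_den A r c}" by blast
  ultimately show ?thesis using X Y by (auto simp: mats_carrier intro: finite_subset)
qed

lemma mats_smult_closed:
  assumes X: "X \<in> carrier mats"
  shows "k \<odot>\<^bsub>mats\<^esub> X \<in> carrier mats"
proof -
  have "(\<Union>x\<in>X r c. entry r c (k \<odot> x)) \<in> mat_entries A r c" for r c
    by (rule mats_entryE[OF X, of r c]) (simp add: entry_smult del: UN_simps)
  moreover have "(\<Union>x\<in>X r c. entry r c (k \<odot> x)) = mat_den A r c" if "X r c = mat_den A r c" for r c
    using entry_smult[of \<zero> r c k] that by (simp add: entry_zero)
  then have "{(r, c). (\<Union>x\<in>X r c. entry r c (k \<odot> x)) \<noteq> mat_den A r c} \<subseteq> {(r, c). X r c \<noteq> mat_den A r c}"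
    by blast
  ultimately show ?thesis using X by (auto simp: mats_carrier intro: finite_subset)
qed

lemma mats_abelian_group: "abelian_group mats"
proof (rule abelian_groupI)
  show "\<zero>\<^bsub>mats\<^esub> \<in> carrier mats" by (simp add: mats_carrier)
  fix X assume X: "X \<in> carrier mats"
  show "\<zero>\<^bsub>mats\<^esub> \<oplus>\<^bsub>mats\<^esub> X = X"
  proof (intro ext)
    fix r c
    show "(\<zero>\<^bsub>mats\<^esub> \<oplus>\<^bsub>mats\<^esub> X) r c = X r c"
      using entry_add[of \<zero> _ r c] by (rule_tac mats_entryE[OF X, of r c]) (simp add: entry_zero)
  qed
  have "((- 1) \<odot>\<^bsub>mats\<^esub> X) \<oplus>\<^bsub>mats\<^esub> X = \<zero>\<^bsub>mats\<^esub>"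
  proof (intro ext)
    fix r c
    obtain x where x: "x \<in> mat_num A r c" "X r c = entry r c x" by (rule mats_entryE[OF X])
    then have "(((- 1) \<odot>\<^bsub>mats\<^esub> X) \<oplus>\<^bsub>mats\<^esub> X) r c = entry r c ((- 1) \<odot> x) <+> entry r c x"
      by (simp only: mats_simps entry_smult mat_num_carrier)
    also have "\<dots> = entry r c \<zero>" using x by (simp add: smult_minus entry_add l_neg)
    finally show "(((- 1) \<odot>\<^bsub>mats\<^esub> X) \<oplus>\<^bsub>mats\<^esub> X) r c = \<zero>\<^bsub>mats\<^esub> r c" by (simp add: entry_zero)
  qed
  then show "\<exists>Y\<in>carrier mats. Y \<oplus>\<^bsub>mats\<^esub> X = \<zero>\<^bsub>mats\<^esub>" using mats_smult_closed[OF X] by blast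
  fix Y assume Y: "Y \<in> carrier mats"
  show "X \<oplus>\<^bsub>mats\<^esub> Y \<in> carrier mats" using X Y by (rule mats_add_closed)
  show "X \<oplus>\<^bsub>mats\<^esub> Y = Y \<oplus>\<^bsub>mats\<^esub> X"
  proof (intro ext)
    fix r c
    show "(X \<oplus>\<^bsub>mats\<^esub> Y) r c = (Y \<oplus>\<^bsub>mats\<^esub> X) r c"
      by (rule mats_entryE[OF X, of r c], rule mats_entryE[OF Y, of r c]) (simp add: entry_add a_comm)
  qed
  fix Z assume Z: "Z \<in> carrier mats"
  show "(X \<oplus>\<^bsub>mats\<^esub> Y) \<oplus>\<^bsub>mats\<^esub> Z = X \<oplus>\<^bsub>mats\<^esub> (Y \<oplus>\<^bsub>mats\<^esub> Z)"
  proof (intro ext)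
    fix r c
    show "((X \<oplus>\<^bsub>mats\<^esub> Y) \<oplus>\<^bsub>mats\<^esub> Z) r c = (X \<oplus>\<^bsub>mats\<^esub> (Y \<oplus>\<^bsub>mats\<^esub> Z)) r c"
      by (rule mats_entryE[OF X, of r c], rule mats_entryE[OF Y, of r c], rule mats_entryE[OF Z, of r c])
        (simp add: entry_add a_assoc)
  qed
qed

lemma mats_mult_def:
  "(X \<otimes>\<^bsub>mats\<^esub> Y) r c = finsum (alg_quot A (mat_den A r c)) (\<lambda>m. entry_mult A r c (X r m) (Y m c))
     {m. X r m \<noteq> mat_den A r m \<and> Y m c \<noteq> mat_den A m c}"
  by (simp add: mat_algebra_def)

text \<open>
  Every product formed below has a left factor supported in one column or a right factor supported in
  one row, so its entries are single products instead of sums.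
\<close>

lemma mats_mult_single:
  assumes X: "X \<in> carrier mats" and Y: "Y \<in> carrier mats"
    and single: "\<And>m. m \<noteq> i \<Longrightarrow> X r m = mat_den A r m \<or> Y m c = mat_den A m c"
  shows "(X \<otimes>\<^bsub>mats\<^esub> Y) r c = entry_mult A r c (X r i) (Y i c)"
proof -
  interpret Q: abelian_group "alg_quot A (mat_den A r c)"
    by (rule alg_quot_abelian_group) (rule den.abelian_subgroup_axioms)
  obtain x where x: "x \<in> mat_num A r i" "X r i = entry r i x" by (rule mats_entryE[OF X])
  obtain y where y: "y \<in> mat_num A i c" "Y i c = entry i c y" by (rule mats_entryE[OF Y])
  have em: "entry_mult A r c (X r i) (Y i c) = entry r c (x \<otimes> y)"
    using x y by (simp add: entry_mult_entry)
  then have em': "entry_mult A r c (X r i) (Y i c) \<in> carrier (alg_quot A (mat_den A r c))"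
    using x y by (simp add: a_rcosets_eq)
  define S where "S = {m. X r m \<noteq> mat_den A r m \<and> Y m c \<noteq> mat_den A m c}"
  have prod: "(X \<otimes>\<^bsub>mats\<^esub> Y) r c
      = finsum (alg_quot A (mat_den A r c)) (\<lambda>m. entry_mult A r c (X r m) (Y m c)) S"
    by (simp only: mats_mult_def S_def)
  show ?thesis
  proof (cases "i \<in> S")
    case True
    moreover have "S \<subseteq> {i}" using single unfolding S_def by blast
    ultimately have "S = {i}" by blast
    then have "(X \<otimes>\<^bsub>mats\<^esub> Y) r c
        = entry_mult A r c (X r i) (Y i c) \<oplus>\<^bsub>alg_quot A (mat_den A r c)\<^esub> \<zero>\<^bsub>alg_quot A (mat_den A r c)\<^esub>"
      unfolding prod
      using Q.finsum_insert[of "{}" i "\<lambda>m. entry_mult A r c (X r m) (Y m c)"] em' Q.finsum_empty by simp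
    then show ?thesis using Q.r_zero[OF em'] by simp
  next
    case False
    have "S \<subseteq> {i}" using single unfolding S_def by blast
    then have "S = {}" using False by blast
    then have "(X \<otimes>\<^bsub>mats\<^esub> Y) r c = mat_den A r c" unfolding prod using Q.finsum_empty by simp
    moreover have "entry_mult A r c (X r i) (Y i c) = mat_den A r c"
    proof (cases "X r i = mat_den A r i")
      case True
      then have "entry_mult A r c (X r i) (Y i c) = entry r c (\<zero> \<otimes> y)"
        using entry_mult_entry[of \<zero> r i y c] y by (simp add: entry_zero)
      then show ?thesis using y by (simp add: entry_zero)
    next
      case False
      then have "Y i c = mat_den A i c" using \<open>i \<notin> S\<close> by (simp add: S_def)
      then have "entry_mult A r c (X r i) (Y i c) = entry r c (x \<otimes> \<zero>)"
        using entry_mult_entry[of x r i \<zero> c] x by (simp add: entry_zero)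
      then show ?thesis using x by (simp add: entry_zero)
    qed
    ultimately show ?thesis by simp
  qed
qed

lemma entry_mult_den:
  assumes "X \<in> mat_entries A r i" "Y \<in> mat_entries A i c" "X = mat_den A r i \<or> Y = mat_den A i c"
  shows "entry_mult A r c X Y = mat_den A r c"
  using assms(3)
proof
  assume "X = mat_den A r i"
  moreover obtain y where "y \<in> mat_num A i c" "Y = entry i c y" by (rule mat_entriesE[OF assms(2)])
  ultimately show ?thesis using entry_mult_entry[of \<zero> r i y c] by (simp add: entry_zero)
next
  assume "Y = mat_den A i c"
  moreover obtain x where "x \<in> mat_num A r i" "X = entry r i x" by (rule mat_entriesE[OF assms(1)])
  ultimately show ?thesis using entry_mult_entry[of x r i \<zero> c] by (simp add: entry_zero)
qed

lemma mats_mult_single_closed: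
  assumes X: "X \<in> carrier mats" and Y: "Y \<in> carrier mats"
    and single: "\<And>r c m. m \<noteq> i \<Longrightarrow> X r m = mat_den A r m \<or> Y m c = mat_den A m c"
  shows "X \<otimes>\<^bsub>mats\<^esub> Y \<in> carrier mats"
proof -
  have prod: "(X \<otimes>\<^bsub>mats\<^esub> Y) r c = entry_mult A r c (X r i) (Y i c)" for r c
    using X Y single by (rule mats_mult_single)
  have XY: "X r c \<in> mat_entries A r c" "Y r c \<in> mat_entries A r c" for r c
    using X Y by (auto simp: mats_carrier)
  have "(X \<otimes>\<^bsub>mats\<^esub> Y) r c \<in> mat_entries A r c" for r c
    unfolding prod
    by (rule mats_entryE[OF X, of r i], rule mats_entryE[OF Y, of i c])
      (simp add: entry_mult_entry mat_num_mult)
  moreover have "{(r, c). (X \<otimes>\<^bsub>mats\<^esub> Y) r c \<noteq> mat_den A r c}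
      \<subseteq> fst ` {(r, c). X r c \<noteq> mat_den A r c} \<times> snd ` {(r, c). Y r c \<noteq> mat_den A r c}"
  proof (rule subsetI)
    fix p assume "p \<in> {(r, c). (X \<otimes>\<^bsub>mats\<^esub> Y) r c \<noteq> mat_den A r c}"
    then obtain r c where p: "p = (r, c)" and ne: "(X \<otimes>\<^bsub>mats\<^esub> Y) r c \<noteq> mat_den A r c" by auto
    then have "X r i \<noteq> mat_den A r i" "Y i c \<noteq> mat_den A i c"
      using entry_mult_den[OF XY(1) XY(2), of r i c] by (auto simp: prod)
    then have "(r, i) \<in> {(r, c). X r c \<noteq> mat_den A r c}" "(i, c) \<in> {(r, c). Y r c \<noteq> mat_den A r c}"
      by simp_all
    from imageI[OF this(1), of fst] imageI[OF this(2), of snd]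
    show "p \<in> fst ` {(r, c). X r c \<noteq> mat_den A r c} \<times> snd ` {(r, c). Y r c \<noteq> mat_den A r c}"
      by (simp only: p fst_conv snd_conv mem_Times_iff simp_thms)
  qed
  then have "finite {(r, c). (X \<otimes>\<^bsub>mats\<^esub> Y) r c \<noteq> mat_den A r c}"
    using X Y by (rule_tac finite_subset) (auto simp: mats_carrier)
  ultimately show ?thesis by (simp add: mats_carrier)
qed

subsection \<open>The diagonal position \<open>(i, i)\<close>\<close>

text \<open>
  Since the denominator at \<open>(i, i)\<close> is zero, the entries there are singletons, and the matrices that are
  supported at this position form a copy of \<open>A\<close>.
\<close>

definition diag_entry :: "int \<Rightarrow> 'b zmat \<Rightarrow> 'b" where
  "diag_entry i X = the_elem (X i i)"

lemma diag_entry: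
  assumes "X \<in> carrier mats"
  shows "X i i = {diag_entry i X}" and "diag_entry i X \<in> carrier A"
proof -
  obtain x where "x \<in> mat_num A i i" "X i i = entry i i x" by (rule mats_entryE[OF assms])
  then have "x \<in> carrier A" "X i i = {x}" using entry_diagonal[of x i] by auto
  then show "X i i = {diag_entry i X}" "diag_entry i X \<in> carrier A" by (simp_all add: diag_entry_def)
qed

lemma diag_entry_eqI: "X i i = {a} \<Longrightarrow> diag_entry i X = a"
  by (simp add: diag_entry_def)

lemma diag_entry_add:
  "X \<in> carrier mats \<Longrightarrow> Y \<in> carrier mats \<Longrightarrow> diag_entry i (X \<oplus>\<^bsub>mats\<^esub> Y) = diag_entry i X \<oplus> diag_entry i Y"
  using diag_entry[of X i] diag_entry[of Y i] by (intro diag_entry_eqI) (simp add: set_add_def')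

lemma diag_entry_smult:
  "X \<in> carrier mats \<Longrightarrow> diag_entry i (k \<odot>\<^bsub>mats\<^esub> X) = k \<odot> diag_entry i X"
  using diag_entry[of X i] by (intro diag_entry_eqI) (simp add: entry_diagonal)

abbreviation diag :: "int \<Rightarrow> 'b \<Rightarrow> 'b zmat" where
  "diag i a \<equiv> mat_elem A a i i"

lemma diag_apply: "a \<in> carrier A \<Longrightarrow> diag i a r c = (if r = i \<and> c = i then {a} else mat_den A r c)"
  by (simp add: mat_elem_def)

lemma diag_closed [simp]:
  assumes "a \<in> carrier A"
  shows "diag i a \<in> carrier mats"
proof -
  have "diag i a r c \<in> mat_entries A r c" for r c
    using assms entry_in_mat_entries[of a i i] by (simp add: mat_elem_def)
  moreover have "{(r, c). diag i a r c \<noteq> mat_den A r c} \<subseteq> {(i, i)}"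
    by (auto simp: mat_elem_def)
  ultimately show ?thesis by (auto simp: mats_carrier intro: finite_subset)
qed

lemma diag_entry_diag [simp]: "a \<in> carrier A \<Longrightarrow> diag_entry i (diag i a) = a"
  by (rule diag_entry_eqI) (simp add: diag_apply)

lemma eq_diagI:
  assumes "X \<in> carrier mats" "\<And>r c. r \<noteq> i \<or> c \<noteq> i \<Longrightarrow> X r c = mat_den A r c" "diag_entry i X = a"
  shows "X = diag i a"
  using assms diag_entry[OF assms(1), of i] by (intro ext) (auto simp: diag_apply)

lemma diag_add: "a \<in> carrier A \<Longrightarrow> b \<in> carrier A \<Longrightarrow> diag i a \<oplus>\<^bsub>mats\<^esub> diag i b = diag i (a \<oplus> b)"
  using entry_add[of \<zero> \<zero>]
  by (intro eq_diagI mats_add_closed)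
    (auto simp: diag_apply entry_zero diag_entry_add simp del: mats_simps, auto simp: diag_apply entry_zero)

lemma diag_smult: "a \<in> carrier A \<Longrightarrow> k \<odot>\<^bsub>mats\<^esub> diag i a = diag i (k \<odot> a)"
  using entry_smult[of \<zero>]
  by (intro eq_diagI mats_smult_closed)
    (auto simp: diag_apply entry_zero diag_entry_smult simp del: mats_simps, auto simp: diag_apply entry_zero)

lemma diag_zero: "diag i \<zero> = \<zero>\<^bsub>mats\<^esub>"
  by (intro ext) (simp add: diag_apply)

definition row_supported :: "int \<Rightarrow> 'b zmat \<Rightarrow> bool" where
  "row_supported i X \<longleftrightarrow> (\<forall>r c. r \<noteq> i \<longrightarrow> X r c = mat_den A r c)"

definition col_supported :: "int \<Rightarrow> 'b zmat \<Rightarrow> bool" where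
  "col_supported i X \<longleftrightarrow> (\<forall>r c. c \<noteq> i \<longrightarrow> X r c = mat_den A r c)"

lemma diag_supported [simp]:
  "a \<in> carrier A \<Longrightarrow> row_supported i (diag i a)" "a \<in> carrier A \<Longrightarrow> col_supported i (diag i a)"
  by (simp_all add: row_supported_def col_supported_def diag_apply)

lemma diag_eqI:
  "X \<in> carrier mats \<Longrightarrow> row_supported i X \<Longrightarrow> col_supported i X \<Longrightarrow> X = diag i (diag_entry i X)"
  by (rule eq_diagI) (auto simp: row_supported_def col_supported_def)

lemma supported_mult:
  assumes X: "X \<in> carrier mats" and Y: "Y \<in> carrier mats"
    and "col_supported i X \<or> row_supported i Y"
  shows "X \<otimes>\<^bsub>mats\<^esub> Y \<in> carrier mats"
    and "diag_entry i (X \<otimes>\<^bsub>mats\<^esub> Y) = diag_entry i X \<otimes> diag_entry i Y"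
    and "row_supported i X \<Longrightarrow> row_supported i (X \<otimes>\<^bsub>mats\<^esub> Y)"
    and "col_supported i Y \<Longrightarrow> col_supported i (X \<otimes>\<^bsub>mats\<^esub> Y)"
proof -
  have single: "m \<noteq> i \<Longrightarrow> X r m = mat_den A r m \<or> Y m c = mat_den A m c" for r m c
    using assms(3) by (auto simp: row_supported_def col_supported_def)
  show "X \<otimes>\<^bsub>mats\<^esub> Y \<in> carrier mats" using X Y single by (rule mats_mult_single_closed)
  have prod: "(X \<otimes>\<^bsub>mats\<^esub> Y) r c = entry_mult A r c (X r i) (Y i c)" for r c
    using X Y single by (rule mats_mult_single)
  have XY: "X r c \<in> mat_entries A r c" "Y r c \<in> mat_entries A r c" for r c
    using X Y by (auto simp: mats_carrier)
  show "diag_entry i (X \<otimes>\<^bsub>mats\<^esub> Y) = diag_entry i X \<otimes> diag_entry i Y"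
    using diag_entry[OF X, of i] diag_entry[OF Y, of i]
      entry_mult_entry[of "diag_entry i X" i i "diag_entry i Y" i]
    by (intro diag_entry_eqI) (simp add: prod entry_diagonal del: mat_den_diagonal)
  show "row_supported i X \<Longrightarrow> row_supported i (X \<otimes>\<^bsub>mats\<^esub> Y)"
    unfolding row_supported_def prod using entry_mult_den[OF XY(1) XY(2) disjI1] by blast
  show "col_supported i Y \<Longrightarrow> col_supported i (X \<otimes>\<^bsub>mats\<^esub> Y)"
    unfolding col_supported_def prod using entry_mult_den[OF XY(1) XY(2) disjI2] by blast
qed

text \<open>
  A product with a row factor on the left and a column factor on the right is cut down to a single
  diagonal position.
\<close>

lemma supported_mult_eq_diag:
  assumes "X \<in> carrier mats" "Y \<in> carrier mats" "row_supported i X" "col_supported i Y"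
    and "col_supported i X \<or> row_supported i Y"
  shows "X \<otimes>\<^bsub>mats\<^esub> Y = diag i (diag_entry i X \<otimes> diag_entry i Y)"
  using diag_eqI[OF supported_mult(1)[OF assms(1,2,5)] supported_mult(3)[OF assms(1,2,5,3)]
      supported_mult(4)[OF assms(1,2,5,4)]] supported_mult(2)[OF assms(1,2,5)] by simp

lemma diag_mult_diag:
  "a \<in> carrier A \<Longrightarrow> b \<in> carrier A \<Longrightarrow> diag i a \<otimes>\<^bsub>mats\<^esub> diag i b = diag i (a \<otimes> b)"
  using supported_mult_eq_diag[of "diag i a" "diag i b" i] by simp

lemma row_supported_mult_diag:
  "X \<in> carrier mats \<Longrightarrow> row_supported i X \<Longrightarrow> a \<in> carrier A
    \<Longrightarrow> X \<otimes>\<^bsub>mats\<^esub> diag i a = diag i (diag_entry i X \<otimes> a)"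
  by (simp add: supported_mult_eq_diag)

lemma diag_mult_row_supported:
  assumes "X \<in> carrier mats" "a \<in> carrier A"
  shows "diag i a \<otimes>\<^bsub>mats\<^esub> X \<in> carrier mats" and "row_supported i (diag i a \<otimes>\<^bsub>mats\<^esub> X)"
    and "diag_entry i (diag i a \<otimes>\<^bsub>mats\<^esub> X) = a \<otimes> diag_entry i X"
  using supported_mult[of "diag i a" X i] assms by simp_all

lemma mult_diag_row_supported:
  assumes X: "X \<in> carrier mats" "row_supported j X" and a: "a \<in> carrier A"
  shows "row_supported j (X \<otimes>\<^bsub>mats\<^esub> diag i a)"
proof -
  have "(X \<otimes>\<^bsub>mats\<^esub> diag i a) r c = mat_den A r c" if "r \<noteq> j" for r c
  proof -
    have "(X \<otimes>\<^bsub>mats\<^esub> diag i a) r c = entry_mult A r c (X r i) (diag i a i c)"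
      using a by (intro mats_mult_single[OF X(1) diag_closed]) (auto simp: diag_apply)
    also have "X r i = mat_den A r i" using X(2) that by (simp add: row_supported_def)
    also have "entry_mult A r c (mat_den A r i) (diag i a i c) = mat_den A r c"
      using diag_closed[OF a, of i] by (intro entry_mult_den) (auto simp: mats_carrier)
    finally show ?thesis .
  qed
  then show ?thesis by (simp add: row_supported_def)
qed

end

section \<open>The corner of the trivial extension at a diagonal position\<close>

text \<open>
  The family \<open>e\<close>, placed at all diagonal positions, indexes the pieces of \<open>\<CC>\<close> whose duals make up the
  restricted dual. That the family is finite with sum \<open>1\<close> makes the identity at position \<open>(i, i)\<close> a
  finite sum of these idempotents.
\<close>

locale idempotent_decomposition = nilpotent_radical_algebra A
  for A :: "('k::field, 'b) module" (structure) +
  fixes V :: "'v set" and e :: "'v \<Rightarrow> 'b"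
  assumes finite_V: "finite V"
    and e_closed: "\<And>v. v \<in> V \<Longrightarrow> e v \<in> carrier A"
    and sum_e: "finsum A e V = \<one>"
begin

abbreviation idems :: "'v \<times> int \<Rightarrow> 'b zmat" where
  "idems \<equiv> \<lambda>(v, j). diag j (e v)"

abbreviation dual :: "('b zmat \<Rightarrow> 'k) set" where
  "dual \<equiv> restricted_dual mats (V \<times> UNIV) idems"

abbreviation triv :: "('k, 'b zmat \<times> ('b zmat \<Rightarrow> 'k)) module" where
  "triv \<equiv> trivial_extension mats (V \<times> UNIV) idems"

lemma triv_simps [simp]:
  "carrier triv = carrier mats \<times> dual"
  "mult triv (X, f) (Y, g) = (X \<otimes>\<^bsub>mats\<^esub> Y, \<lambda>Z. if Z \<in> carrier mats then g (Z \<otimes>\<^bsub>mats\<^esub> X) + f (Y \<otimes>\<^bsub>mats\<^esub> Z) else 0)"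
  "zero triv = (\<zero>\<^bsub>mats\<^esub>, \<lambda>x. 0)"
  "add triv (X, f) (Y, g) = (X \<oplus>\<^bsub>mats\<^esub> Y, \<lambda>x. f x + g x)"
  "smult triv c (X, f) = (c \<odot>\<^bsub>mats\<^esub> X, \<lambda>x. c * f x)"
  by (auto simp: trivial_extension_def dual_lact_def dual_ract_def fun_eq_iff simp del: mats_simps)

lemma dualD:
  assumes "f \<in> dual"
  shows "X \<in> carrier mats \<Longrightarrow> Y \<in> carrier mats \<Longrightarrow> f (X \<oplus>\<^bsub>mats\<^esub> Y) = f X + f Y"
    and "X \<in> carrier mats \<Longrightarrow> f (c \<odot>\<^bsub>mats\<^esub> X) = c * f X"
    and "X \<notin> carrier mats \<Longrightarrow> f X = 0"
  using assms unfolding restricted_dual_def by blast+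

lemma dual_zero: "(\<lambda>x. 0) \<in> dual"
  by (simp add: restricted_dual_def)

lemma dual_smult:
  assumes "f \<in> dual"
  shows "(\<lambda>x. c * f x) \<in> dual"
proof -
  have "finite {(\<mu>, \<nu>) \<in> (V \<times> UNIV) \<times> (V \<times> UNIV).
      \<exists>x\<in>carrier mats. c * f (idems \<mu> \<otimes>\<^bsub>mats\<^esub> x \<otimes>\<^bsub>mats\<^esub> idems \<nu>) \<noteq> 0}"
    by (rule finite_subset[of _ "{(\<mu>, \<nu>) \<in> (V \<times> UNIV) \<times> (V \<times> UNIV).
      \<exists>x\<in>carrier mats. f (idems \<mu> \<otimes>\<^bsub>mats\<^esub> x \<otimes>\<^bsub>mats\<^esub> idems \<nu>) \<noteq> 0}"])
      (use assms in \<open>auto simp: restricted_dual_def\<close>)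
  then show ?thesis
    using assms by (simp add: restricted_dual_def distrib_left mult_ac del: mats_simps)
qed

lemma dual_add:
  assumes "f \<in> dual" "g \<in> dual"
  shows "(\<lambda>x. f x + g x) \<in> dual"
proof -
  let ?S = "\<lambda>f. {(\<mu>, \<nu>) \<in> (V \<times> (UNIV :: int set)) \<times> (V \<times> (UNIV :: int set)).
      \<exists>x\<in>carrier mats. f (idems \<mu> \<otimes>\<^bsub>mats\<^esub> x \<otimes>\<^bsub>mats\<^esub> idems \<nu>) \<noteq> 0}"
  have "finite (?S f \<union> ?S g)" using assms by (simp add: restricted_dual_def)
  moreover have "?S (\<lambda>x. f x + g x) \<subseteq> ?S f \<union> ?S g" by auto
  ultimately have "finite (?S (\<lambda>x. f x + g x))" by (rule rev_finite_subset)
  then show ?thesis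
    using assms by (simp add: restricted_dual_def distrib_left add_ac del: mats_simps)
qed

lemma triv_abelian_group: "abelian_group triv"
proof -
  interpret mats: abelian_group mats by (rule mats_abelian_group)
  show ?thesis
  proof (rule abelian_groupI)
    fix x assume "x \<in> carrier triv"
    then obtain X f where x: "x = (X, f)" "X \<in> carrier mats" "f \<in> dual" by auto
    have "(\<ominus>\<^bsub>mats\<^esub> X, \<lambda>x. (- 1) * f x) \<oplus>\<^bsub>triv\<^esub> x = \<zero>\<^bsub>triv\<^esub>"
      using x by (simp add: mats.l_neg del: mats_simps)
    moreover have "(\<ominus>\<^bsub>mats\<^esub> X, \<lambda>x. (- 1) * f x) \<in> carrier triv"
      unfolding triv_simps using x dual_smult[OF x(3)] by (intro SigmaI mats.a_inv_closed)
    ultimately show "\<exists>y\<in>carrier triv. y \<oplus>\<^bsub>triv\<^esub> x = \<zero>\<^bsub>triv\<^esub>" by blast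
  qed (auto simp: dual_zero dual_add mats.a_ac add_ac simp del: mats_simps)
qed

definition linear_form :: "('b \<Rightarrow> 'k) \<Rightarrow> bool" where
  "linear_form \<phi> \<longleftrightarrow> (\<forall>x\<in>carrier A. \<forall>y\<in>carrier A. \<phi> (x \<oplus> y) = \<phi> x + \<phi> y) \<and>
     (\<forall>c. \<forall>x\<in>carrier A. \<phi> (c \<odot> x) = c * \<phi> x)"

text \<open>The value \<open>0\<close> outside the carrier is the one that elements of the restricted dual must have.\<close>

definition diag_form :: "int \<Rightarrow> ('b \<Rightarrow> 'k) \<Rightarrow> 'b zmat \<Rightarrow> 'k" where
  "diag_form i \<phi> = (\<lambda>X. if X \<in> carrier mats then \<phi> (diag_entry i X) else 0)"

lemma diag_form_cong: "(\<And>a. a \<in> carrier A \<Longrightarrow> \<phi> a = \<phi>' a) \<Longrightarrow> diag_form i \<phi> = diag_form i \<phi>'"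
  by (auto simp: diag_form_def diag_entry)

lemma linear_form_zero: "linear_form \<phi> \<Longrightarrow> \<phi> \<zero> = 0"
  unfolding linear_form_def using smult_zero[of 0] by (metis mult_zero_left zero_closed)

text \<open>
  Such a functional kills every piece \<open>e\<^sub>\<mu> \<CC> e\<^sub>\<nu>\<close> outside position \<open>(i, i)\<close>, and there are only finitely
  many pieces at this position.
\<close>

lemma diag_form_in_dual:
  assumes "linear_form \<phi>"
  shows "diag_form i \<phi> \<in> dual"
proof -
  have vanish: "diag_form i \<phi> (diag j a \<otimes>\<^bsub>mats\<^esub> X \<otimes>\<^bsub>mats\<^esub> diag k b) = 0"
    if "a \<in> carrier A" "b \<in> carrier A" "X \<in> carrier mats" "j \<noteq> i \<or> k \<noteq> i" for j k a b X
  proof -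
    let ?Y = "diag j a \<otimes>\<^bsub>mats\<^esub> X"
    have Y: "?Y \<in> carrier mats" "row_supported j ?Y"
      using that by (auto simp: diag_mult_row_supported)
    have "?Y \<otimes>\<^bsub>mats\<^esub> diag k b \<in> carrier mats" "row_supported j (?Y \<otimes>\<^bsub>mats\<^esub> diag k b)"
      "col_supported k (?Y \<otimes>\<^bsub>mats\<^esub> diag k b)"
      using that Y supported_mult[of ?Y "diag k b" k] mult_diag_row_supported[of ?Y j b k] by auto
    then have "(?Y \<otimes>\<^bsub>mats\<^esub> diag k b) i i = {\<zero>}"
      using that(4) by (auto simp: row_supported_def col_supported_def)
    then show ?thesis
      using linear_form_zero[OF assms] diag_entry_eqI by (simp add: diag_form_def)
  qed
  have "{(\<mu>, \<nu>) \<in> (V \<times> UNIV) \<times> (V \<times> UNIV).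
      \<exists>x\<in>carrier mats. diag_form i \<phi> (idems \<mu> \<otimes>\<^bsub>mats\<^esub> x \<otimes>\<^bsub>mats\<^esub> idems \<nu>) \<noteq> 0}
    \<subseteq> (V \<times> {i}) \<times> (V \<times> {i})"
  proof (rule subsetI)
    fix p assume "p \<in> {(\<mu>, \<nu>) \<in> (V \<times> UNIV) \<times> (V \<times> UNIV).
      \<exists>x\<in>carrier mats. diag_form i \<phi> (idems \<mu> \<otimes>\<^bsub>mats\<^esub> x \<otimes>\<^bsub>mats\<^esub> idems \<nu>) \<noteq> 0}"
    then obtain u j w k X where p: "p = ((u, j), (w, k))" "u \<in> V" "w \<in> V" and X: "X \<in> carrier mats"
      "diag_form i \<phi> (diag j (e u) \<otimes>\<^bsub>mats\<^esub> X \<otimes>\<^bsub>mats\<^esub> diag k (e w)) \<noteq> 0"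
      by (elim CollectE case_prodE conjE bexE) (auto simp del: mats_simps)
    then have "j = i \<and> k = i" using vanish[OF e_closed e_closed, of u w X j k] by blast
    then show "p \<in> (V \<times> {i}) \<times> (V \<times> {i})" using p by simp
  qed
  then have "finite {(\<mu>, \<nu>) \<in> (V \<times> UNIV) \<times> (V \<times> UNIV).
      \<exists>x\<in>carrier mats. diag_form i \<phi> (idems \<mu> \<otimes>\<^bsub>mats\<^esub> x \<otimes>\<^bsub>mats\<^esub> idems \<nu>) \<noteq> 0}"
    by (rule finite_subset) (simp add: finite_V)
  moreover have "diag_form i \<phi> (X \<oplus>\<^bsub>mats\<^esub> Y) = diag_form i \<phi> X + diag_form i \<phi> Y"
    if "X \<in> carrier mats" "Y \<in> carrier mats" for X Y
    using assms that mats_add_closed[OF that]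
    by (simp add: diag_form_def linear_form_def diag_entry diag_entry_add del: mats_simps)
  moreover have "diag_form i \<phi> (c \<odot>\<^bsub>mats\<^esub> X) = c * diag_form i \<phi> X" if "X \<in> carrier mats" for X c
    using assms that mats_smult_closed[OF that]
    by (simp add: diag_form_def linear_form_def diag_entry diag_entry_smult del: mats_simps)
  moreover have "diag_form i \<phi> X = 0" if "X \<notin> carrier mats" for X
    using that by (simp add: diag_form_def)
  ultimately show ?thesis by (simp add: restricted_dual_def del: mats_simps)
qed

lemma linear_form_dual_diag:
  assumes "f \<in> dual"
  shows "linear_form (\<lambda>a. f (diag i a))"
  unfolding linear_form_def
  using dualD(1,2)[OF assms] by (auto simp: diag_add[symmetric] diag_smult[symmetric] simp del: mats_simps)

text \<open>
  These pairs fill the corner at position \<open>i\<close>, which thereby becomes the trivial extension of \<open>A\<close> by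
  its full dual space.
\<close>

definition diag_pair :: "int \<Rightarrow> 'b \<Rightarrow> ('b \<Rightarrow> 'k) \<Rightarrow> 'b zmat \<times> ('b zmat \<Rightarrow> 'k)" where
  "diag_pair i a \<phi> = (diag i a, diag_form i \<phi>)"

lemma diag_pair_closed: "a \<in> carrier A \<Longrightarrow> linear_form \<phi> \<Longrightarrow> diag_pair i a \<phi> \<in> carrier triv"
  by (simp add: diag_pair_def diag_form_in_dual)

lemma diag_pair_add:
  "a \<in> carrier A \<Longrightarrow> b \<in> carrier A \<Longrightarrow>
    diag_pair i a \<phi> \<oplus>\<^bsub>triv\<^esub> diag_pair i b \<chi> = diag_pair i (a \<oplus> b) (\<lambda>x. \<phi> x + \<chi> x)"
  by (auto simp: diag_pair_def diag_add diag_form_def fun_eq_iff simp del: mats_simps)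

lemma diag_pair_smult:
  "a \<in> carrier A \<Longrightarrow> c \<odot>\<^bsub>triv\<^esub> diag_pair i a \<phi> = diag_pair i (c \<odot> a) (\<lambda>x. c * \<phi> x)"
  by (auto simp: diag_pair_def diag_smult diag_form_def fun_eq_iff simp del: mats_simps)

lemma diag_pair_zero: "diag_pair i \<zero> (\<lambda>x. 0) = \<zero>\<^bsub>triv\<^esub>"
  by (auto simp: diag_pair_def diag_zero diag_form_def fun_eq_iff simp del: mats_simps)

lemma diag_pair_mult:
  assumes "a \<in> carrier A" "b \<in> carrier A"
  shows "diag_pair i a \<phi> \<otimes>\<^bsub>triv\<^esub> diag_pair i b \<chi>
    = diag_pair i (a \<otimes> b) (\<lambda>x. \<chi> (x \<otimes> a) + \<phi> (b \<otimes> x))"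
  using assms supported_mult[of _ "diag i a" i] supported_mult[of "diag i b" _ i]
  by (auto simp: diag_pair_def diag_mult_diag diag_form_def fun_eq_iff simp del: mats_simps)

lemma linear_form_simps:
  "linear_form (\<lambda>x. 0)"
  "linear_form \<phi> \<Longrightarrow> linear_form \<chi> \<Longrightarrow> linear_form (\<lambda>x. \<phi> x + \<chi> x)"
  "linear_form \<phi> \<Longrightarrow> linear_form (\<lambda>x. c * \<phi> x)"
  "linear_form \<phi> \<Longrightarrow> a \<in> carrier A \<Longrightarrow> linear_form (\<lambda>x. \<phi> (x \<otimes> a))"
  "linear_form \<phi> \<Longrightarrow> a \<in> carrier A \<Longrightarrow> linear_form (\<lambda>x. \<phi> (a \<otimes> x))"
  by (auto simp: linear_form_def distrib_left mult_ac add_ac l_distr r_distr smult_mult_left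
      smult_mult_right)

definition unit_pair :: "int \<Rightarrow> 'b zmat \<times> ('b zmat \<Rightarrow> 'k)" where
  "unit_pair i = to_triv_ext (diag i \<one>)"

lemma to_triv_ext_diag: "to_triv_ext (diag i a) = diag_pair i a (\<lambda>x. 0)"
  by (auto simp: to_triv_ext_def diag_pair_def diag_form_def)

lemma unit_pair_eq: "unit_pair i = diag_pair i \<one> (\<lambda>x. 0)"
  by (simp add: unit_pair_def to_triv_ext_diag)

lemma finsum_to_triv_ext_diag:
  assumes "finite S" "\<And>k. k \<in> S \<Longrightarrow> a k \<in> carrier A"
  shows "finsum triv (\<lambda>k. to_triv_ext (diag i (a k))) S = to_triv_ext (diag i (finsum A a S))"
  using assms
proof (induction S)
  case empty
  interpret triv: abelian_group triv by (rule triv_abelian_group)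
  show ?case by (simp add: to_triv_ext_diag diag_pair_zero del: triv_simps)
next
  case (insert k S)
  interpret triv: abelian_group triv by (rule triv_abelian_group)
  have "(\<lambda>k. diag_pair i (a k) (\<lambda>x. 0)) \<in> S \<rightarrow> carrier triv"
    using insert by (auto intro!: diag_pair_closed linear_form_simps simp del: triv_simps)
  then have "finsum triv (\<lambda>k. diag_pair i (a k) (\<lambda>x. 0)) (insert k S)
      = diag_pair i (a k) (\<lambda>x. 0) \<oplus>\<^bsub>triv\<^esub> finsum triv (\<lambda>k. diag_pair i (a k) (\<lambda>x. 0)) S"
    using insert by (intro triv.finsum_insert) (auto intro!: diag_pair_closed linear_form_simps simp del: triv_simps)
  then show ?case
    using insert by (simp add: to_triv_ext_diag diag_pair_add Pi_def del: triv_simps)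
qed

lemma corner_product:
  assumes x: "x \<in> carrier triv"
  shows "unit_pair i \<otimes>\<^bsub>triv\<^esub> x \<otimes>\<^bsub>triv\<^esub> unit_pair i
    = diag_pair i (diag_entry i (fst x)) (\<lambda>a. snd x (diag i a))"
proof -
  obtain X f where xX: "x = (X, f)" "X \<in> carrier mats" "f \<in> dual" using x by auto
  have cut: "diag i \<one> \<otimes>\<^bsub>mats\<^esub> Z \<otimes>\<^bsub>mats\<^esub> diag i \<one> = diag i (diag_entry i Z)" if "Z \<in> carrier mats" for Z
    using diag_mult_row_supported[OF that one_closed, of i] diag_entry[OF that, of i]
    by (simp add: row_supported_mult_diag)
  show ?thesis
    using xX cut diag_mult_row_supported(1)[OF _ one_closed, of _ i]
    by (simp add: unit_pair_def to_triv_ext_def diag_pair_def diag_form_def cong: if_cong)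
qed

lemma corner_carrier:
  "carrier (corner triv (unit_pair i)) = {diag_pair i a \<phi> | a \<phi>. a \<in> carrier A \<and> linear_form \<phi>}"
proof -
  have "\<exists>a \<phi>. unit_pair i \<otimes>\<^bsub>triv\<^esub> x \<otimes>\<^bsub>triv\<^esub> unit_pair i = diag_pair i a \<phi> \<and> a \<in> carrier A \<and> linear_form \<phi>"
    if "x \<in> carrier triv" for x
  proof (intro exI conjI)
    show "unit_pair i \<otimes>\<^bsub>triv\<^esub> x \<otimes>\<^bsub>triv\<^esub> unit_pair i
      = diag_pair i (diag_entry i (fst x)) (\<lambda>a. snd x (diag i a))" using that by (rule corner_product)
    show "diag_entry i (fst x) \<in> carrier A" "linear_form (\<lambda>a. snd x (diag i a))"
      using that by (auto intro: diag_entry linear_form_dual_diag)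
  qed
  moreover have "diag_pair i a \<phi> = unit_pair i \<otimes>\<^bsub>triv\<^esub> diag_pair i a \<phi> \<otimes>\<^bsub>triv\<^esub> unit_pair i"
    if "a \<in> carrier A" "linear_form \<phi>" for a \<phi>
  proof -
    have "diag_form i (\<lambda>b. diag_form i \<phi> (diag i b)) = diag_form i \<phi>"
      by (rule diag_form_cong) (simp add: diag_form_def)
    then show ?thesis
      using corner_product[OF diag_pair_closed[OF that], of i i] that by (simp add: diag_pair_def)
  qed
  then have "\<exists>x. diag_pair i a \<phi> = unit_pair i \<otimes>\<^bsub>triv\<^esub> x \<otimes>\<^bsub>triv\<^esub> unit_pair i \<and> x \<in> carrier triv"
    if "a \<in> carrier A" "linear_form \<phi>" for a \<phi>
    using that diag_pair_closed by blast
  ultimately show ?thesis unfolding corner_def by (auto simp del: triv_simps)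
qed

text \<open>
  The generators of the ideal, computed: only the entries at \<open>(i, i)\<close> of the two factors \<open>x\<close>, \<open>y\<close>
  and the restrictions of their functionals to this position enter.
\<close>

lemma corner_ideal_product:
  assumes x: "x \<in> carrier triv" and y: "y \<in> carrier triv" and \<epsilon>: "\<epsilon> \<in> carrier A"
  shows "unit_pair i \<otimes>\<^bsub>triv\<^esub> x \<otimes>\<^bsub>triv\<^esub> to_triv_ext (diag i \<epsilon>) \<otimes>\<^bsub>triv\<^esub> y \<otimes>\<^bsub>triv\<^esub> unit_pair i
    = diag_pair i (diag_entry i (fst x) \<otimes> \<epsilon> \<otimes> diag_entry i (fst y))
        (\<lambda>a. snd y (diag i (a \<otimes> (diag_entry i (fst x) \<otimes> \<epsilon>)))
          + snd x (diag i (\<epsilon> \<otimes> (diag_entry i (fst y) \<otimes> a))))"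
proof -
  obtain X f where X: "x = (X, f)" "X \<in> carrier mats" "f \<in> dual" using x by auto
  obtain Y g where Y: "y = (Y, g)" "Y \<in> carrier mats" "g \<in> dual" using y by auto
  let ?E = "diag i \<one>" and ?F = "diag i \<epsilon>"
  define a b where "a = diag_entry i X" and "b = diag_entry i Y"
  have ab: "a \<in> carrier A" "b \<in> carrier A" using diag_entry X Y by (auto simp: a_def b_def)
  note row = diag_mult_row_supported
  have EZ: "?E \<otimes>\<^bsub>mats\<^esub> Z \<in> carrier mats" "row_supported i (?E \<otimes>\<^bsub>mats\<^esub> Z)"
    "diag_entry i (?E \<otimes>\<^bsub>mats\<^esub> Z) = diag_entry i Z" if "Z \<in> carrier mats" for Z
    using row[OF that one_closed, of i] diag_entry[OF that, of i] by simp_all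
  have EXF: "?E \<otimes>\<^bsub>mats\<^esub> X \<otimes>\<^bsub>mats\<^esub> ?F = diag i (a \<otimes> \<epsilon>)"
    using EZ[OF X(2)] \<epsilon> by (simp add: row_supported_mult_diag a_def)
  have FZE: "?F \<otimes>\<^bsub>mats\<^esub> Z \<in> carrier mats"
    "?F \<otimes>\<^bsub>mats\<^esub> Z \<otimes>\<^bsub>mats\<^esub> ?E = diag i (\<epsilon> \<otimes> diag_entry i Z)" if "Z \<in> carrier mats" for Z
    using row[OF that \<epsilon>, of i] diag_entry[OF that, of i] \<epsilon> by (simp_all add: row_supported_mult_diag)
  have EXFYE: "diag i (a \<otimes> \<epsilon>) \<otimes>\<^bsub>mats\<^esub> Y \<otimes>\<^bsub>mats\<^esub> ?E = diag i (a \<otimes> \<epsilon> \<otimes> b)"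
    using row[OF Y(2), of "a \<otimes> \<epsilon>" i] ab \<epsilon> by (simp add: row_supported_mult_diag b_def)
  have YEZ: "Y \<otimes>\<^bsub>mats\<^esub> (?E \<otimes>\<^bsub>mats\<^esub> Z) \<in> carrier mats"
    "diag_entry i (Y \<otimes>\<^bsub>mats\<^esub> (?E \<otimes>\<^bsub>mats\<^esub> Z)) = b \<otimes> diag_entry i Z" if "Z \<in> carrier mats" for Z
    using supported_mult(1,2)[OF Y(2) EZ(1)[OF that], of i] EZ[OF that] by (simp_all add: b_def)
  have EZc: "?E \<otimes>\<^bsub>mats\<^esub> Z \<otimes>\<^bsub>mats\<^esub> diag i c = diag i (diag_entry i Z \<otimes> c)"
    if "Z \<in> carrier mats" "c \<in> carrier A" for Z c
    using EZ[OF that(1)] that by (simp add: row_supported_mult_diag)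
  have 1: "unit_pair i \<otimes>\<^bsub>triv\<^esub> x
      = (?E \<otimes>\<^bsub>mats\<^esub> X, \<lambda>Z. if Z \<in> carrier mats then f (Z \<otimes>\<^bsub>mats\<^esub> ?E) else 0)"
    by (simp add: unit_pair_def to_triv_ext_def X cong: if_cong)
  have 2: "unit_pair i \<otimes>\<^bsub>triv\<^esub> x \<otimes>\<^bsub>triv\<^esub> to_triv_ext ?F
      = (diag i (a \<otimes> \<epsilon>), \<lambda>Z. if Z \<in> carrier mats then f (diag i (\<epsilon> \<otimes> diag_entry i Z)) else 0)"
    unfolding 1 by (simp add: to_triv_ext_def EXF FZE cong: if_cong)
  show ?thesis
    unfolding 2 using ab \<epsilon>
    by (simp add: unit_pair_def to_triv_ext_def X Y EXFYE EZ EZc YEZ diag_pair_def diag_form_def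
        a_def[symmetric] b_def[symmetric] cong: if_cong)
qed

lemma corner_abelian_group: "abelian_group (corner triv (unit_pair i))"
proof -
  interpret triv: abelian_group triv by (rule triv_abelian_group)
  have add: "add (corner triv (unit_pair i)) = add triv" "zero (corner triv (unit_pair i)) = zero triv"
    by (simp_all add: corner_def)
  show ?thesis
  proof (rule abelian_groupI; unfold add corner_carrier)
    fix x assume "x \<in> {diag_pair i a \<phi> | a \<phi>. a \<in> carrier A \<and> linear_form \<phi>}"
    then obtain a \<phi> where x: "x = diag_pair i a \<phi>" "a \<in> carrier A" "linear_form \<phi>" by auto
    then have xc: "x \<in> carrier triv" by (simp only: diag_pair_closed)
    show "\<zero>\<^bsub>triv\<^esub> \<oplus>\<^bsub>triv\<^esub> x = x" using xc by (rule triv.l_zero)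
    have "diag_pair i (\<ominus> a) (\<lambda>x. (- 1) * \<phi> x) \<oplus>\<^bsub>triv\<^esub> x = diag_pair i \<zero> (\<lambda>x. 0)"
      using x by (simp add: diag_pair_add l_neg del: triv_simps)
    then show "\<exists>y\<in>{diag_pair i a \<phi> | a \<phi>. a \<in> carrier A \<and> linear_form \<phi>}. y \<oplus>\<^bsub>triv\<^esub> x = \<zero>\<^bsub>triv\<^esub>"
      using x a_inv_closed linear_form_simps(3) unfolding diag_pair_zero by blast
    fix y assume "y \<in> {diag_pair i a \<phi> | a \<phi>. a \<in> carrier A \<and> linear_form \<phi>}"
    then obtain b \<chi> where y: "y = diag_pair i b \<chi>" "b \<in> carrier A" "linear_form \<chi>" by auto
    then have yc: "y \<in> carrier triv" by (simp only: diag_pair_closed)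
    show "x \<oplus>\<^bsub>triv\<^esub> y = y \<oplus>\<^bsub>triv\<^esub> x" using xc yc by (rule triv.a_comm)
    show "x \<oplus>\<^bsub>triv\<^esub> y \<in> {diag_pair i a \<phi> | a \<phi>. a \<in> carrier A \<and> linear_form \<phi>}"
      using x y diag_pair_add linear_form_simps(2) a_closed by blast
    fix z assume "z \<in> {diag_pair i a \<phi> | a \<phi>. a \<in> carrier A \<and> linear_form \<phi>}"
    then have "z \<in> carrier triv" using diag_pair_closed by blast
    with xc yc show "x \<oplus>\<^bsub>triv\<^esub> y \<oplus>\<^bsub>triv\<^esub> z = x \<oplus>\<^bsub>triv\<^esub> (y \<oplus>\<^bsub>triv\<^esub> z)" by (rule triv.a_assoc)
  next
    show "\<zero>\<^bsub>triv\<^esub> \<in> {diag_pair i a \<phi> | a \<phi>. a \<in> carrier A \<and> linear_form \<phi>}"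
      unfolding diag_pair_zero[of i, symmetric] using linear_form_simps(1) zero_closed by blast
  qed
qed

text \<open>
  In the trivial extension of \<open>A\<close> by its dual, the ideal generated by \<open>\<epsilon>\<close> contains \<open>\<epsilon> a\<close> for all \<open>a\<close>,
  hence the kernel of \<open>\<pi>\<close>, and the functionals \<open>x \<mapsto> \<gamma> (\<epsilon> b x)\<close> for all \<open>\<gamma>\<close> and \<open>b\<close>. The latter add up to
  the whole dual: a given \<open>\<phi>\<close> splits as \<open>\<phi> (\<epsilon> x) + \<phi> (x - \<epsilon> x)\<close>, where the first summand has \<open>\<gamma> = \<phi>\<close> and
  \<open>b = 1\<close>, and the second has \<open>\<gamma> = \<phi> \<circ> \<sigma>\<close> and \<open>b = \<alpha>\<close>. So \<open>\<alpha>\<close> must embed the complement of \<open>\<epsilon> A\<close> into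
  \<open>\<epsilon> A\<close> by left multiplication, with a linear left inverse \<open>\<sigma>\<close>. Conversely the ideal lies in the
  kernel of \<open>(a, \<phi>) \<mapsto> \<pi> a\<close> because \<open>\<pi> \<epsilon> = 0\<close>.
\<close>

theorem alg_isomorphic_corner_quotient:
  fixes B :: "('k, 'c) module"
  assumes "ring_hom_ring A B \<pi>" and surj: "\<pi> ` carrier A = carrier B"
    and \<pi>_smult: "\<And>c a. a \<in> carrier A \<Longrightarrow> \<pi> (c \<odot> a) = c \<odot>\<^bsub>B\<^esub> \<pi> a"
    and \<epsilon>: "\<epsilon> \<in> carrier A" "\<pi> \<epsilon> = \<zero>\<^bsub>B\<^esub>"
    and ker: "\<And>a. a \<in> carrier A \<Longrightarrow> \<pi> a = \<zero>\<^bsub>B\<^esub> \<Longrightarrow> \<epsilon> \<otimes> a = a"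
    and \<alpha>: "\<alpha> \<in> carrier A"
    and \<sigma>: "\<And>a. a \<in> carrier A \<Longrightarrow> \<sigma> a \<in> carrier A"
      "\<And>a b. a \<in> carrier A \<Longrightarrow> b \<in> carrier A \<Longrightarrow> \<sigma> (a \<oplus> b) = \<sigma> a \<oplus> \<sigma> b"
      "\<And>c a. a \<in> carrier A \<Longrightarrow> \<sigma> (c \<odot> a) = c \<odot> \<sigma> a"
      "\<And>a. a \<in> carrier A \<Longrightarrow> \<sigma> (\<epsilon> \<otimes> (\<alpha> \<otimes> a)) = a \<ominus> \<epsilon> \<otimes> a"
  shows "B \<cong>\<^sub>a\<^sub>l\<^sub>g alg_quot (corner triv (unit_pair i))
    (corner_ideal triv (unit_pair i) (to_triv_ext (diag i \<epsilon>)))"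
proof -
  interpret triv: abelian_group triv by (rule triv_abelian_group)
  interpret \<pi>: ring_hom_ring A B \<pi> by fact
  note \<epsilon>\<pi> = \<epsilon>(2) and \<epsilon> = \<epsilon>(1)
  define T where "T = corner triv (unit_pair i)"
  define \<psi> where "\<psi> = (\<lambda>x :: 'b zmat \<times> ('b zmat \<Rightarrow> 'k). \<pi> (diag_entry i (fst x)))"
  have T: "carrier T = {diag_pair i a \<phi> | a \<phi>. a \<in> carrier A \<and> linear_form \<phi>}"
    "add T = add triv" "mult T = mult triv" "smult T = smult triv" "one T = unit_pair i"
    unfolding T_def corner_carrier by (simp_all add: corner_def)
  have \<psi>_pair: "\<psi> (diag_pair i a \<phi>) = \<pi> a" if "a \<in> carrier A" for a \<phi>
    using that by (simp add: \<psi>_def diag_pair_def)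
  have \<pi>_hom: "\<pi> (a \<oplus> b) = \<pi> a \<oplus>\<^bsub>B\<^esub> \<pi> b" "\<pi> (a \<otimes> b) = \<pi> a \<otimes>\<^bsub>B\<^esub> \<pi> b"
    if "a \<in> carrier A" "b \<in> carrier A" for a b
    using that by simp_all
  define K where "K = {x \<in> carrier T. \<psi> x = \<zero>\<^bsub>B\<^esub>}"
  have pair_K: "diag_pair i a \<phi> \<in> K \<longleftrightarrow> \<pi> a = \<zero>\<^bsub>B\<^esub>" if "a \<in> carrier A" "linear_form \<phi>" for a \<phi>
    using that by (auto simp: K_def T \<psi>_pair)
  have K_E: "\<exists>a \<phi>. x = diag_pair i a \<phi> \<and> a \<in> carrier A \<and> linear_form \<phi> \<and> \<pi> a = \<zero>\<^bsub>B\<^esub>" if "x \<in> K" for x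
  proof -
    have "x \<in> carrier T" "\<psi> x = \<zero>\<^bsub>B\<^esub>" using that by (simp_all add: K_def)
    then obtain a \<phi> where "x = diag_pair i a \<phi>" "a \<in> carrier A" "linear_form \<phi>" by (auto simp: T)
    then show ?thesis using \<open>\<psi> x = \<zero>\<^bsub>B\<^esub>\<close> by (intro exI[of _ a] exI[of _ \<phi>]) (simp add: \<psi>_pair)
  qed
  define J where "J = corner_ideal triv (unit_pair i) (to_triv_ext (diag i \<epsilon>))"
  define G where "G = {unit_pair i \<otimes>\<^bsub>triv\<^esub> x \<otimes>\<^bsub>triv\<^esub> to_triv_ext (diag i \<epsilon>) \<otimes>\<^bsub>triv\<^esub> y \<otimes>\<^bsub>triv\<^esub> unit_pair i
    | x y. x \<in> carrier triv \<and> y \<in> carrier triv}"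
  have J: "J = generate (add_monoid triv) G" by (simp only: J_def G_def corner_ideal_def)
  have lin: "linear_form (\<lambda>x. \<eta> (x \<otimes> (a \<otimes> \<epsilon>)) + \<gamma> (\<epsilon> \<otimes> (b \<otimes> x)))"
    if "a \<in> carrier A" "b \<in> carrier A" "linear_form \<eta>" "linear_form \<gamma>" for a b \<eta> \<gamma>
    using that \<epsilon> linear_form_simps(5)[OF linear_form_simps(5)[OF that(4) \<epsilon>] that(2)]
    by (intro linear_form_simps(2,4)) auto
  have G_K: "g \<in> K" if "g \<in> G" for g
  proof -
    obtain x y where xy: "x \<in> carrier triv" "y \<in> carrier triv"
      and g: "g = unit_pair i \<otimes>\<^bsub>triv\<^esub> x \<otimes>\<^bsub>triv\<^esub> to_triv_ext (diag i \<epsilon>) \<otimes>\<^bsub>triv\<^esub> y \<otimes>\<^bsub>triv\<^esub> unit_pair i"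
      using \<open>g \<in> G\<close> unfolding G_def by blast
    have c: "diag_entry i (fst x) \<in> carrier A" "diag_entry i (fst y) \<in> carrier A"
      "linear_form (\<lambda>a. snd x (diag i a))" "linear_form (\<lambda>a. snd y (diag i a))"
      using xy diag_entry linear_form_dual_diag by auto
    show ?thesis
      unfolding g corner_ideal_product[OF xy \<epsilon>]
      using pair_K[OF _ lin[OF c(1,2) c(4,3)]] c \<epsilon> by (simp add: \<epsilon>\<pi>)
  qed
  have gen: "diag_pair i (a \<otimes> \<epsilon> \<otimes> b) (\<lambda>x. \<eta> (x \<otimes> (a \<otimes> \<epsilon>)) + \<gamma> (\<epsilon> \<otimes> (b \<otimes> x))) \<in> G"
    if "a \<in> carrier A" "b \<in> carrier A" "linear_form \<eta>" "linear_form \<gamma>" for a b \<eta> \<gamma>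
  proof -
    let ?x = "diag_pair i a \<gamma>" and ?y = "diag_pair i b \<eta>"
    have xy: "?x \<in> carrier triv" "?y \<in> carrier triv" using that by (simp_all only: diag_pair_closed)
    have "unit_pair i \<otimes>\<^bsub>triv\<^esub> ?x \<otimes>\<^bsub>triv\<^esub> to_triv_ext (diag i \<epsilon>) \<otimes>\<^bsub>triv\<^esub> ?y \<otimes>\<^bsub>triv\<^esub> unit_pair i
      = diag_pair i (a \<otimes> \<epsilon> \<otimes> b) (\<lambda>x. \<eta> (x \<otimes> (a \<otimes> \<epsilon>)) + \<gamma> (\<epsilon> \<otimes> (b \<otimes> x)))"
      unfolding corner_ideal_product[OF xy \<epsilon>]
      using that \<epsilon> unfolding diag_pair_def
      by (simp add: diag_form_def diag_entry(2) cong: if_cong)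
    then show ?thesis unfolding G_def using xy by (metis (mono_tags, lifting) mem_Collect_eq)
  qed
  have K_zero: "\<zero>\<^bsub>triv\<^esub> \<in> K"
    using pair_K[OF zero_closed linear_form_simps(1)] by (simp only: diag_pair_zero \<pi>.hom_zero)
  have J_add: "g \<oplus>\<^bsub>triv\<^esub> h \<in> J" if "g \<in> J" "h \<in> J" for g h
    using that generate.eng[of g "add_monoid triv" G h] by (simp add: J del: triv_simps)
  have G_J: "g \<in> J" if "g \<in> G" for g
    unfolding J using that by (rule generate.incl)
  have "J \<subseteq> K"
  proof
    fix x assume "x \<in> J"
    then show "x \<in> K"
      unfolding J
    proof induction
      case one
      then show ?case using K_zero by simp
    next
      case (incl h)
      then show ?case by (rule G_K)
    next
      case (inv h)
      then obtain a \<phi> where h: "h = diag_pair i a \<phi>" "a \<in> carrier A" "linear_form \<phi>" "\<pi> a = \<zero>\<^bsub>B\<^esub>"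
        using K_E G_K by blast
      have "diag_pair i (\<ominus> a) (\<lambda>x. (- 1) * \<phi> x) \<oplus>\<^bsub>triv\<^esub> h = \<zero>\<^bsub>triv\<^esub>"
        using h by (simp add: diag_pair_add l_neg diag_pair_zero del: triv_simps)
      then have "\<ominus>\<^bsub>triv\<^esub> h = diag_pair i (\<ominus> a) (\<lambda>x. (- 1) * \<phi> x)"
        using h linear_form_simps(3)[OF h(3), of "- 1"]
        by (intro triv.minus_equality) (auto intro!: diag_pair_closed simp del: triv_simps)
      moreover have "\<pi> (\<ominus> a) = \<zero>\<^bsub>B\<^esub>"
        using h by simp
      ultimately have "\<ominus>\<^bsub>triv\<^esub> h \<in> K" using pair_K[OF a_inv_closed[OF h(2)] linear_form_simps(3)[OF h(3), of "- 1"]] by simp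
      then show ?case by (simp add: a_inv_def)
    next
      case (eng g h)
      then obtain a \<phi> b \<chi> where "g = diag_pair i a \<phi>" "a \<in> carrier A" "linear_form \<phi>" "\<pi> a = \<zero>\<^bsub>B\<^esub>"
        "h = diag_pair i b \<chi>" "b \<in> carrier A" "linear_form \<chi>" "\<pi> b = \<zero>\<^bsub>B\<^esub>"
        using K_E by meson
      then have "g \<oplus>\<^bsub>triv\<^esub> h \<in> K"
        by (simp add: diag_pair_add pair_K linear_form_simps \<pi>_hom del: triv_simps)
      then show ?case by simp
    qed
  qed
  moreover have "K \<subseteq> J"
  proof
    fix x assume "x \<in> K"
    then obtain a \<phi> where x: "x = diag_pair i a \<phi>" "a \<in> carrier A" "linear_form \<phi>" "\<pi> a = \<zero>\<^bsub>B\<^esub>"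
      using K_E by blast
    have \<epsilon>a: "\<epsilon> \<otimes> a = a" using ker x by simp
    have \<phi>\<sigma>: "linear_form (\<lambda>x. \<phi> (\<sigma> x))" using x(3) \<sigma> by (auto simp: linear_form_def)
    note z = linear_form_simps(1)
    have "diag_pair i a (\<lambda>x. 0) \<in> G"
      using gen[OF \<epsilon> x(2) z z] \<epsilon> x \<epsilon>a by (simp add: m_assoc)
    moreover have "diag_pair i \<zero> (\<lambda>x. \<phi> (\<epsilon> \<otimes> x)) \<in> G"
    proof -
      have "diag_form i (\<lambda>x. 0 + \<phi> (\<epsilon> \<otimes> (\<one> \<otimes> x))) = diag_form i (\<lambda>x. \<phi> (\<epsilon> \<otimes> x))"
        by (rule diag_form_cong) simp
      then show ?thesis using gen[OF zero_closed one_closed z x(3)] \<epsilon> by (simp add: diag_pair_def)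
    qed
    moreover have "diag_pair i \<zero> (\<lambda>x. \<phi> (\<sigma> (\<epsilon> \<otimes> (\<alpha> \<otimes> x)))) \<in> G"
      using gen[OF zero_closed \<alpha> z \<phi>\<sigma>] \<epsilon> \<alpha> by simp
    ultimately have "diag_pair i a (\<lambda>x. 0) \<oplus>\<^bsub>triv\<^esub>
        (diag_pair i \<zero> (\<lambda>x. \<phi> (\<epsilon> \<otimes> x)) \<oplus>\<^bsub>triv\<^esub> diag_pair i \<zero> (\<lambda>x. \<phi> (\<sigma> (\<epsilon> \<otimes> (\<alpha> \<otimes> x))))) \<in> J"
      by (intro J_add G_J)
    moreover have eq: "diag_form i (\<lambda>x. 0 + (\<phi> (\<epsilon> \<otimes> x) + \<phi> (\<sigma> (\<epsilon> \<otimes> (\<alpha> \<otimes> x))))) = diag_form i \<phi>"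
    proof (rule diag_form_cong)
      fix b assume b: "b \<in> carrier A"
      have "\<epsilon> \<otimes> b \<oplus> (b \<ominus> \<epsilon> \<otimes> b) = b" using b \<epsilon>
        by (simp add: a_minus_def a_lcomm[of "\<epsilon> \<otimes> b" b] r_neg)
      then have "\<phi> (\<epsilon> \<otimes> b) + \<phi> (b \<ominus> \<epsilon> \<otimes> b) = \<phi> b"
        using x(3) b \<epsilon> unfolding linear_form_def by (metis m_closed minus_closed)
      then show "0 + (\<phi> (\<epsilon> \<otimes> b) + \<phi> (\<sigma> (\<epsilon> \<otimes> (\<alpha> \<otimes> b)))) = \<phi> b" using \<sigma>(4)[OF b] by simp
    qed
    have "diag_pair i a (\<lambda>x. 0) \<oplus>\<^bsub>triv\<^esub>
        (diag_pair i \<zero> (\<lambda>x. \<phi> (\<epsilon> \<otimes> x)) \<oplus>\<^bsub>triv\<^esub> diag_pair i \<zero> (\<lambda>x. \<phi> (\<sigma> (\<epsilon> \<otimes> (\<alpha> \<otimes> x))))) = x"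
      using x(2) eq by (simp add: diag_pair_add x(1) del: triv_simps) (simp add: diag_pair_def)
    ultimately show "x \<in> J" by (simp only:)
  qed
  ultimately have "J = K" by blast
  have "B \<cong>\<^sub>a\<^sub>l\<^sub>g alg_quot T K"
  proof (rule alg_isomorphic_alg_quot_kernel[where \<psi> = \<psi>])
    show "abelian_group T" unfolding T_def by (rule corner_abelian_group)
    show "abelian_group B" by (rule \<pi>.S.abelian_group_axioms)
    show "\<psi> ` carrier T = carrier B"
    proof
      show "\<psi> ` carrier T \<subseteq> carrier B" using surj by (auto simp: T \<psi>_pair)
      show "carrier B \<subseteq> \<psi> ` carrier T"
      proof
        fix b assume "b \<in> carrier B"
        then obtain a where a: "a \<in> carrier A" "b = \<pi> a" using surj by blast
        then have "diag_pair i a (\<lambda>x. 0) \<in> carrier T" using linear_form_simps(1) unfolding T by blast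
        then show "b \<in> \<psi> ` carrier T" using a \<psi>_pair by (metis imageI)
      qed
    qed
    show "\<one>\<^bsub>T\<^esub> \<in> carrier T" using linear_form_simps(1) one_closed unfolding T unit_pair_eq by blast
    show "\<psi> \<one>\<^bsub>T\<^esub> = \<one>\<^bsub>B\<^esub>" by (simp add: T unit_pair_eq \<psi>_pair)
    show "K = {x \<in> carrier T. \<psi> x = \<zero>\<^bsub>B\<^esub>}" by (rule K_def)
    fix x assume "x \<in> carrier T"
    then obtain a \<phi> where x: "x = diag_pair i a \<phi>" "a \<in> carrier A" "linear_form \<phi>" by (auto simp: T)
    fix c
    show "c \<odot>\<^bsub>T\<^esub> x \<in> carrier T" and "\<psi> (c \<odot>\<^bsub>T\<^esub> x) = c \<odot>\<^bsub>B\<^esub> \<psi> x"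
      using x linear_form_simps(3) by (auto simp: T diag_pair_smult \<psi>_pair \<pi>_smult simp del: triv_simps)
    fix y assume "y \<in> carrier T"
    then obtain b \<chi> where y: "y = diag_pair i b \<chi>" "b \<in> carrier A" "linear_form \<chi>" by (auto simp: T)
    show "\<psi> (x \<oplus>\<^bsub>T\<^esub> y) = \<psi> x \<oplus>\<^bsub>B\<^esub> \<psi> y" and "\<psi> (x \<otimes>\<^bsub>T\<^esub> y) = \<psi> x \<otimes>\<^bsub>B\<^esub> \<psi> y"
      using x y by (simp_all add: T diag_pair_add diag_pair_mult \<psi>_pair \<pi>_hom del: triv_simps)
    have "linear_form (\<lambda>u. \<chi> (u \<otimes> a) + \<phi> (b \<otimes> u))"
      using x y by (intro linear_form_simps)
    then show "x \<otimes>\<^bsub>T\<^esub> y \<in> carrier T"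
      using x y unfolding T by (auto simp: diag_pair_mult simp del: triv_simps)
  qed
  then show ?thesis using \<open>J = K\<close> by (simp add: J_def T_def)
qed

end

section \<open>The quiver with the attached arrows\<close>

text \<open>
  The path \<open>\<alpha>\<^sub>v p\<close>, where \<open>v\<close> is the end of \<open>p\<close>.
\<close>

fun alpha_path :: "('v, 'a) qpath \<Rightarrow> ('v + 'v, 'a + 'v) qpath" where
  "alpha_path (u, p, v) = (Inl u, map Inl p @ [Inr v], Inr v)"

lemma tilde_quiver_simps [simp]:
  "verts (tilde_quiver Q) = Inl ` verts Q \<union> Inr ` verts Q"
  "arcs (tilde_quiver Q) = Inl ` arcs Q \<union> Inr ` verts Q"
  "tail (tilde_quiver Q) (Inl a) = Inl (tail Q a)" "tail (tilde_quiver Q) (Inr v) = Inl v"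
  "head (tilde_quiver Q) (Inl a) = Inl (head Q a)" "head (tilde_quiver Q) (Inr v) = Inr v"
  by (simp_all add: tilde_quiver_def)

lemma (in fin_digraph) fin_digraph_tilde_quiver: "fin_digraph (tilde_quiver G)"
  by unfold_locales auto

lemma cas_tilde_Inr: "pre_digraph.cas (tilde_quiver Q) (Inr u) p w \<longleftrightarrow> p = [] \<and> w = Inr u"
proof (cases p)
  case (Cons a q)
  then show ?thesis by (cases a) (auto simp: pre_digraph.cas.simps)
qed (auto simp: pre_digraph.cas.simps)

lemma cas_tilde_Inl:
  "pre_digraph.cas (tilde_quiver Q) (Inl u) p w \<longleftrightarrow>
    (\<exists>q v. pre_digraph.cas Q u q v \<and>
      (p = map Inl q \<and> w = Inl v \<or> p = map Inl q @ [Inr v] \<and> w = Inr v))"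
proof (induction p arbitrary: u)
  case Nil
  then show ?case by (auto simp: pre_digraph.cas.simps)
next
  case (Cons a p)
  show ?case
  proof (cases a)
    case (Inl b)
    have "pre_digraph.cas (tilde_quiver Q) (Inl u) (a # p) w \<longleftrightarrow>
        tail Q b = u \<and> pre_digraph.cas (tilde_quiver Q) (Inl (head Q b)) p w"
      by (simp add: Inl pre_digraph.cas.simps)
    also have "\<dots> \<longleftrightarrow> (\<exists>q v. pre_digraph.cas Q u (b # q) v \<and>
      (p = map Inl q \<and> w = Inl v \<or> p = map Inl q @ [Inr v] \<and> w = Inr v))"
      by (auto simp: Cons.IH pre_digraph.cas.simps)
    also have "\<dots> \<longleftrightarrow> (\<exists>q v. pre_digraph.cas Q u q v \<and>
      (a # p = map Inl q \<and> w = Inl v \<or> a # p = map Inl q @ [Inr v] \<and> w = Inr v))" (is "_ \<longleftrightarrow> ?R")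
    proof
      assume ?R
      then obtain q v where qv: "pre_digraph.cas Q u q v"
        "a # p = map Inl q \<and> w = Inl v \<or> a # p = map Inl q @ [Inr v] \<and> w = Inr v"
        by (elim exE conjE) (rule that)
      then obtain q' where "q = b # q'" by (cases q) (auto simp: Inl)
      with qv show "\<exists>q v. pre_digraph.cas Q u (b # q) v \<and>
        (p = map Inl q \<and> w = Inl v \<or> p = map Inl q @ [Inr v] \<and> w = Inr v)" by auto
    qed (use Inl in \<open>force intro: exI[of _ "b # _"]\<close>)
    finally show ?thesis .
  next
    case (Inr k)
    have "pre_digraph.cas (tilde_quiver Q) (Inl u) (a # p) w \<longleftrightarrow> k = u \<and> p = [] \<and> w = Inr k"
      by (simp add: Inr pre_digraph.cas.simps cas_tilde_Inr)
    also have "\<dots> \<longleftrightarrow> (\<exists>q v. pre_digraph.cas Q u q v \<and>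
      (a # p = map Inl q \<and> w = Inl v \<or> a # p = map Inl q @ [Inr v] \<and> w = Inr v))" (is "_ \<longleftrightarrow> ?R")
    proof
      assume ?R
      then obtain q v where qv: "pre_digraph.cas Q u q v"
        "a # p = map Inl q \<and> w = Inl v \<or> a # p = map Inl q @ [Inr v] \<and> w = Inr v"
        by (elim exE conjE) (rule that)
      then have "q = []" by (cases q) (auto simp: Inr)
      with qv show "k = u \<and> p = [] \<and> w = Inr k" by (auto simp: Inr pre_digraph.cas.simps)
    qed (auto simp: Inr pre_digraph.cas.simps intro!: exI[of _ "[]"])
    finally show ?thesis .
  qed
qed

lemma Inl_image_subset_iff: "Inl ` S \<subseteq> Inl ` T \<union> Inr ` U \<longleftrightarrow> S \<subseteq> T"
  by auto

text \<open>
  No arrow starts at a new vertex, so a new arrow can occur in a path only as the last one.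
\<close>

lemma qpaths_tilde_quiver_cases [consumes 1, case_names tilde alpha trivial]:
  assumes "p \<in> qpaths (tilde_quiver Q)"
  obtains q where "q \<in> qpaths Q" "p = tilde_path q"
  | q where "q \<in> qpaths Q" "p = alpha_path q"
  | v where "v \<in> verts Q" "p = (Inr v, [], Inr v)"
proof -
  obtain x as y where p: "p = (x, as, y)" by (cases p)
  have walk: "x \<in> verts (tilde_quiver Q)" "set as \<subseteq> arcs (tilde_quiver Q)"
    "pre_digraph.cas (tilde_quiver Q) x as y"
    using assms unfolding p by (auto simp: qpaths_def pre_digraph.awalk_def)
  show ?thesis
  proof (cases x)
    case (Inl u)
    then obtain q v where q: "pre_digraph.cas Q u q v"
      "as = map Inl q \<and> y = Inl v \<or> as = map Inl q @ [Inr v] \<and> y = Inr v"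
      using walk(3) cas_tilde_Inl by metis
    then have "(u, q, v) \<in> qpaths Q"
      using walk Inl by (auto simp: qpaths_def pre_digraph.awalk_def Inl_image_subset_iff)
    then show ?thesis using q Inl p that(1)[of "(u, q, v)"] that(2)[of "(u, q, v)"] by auto
  next
    case (Inr v)
    then show ?thesis using walk p that(3)[of v] by (auto simp: cas_tilde_Inr)
  qed
qed

lemma trivial_tilde_qpath: "v \<in> verts Q \<Longrightarrow> (Inr v, [], Inr v) \<in> qpaths (tilde_quiver Q)"
  by (simp add: qpaths_def pre_digraph.awalk_def pre_digraph.cas.simps)

lemma tilde_path_qpaths: "q \<in> qpaths Q \<Longrightarrow> tilde_path q \<in> qpaths (tilde_quiver Q)"
  by (cases q) (auto simp: qpaths_def pre_digraph.awalk_def cas_tilde_Inl)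

lemma (in wf_digraph) alpha_path_qpaths:
  assumes "q \<in> qpaths G"
  shows "alpha_path q \<in> qpaths (tilde_quiver G)"
proof -
  obtain u p v where q: "q = (u, p, v)" by (cases q)
  then have "v \<in> verts G" using assms qpaths_verts by blast
  then show ?thesis using assms unfolding q by (auto simp: qpaths_def awalk_def pre_digraph.awalk_def cas_tilde_Inl)
qed

lemma inj_tilde_path: "inj tilde_path"
proof (rule injI)
  fix p q :: "('a, 'b) qpath"
  assume "tilde_path p = tilde_path q"
  then show "p = q" by (cases p; cases q) (simp add: inj_map_eq_map)
qed

lemma inj_alpha_path: "inj alpha_path"
proof (rule injI)
  fix p q :: "('a, 'b) qpath"
  assume "alpha_path p = alpha_path q"
  then show "p = q" by (cases p; cases q) (simp add: inj_map_eq_map)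
qed

lemma tilde_alpha_distinct [simp]:
  "tilde_path p \<noteq> alpha_path q" "alpha_path q \<noteq> tilde_path p"
  "tilde_path p \<noteq> (Inr v, [], Inr w)" "(Inr v, [], Inr w) \<noteq> tilde_path p"
  "alpha_path p \<noteq> (Inr v, [], Inr w)" "(Inr v, [], Inr w) \<noteq> alpha_path p"
  by (cases p; cases q; simp)+

subsection \<open>Linear maps between the path algebras\<close>

definition push_paths :: "('p \<Rightarrow> 'q) \<Rightarrow> ('p \<Rightarrow>\<^sub>0 'k::comm_monoid_add) \<Rightarrow> ('q \<Rightarrow>\<^sub>0 'k)" where
  "push_paths f x = (\<Sum>p\<in>Poly_Mapping.keys x. Poly_Mapping.single (f p) (Poly_Mapping.lookup x p))"

lemma tilde_elem_eq: "tilde_elem = push_paths tilde_path"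
  by (simp add: fun_eq_iff tilde_elem_def push_paths_def)

lemma push_paths_add: "push_paths f (x + y) = push_paths f x + push_paths f y"
  unfolding push_paths_def by (rule setsum_keys_plus_distrib) (simp_all add: single_add)

lemma push_paths_single [simp]: "push_paths f (Poly_Mapping.single p c) = Poly_Mapping.single (f p) c"
  by (cases "c = 0") (simp_all add: push_paths_def)

lemma push_paths_zero [simp]: "push_paths f 0 = 0"
  by (simp add: push_paths_def)

lemma push_paths_scale:
  "push_paths f (Poly_Mapping.map ((*) c) x) = Poly_Mapping.map ((*) (c::'k::field)) (push_paths f x)"
  by (induction x rule: poly_mapping_keys_induct[OF subset_UNIV])
    (simp_all add: push_paths_add map_scale_add)

lemma keys_push_paths: "f ` Poly_Mapping.keys x \<subseteq> S \<Longrightarrow> Poly_Mapping.keys (push_paths f x) \<subseteq> S"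
  unfolding push_paths_def by (rule keys_sum_subset) auto

lemma map_key_single_notin:
  assumes "inj f" "p \<notin> range f"
  shows "Poly_Mapping.map_key f (Poly_Mapping.single p c) = 0"
  by (rule poly_mapping_eqI) (use assms in \<open>auto simp: map_key.rep_eq lookup_single when_def\<close>)

text \<open>
  By the classification of its paths, the path algebra of the enlarged quiver consists of three blocks:
  a copy of the old path algebra, a copy of it multiplied by the new arrows, and the span of the new
  vertices. The maps \<open>drop_alpha\<close>, \<open>strip_alpha\<close> and \<open>new_vertices\<close> read these blocks, the last one with
  a new vertex replaced by the trivial path at the old one.
\<close>

definition drop_alpha :: "(('v + 'v, 'a + 'v) qpath \<Rightarrow>\<^sub>0 'k::field) \<Rightarrow> (('v, 'a) qpath \<Rightarrow>\<^sub>0 'k)" where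
  "drop_alpha = Poly_Mapping.map_key tilde_path"

definition strip_alpha :: "(('v + 'v, 'a + 'v) qpath \<Rightarrow>\<^sub>0 'k::field) \<Rightarrow> (('v, 'a) qpath \<Rightarrow>\<^sub>0 'k)" where
  "strip_alpha = Poly_Mapping.map_key alpha_path"

fun new_vertex_coeff :: "('v + 'v, 'a + 'v) qpath \<Rightarrow> 'k::field \<Rightarrow> (('v, 'a) qpath \<Rightarrow>\<^sub>0 'k)" where
  "new_vertex_coeff (Inr v, [], Inr w) c = Poly_Mapping.single (v, [], v) c"
| "new_vertex_coeff _ c = 0"

definition new_vertices :: "(('v + 'v, 'a + 'v) qpath \<Rightarrow>\<^sub>0 'k::field) \<Rightarrow> (('v, 'a) qpath \<Rightarrow>\<^sub>0 'k)" where
  "new_vertices x = (\<Sum>p\<in>Poly_Mapping.keys x. new_vertex_coeff p (Poly_Mapping.lookup x p))"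

lemma new_vertex_coeff_add:
  "new_vertex_coeff p (c + d) = new_vertex_coeff p c + new_vertex_coeff p d"
  "new_vertex_coeff p 0 = 0"
  by (induction p c rule: new_vertex_coeff.induct; simp add: single_add)+

lemma coeff_maps_add:
  "drop_alpha (x + y) = drop_alpha x + drop_alpha y"
  "strip_alpha (x + y) = strip_alpha x + strip_alpha y"
  "new_vertices (x + y) = new_vertices x + new_vertices y"
  by (simp_all add: drop_alpha_def strip_alpha_def map_key_plus inj_tilde_path inj_alpha_path)
    (unfold new_vertices_def, rule setsum_keys_plus_distrib, simp_all add: new_vertex_coeff_add)

lemma coeff_maps_zero [simp]:
  "drop_alpha 0 = 0" "strip_alpha 0 = 0" "new_vertices 0 = 0"
  by (simp_all add: drop_alpha_def strip_alpha_def new_vertices_def inj_tilde_path inj_alpha_path)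

lemma coeff_maps_scale:
  "drop_alpha (Poly_Mapping.map ((*) c) x) = Poly_Mapping.map ((*) c) (drop_alpha x)"
  "strip_alpha (Poly_Mapping.map ((*) c) x) = Poly_Mapping.map ((*) c) (strip_alpha x)"
  by (simp_all add: drop_alpha_def strip_alpha_def map_key_map inj_tilde_path inj_alpha_path)

lemma new_vertex_coeff_paths [simp]:
  "new_vertex_coeff (tilde_path p) c = 0" "new_vertex_coeff (alpha_path p) c = 0"
  by (cases p; simp)+

lemma coeff_maps_single [simp]:
  "drop_alpha (Poly_Mapping.single (tilde_path p) c) = Poly_Mapping.single p c"
  "drop_alpha (Poly_Mapping.single (alpha_path p) c) = 0"
  "drop_alpha (Poly_Mapping.single (Inr v, [], Inr w) c) = 0"
  "strip_alpha (Poly_Mapping.single (tilde_path p) c) = 0"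
  "strip_alpha (Poly_Mapping.single (alpha_path p) c) = Poly_Mapping.single p c"
  "strip_alpha (Poly_Mapping.single (Inr v, [], Inr w) c) = 0"
  "new_vertices (Poly_Mapping.single (tilde_path p) c) = 0"
  "new_vertices (Poly_Mapping.single (alpha_path p) c) = 0"
  "new_vertices (Poly_Mapping.single (Inr v, [], Inr w) c) = Poly_Mapping.single (v, [], v) c"
  unfolding drop_alpha_def strip_alpha_def new_vertices_def
  by (simp_all add: inj_tilde_path inj_alpha_path map_key_single_notin image_iff)

lemma coeff_maps_push [simp]:
  "drop_alpha (push_paths tilde_path x) = x"
  "drop_alpha (push_paths alpha_path x) = 0"
  "strip_alpha (push_paths tilde_path x) = 0"
  "strip_alpha (push_paths alpha_path x) = x"
  "new_vertices (push_paths tilde_path x) = 0"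
  "new_vertices (push_paths alpha_path x) = 0"
  by (induction x rule: poly_mapping_keys_induct[OF subset_UNIV]; simp add: push_paths_add coeff_maps_add)+

lemma path_mult_single_tilde:
  "path_mult (Poly_Mapping.single (tilde_path p) c) (Poly_Mapping.single (tilde_path q) d)
    = push_paths tilde_path (path_mult (Poly_Mapping.single p c) (Poly_Mapping.single q d))"
  "path_mult (Poly_Mapping.single (alpha_path p) c) (Poly_Mapping.single (tilde_path q) d)
    = push_paths alpha_path (path_mult (Poly_Mapping.single p c) (Poly_Mapping.single q d))"
  "path_mult (Poly_Mapping.single (Inr v, [], Inr v) c) (Poly_Mapping.single (alpha_path q) d)
    = push_paths alpha_path (path_mult (Poly_Mapping.single (v, [], v) c) (Poly_Mapping.single q d))"
  "path_mult (Poly_Mapping.single (Inr v, [], Inr v) c) (Poly_Mapping.single (Inr w, [], Inr w) d)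
    = (if v = w then Poly_Mapping.single (Inr v, [], Inr v) (c * d) else 0)"
  "path_mult (Poly_Mapping.single (tilde_path p) c) (Poly_Mapping.single (alpha_path q) d) = 0"
  "path_mult (Poly_Mapping.single (alpha_path p) c) (Poly_Mapping.single (alpha_path q) d) = 0"
  "path_mult (Poly_Mapping.single (tilde_path p) c) (Poly_Mapping.single (Inr v, [], Inr v) d) = 0"
  "path_mult (Poly_Mapping.single (alpha_path p) c) (Poly_Mapping.single (Inr v, [], Inr v) d) = 0"
  "path_mult (Poly_Mapping.single (Inr v, [], Inr v) c) (Poly_Mapping.single (tilde_path q) d) = 0"
  by (cases p; cases q; auto simp: path_mult_single)+

lemma path_mult_push_tilde:
  "path_mult (push_paths tilde_path x) (push_paths tilde_path y) = push_paths tilde_path (path_mult x y)"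
proof (induction x rule: poly_mapping_keys_induct[OF subset_UNIV])
  case (2 p c)
  show ?case
    by (induction y rule: poly_mapping_keys_induct[OF subset_UNIV])
      (simp_all add: path_mult_add_right push_paths_add path_mult_single_tilde)
qed (simp_all add: path_mult_add_left push_paths_add)

text \<open>
  The blocks multiply like lower triangular matrices with diagonal \<open>drop_alpha\<close>, \<open>new_vertices\<close> and
  off-diagonal entry \<open>strip_alpha\<close>.
\<close>

lemma coeff_maps_path_mult:
  fixes x y :: "('v + 'v, 'a + 'v) qpath \<Rightarrow>\<^sub>0 'k::field"
  assumes x: "Poly_Mapping.keys x \<subseteq> qpaths (tilde_quiver Q)"
    and y: "Poly_Mapping.keys y \<subseteq> qpaths (tilde_quiver Q)"
  shows "drop_alpha (path_mult x y) = path_mult (drop_alpha x) (drop_alpha y)"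
    and "strip_alpha (path_mult x y)
      = path_mult (strip_alpha x) (drop_alpha y) + path_mult (new_vertices x) (strip_alpha y)"
    and "new_vertices (path_mult x y) = path_mult (new_vertices x) (new_vertices y)"
proof -
  have "drop_alpha (path_mult x y) = path_mult (drop_alpha x) (drop_alpha y)
    \<and> strip_alpha (path_mult x y)
      = path_mult (strip_alpha x) (drop_alpha y) + path_mult (new_vertices x) (strip_alpha y)
    \<and> new_vertices (path_mult x y) = path_mult (new_vertices x) (new_vertices y)"
    using x
  proof (induction x rule: poly_mapping_keys_induct)
    case (single p c)
    show ?case
      using y
    proof (induction y rule: poly_mapping_keys_induct)
      case (single q d)
      show ?case
        using \<open>p \<in> qpaths (tilde_quiver Q)\<close>
      proof (cases rule: qpaths_tilde_quiver_cases)
        case p: (tilde p')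
        from single show ?thesis
          by (cases rule: qpaths_tilde_quiver_cases) (simp_all add: p path_mult_single_tilde)
      next
        case p: (alpha p')
        from single show ?thesis
          by (cases rule: qpaths_tilde_quiver_cases) (simp_all add: p path_mult_single_tilde)
      next
        case p: (trivial v)
        from single show ?thesis
          by (cases rule: qpaths_tilde_quiver_cases)
            (simp_all add: p path_mult_single_tilde path_mult_single)
      qed
    qed (simp_all add: path_mult_add_right coeff_maps_add algebra_simps)
  qed (simp_all add: path_mult_add_left coeff_maps_add algebra_simps)
  then show "drop_alpha (path_mult x y) = path_mult (drop_alpha x) (drop_alpha y)"
    and "strip_alpha (path_mult x y)
      = path_mult (strip_alpha x) (drop_alpha y) + path_mult (new_vertices x) (strip_alpha y)"
    and "new_vertices (path_mult x y) = path_mult (new_vertices x) (new_vertices y)"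
    by auto
qed

lemma keys_coeff_maps:
  fixes x :: "('v + 'v, 'a + 'v) qpath \<Rightarrow>\<^sub>0 'k::field"
  assumes x: "Poly_Mapping.keys x \<subseteq> qpaths (tilde_quiver Q)"
  shows "Poly_Mapping.keys (drop_alpha x) \<subseteq> qpaths Q"
    and "Poly_Mapping.keys (strip_alpha x) \<subseteq> qpaths Q"
    and "Poly_Mapping.keys (new_vertices x) \<subseteq> qpaths Q"
proof -
  have "Poly_Mapping.keys (drop_alpha x) \<subseteq> qpaths Q \<and> Poly_Mapping.keys (strip_alpha x) \<subseteq> qpaths Q
      \<and> Poly_Mapping.keys (new_vertices x) \<subseteq> qpaths Q"
    using x
  proof (induction x rule: poly_mapping_keys_induct)
    case (single p c)
    then show ?case
      by (cases rule: qpaths_tilde_quiver_cases) (auto simp: pre_digraph.trivial_qpath)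
  qed (simp_all add: coeff_maps_add keys_add_subset)
  then show "Poly_Mapping.keys (drop_alpha x) \<subseteq> qpaths Q"
    and "Poly_Mapping.keys (strip_alpha x) \<subseteq> qpaths Q"
    and "Poly_Mapping.keys (new_vertices x) \<subseteq> qpaths Q" by auto
qed

definition sum_new_vertices :: "('v, 'a) pre_digraph \<Rightarrow> (('v + 'v, 'a + 'v) qpath \<Rightarrow>\<^sub>0 'k::field)" where
  "sum_new_vertices Q = (\<Sum>v\<in>verts Q. Poly_Mapping.single (Inr v, [], Inr v) 1)"

definition sum_new_arrows :: "('v, 'a) pre_digraph \<Rightarrow> (('v + 'v, 'a + 'v) qpath \<Rightarrow>\<^sub>0 'k::field)" where
  "sum_new_arrows Q = (\<Sum>v\<in>verts Q. Poly_Mapping.single (alpha_path (v, [], v)) 1)"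

lemma coeff_maps_sum:
  "drop_alpha (sum f S) = (\<Sum>i\<in>S. drop_alpha (f i))"
  "strip_alpha (sum f S) = (\<Sum>i\<in>S. strip_alpha (f i))"
  "new_vertices (sum f S) = (\<Sum>i\<in>S. new_vertices (f i))"
  by (induction S rule: infinite_finite_induct; simp add: coeff_maps_add)+

lemma coeff_maps_sum_new_vertices:
  "drop_alpha (sum_new_vertices Q) = 0"
  "strip_alpha (sum_new_vertices Q) = 0"
  "new_vertices (sum_new_vertices Q) = one (path_algebra Q)"
  by (simp_all add: sum_new_vertices_def coeff_maps_sum)

lemma coeff_maps_sum_new_arrows:
  "drop_alpha (sum_new_arrows Q) = 0"
  "strip_alpha (sum_new_arrows Q) = one (path_algebra Q)"
  "new_vertices (sum_new_arrows Q) = 0"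
  by (simp_all add: sum_new_arrows_def coeff_maps_sum del: alpha_path.simps)

lemma (in wf_digraph) keys_sum_new:
  "Poly_Mapping.keys (sum_new_vertices G) \<subseteq> qpaths (tilde_quiver G)"
  "Poly_Mapping.keys (sum_new_arrows G) \<subseteq> qpaths (tilde_quiver G)"
  unfolding sum_new_vertices_def sum_new_arrows_def
  by (rule keys_sum_subset; simp add: trivial_tilde_qpath alpha_path_qpaths del: alpha_path.simps)+

lemma (in fin_digraph) split_new_vertices:
  fixes x :: "('a + 'a, 'b + 'a) qpath \<Rightarrow>\<^sub>0 'k::field"
  assumes "Poly_Mapping.keys x \<subseteq> qpaths (tilde_quiver G)"
  shows "x = push_paths tilde_path (drop_alpha x) + path_mult (sum_new_vertices G) x"
  using assms
proof (induction x rule: poly_mapping_keys_induct)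
  case (single p c)
  then show ?case
  proof (cases rule: qpaths_tilde_quiver_cases)
    case (alpha q)
    then have "drop_alpha (Poly_Mapping.single p c) = 0" by simp
    moreover have "path_mult (sum_new_vertices G) (Poly_Mapping.single p c) = Poly_Mapping.single p c"
      using alpha qpaths_verts
      by (cases q) (auto simp: sum_new_vertices_def path_mult_sum_left path_mult_single)
    ultimately show ?thesis by simp
  qed (auto simp: sum_new_vertices_def path_mult_sum_left path_mult_single_tilde)
next
  case (add x y)
  then show ?case
  proof -
    have "push_paths tilde_path (drop_alpha (x + y)) + path_mult (sum_new_vertices G) (x + y)
      = (push_paths tilde_path (drop_alpha x) + path_mult (sum_new_vertices G) x)
        + (push_paths tilde_path (drop_alpha y) + path_mult (sum_new_vertices G) y)"
      by (simp add: coeff_maps_add push_paths_add path_mult_add_right add_ac)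
    then show ?thesis by (simp only: add.IH[symmetric])
  qed
qed simp

text \<open>
  Multiplying by the new arrows moves the first block into the second, where \<open>strip_alpha\<close> reads it back.
\<close>

lemma (in fin_digraph) strip_alpha_mult_new:
  fixes x :: "('a + 'a, 'b + 'a) qpath \<Rightarrow>\<^sub>0 'k::field"
  assumes x: "Poly_Mapping.keys x \<subseteq> qpaths (tilde_quiver G)"
  shows "strip_alpha (path_mult (sum_new_vertices G) (path_mult (sum_new_arrows G) x)) = drop_alpha x"
proof -
  interpret T: fin_digraph "tilde_quiver G" by (rule fin_digraph_tilde_quiver)
  have \<alpha>x: "Poly_Mapping.keys (path_mult (sum_new_arrows G) x) \<subseteq> qpaths (tilde_quiver G)"
    using x by (intro T.keys_path_mult keys_sum_new)
  have "strip_alpha (path_mult (sum_new_vertices G) (path_mult (sum_new_arrows G) x))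
      = path_mult (one (path_algebra G)) (strip_alpha (path_mult (sum_new_arrows G) x))"
    using coeff_maps_path_mult(2)[OF keys_sum_new(1) \<alpha>x] by (simp add: coeff_maps_sum_new_vertices del: path_algebra_simps)
  also have "strip_alpha (path_mult (sum_new_arrows G) x) = path_mult (one (path_algebra G)) (drop_alpha x)"
    using coeff_maps_path_mult(2)[OF keys_sum_new(2) x] by (simp add: coeff_maps_sum_new_arrows del: path_algebra_simps)
  also have "path_mult (one (path_algebra G)) (path_mult (one (path_algebra G)) (drop_alpha x)) = drop_alpha x"
    using keys_coeff_maps(1)[OF x] by (simp add: path_mult_one)
  finally show ?thesis .
qed

section \<open>The relations of the enlarged quiver\<close>

locale quiver_with_relations = fin_digraph G for G :: "('v, 'a) pre_digraph" +
  fixes R :: "(('v, 'a) qpath \<Rightarrow>\<^sub>0 'k::field) set"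
  assumes relations: "R \<subseteq> carrier (path_algebra G)"
begin

abbreviation "P \<equiv> path_algebra G :: ('k, ('v, 'a) qpath \<Rightarrow>\<^sub>0 'k) module"
abbreviation "P' \<equiv> path_algebra (tilde_quiver G) :: ('k, ('v + 'v, 'a + 'v) qpath \<Rightarrow>\<^sub>0 'k) module"
abbreviation "I \<equiv> relation_ideal G R"
abbreviation "I' \<equiv> relation_ideal (tilde_quiver G) (tilde_elem ` R)"
abbreviation "A \<equiv> quiver_algebra G R"
abbreviation "A' \<equiv> tilde_algebra G R"

sublocale T: fin_digraph "tilde_quiver G" by (rule fin_digraph_tilde_quiver)
sublocale P: field_algebra P by (rule path_algebra_field_algebra)
sublocale P': field_algebra P' by (rule T.path_algebra_field_algebra)

lemma push_closed:
  "x \<in> carrier P \<Longrightarrow> push_paths tilde_path x \<in> carrier P'"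
  "x \<in> carrier P \<Longrightarrow> push_paths alpha_path x \<in> carrier P'"
  by (auto intro!: keys_push_paths tilde_path_qpaths alpha_path_qpaths
      simp del: tilde_path.simps alpha_path.simps)

lemma tilde_relations: "tilde_elem ` R \<subseteq> carrier P'"
  using relations push_closed(1) unfolding tilde_elem_eq by blast

lemma I_ideal: "ideal I P"
  unfolding relation_ideal_def by (rule P.genideal_ideal[OF relations])

lemma I'_ideal: "ideal I' P'"
  unfolding relation_ideal_def by (rule P'.genideal_ideal[OF tilde_relations])

sublocale I: ideal I P by (rule I_ideal)
sublocale I': ideal I' P' by (rule I'_ideal)

text \<open>
  The elements that are sent into \<open>I'\<close> form an ideal containing the relations.
\<close>

lemma push_I:
  assumes "x \<in> I"
  shows "push_paths tilde_path x \<in> I'"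
proof -
  let ?J = "{x \<in> carrier P. push_paths tilde_path x \<in> I'}"
  have "ideal ?J P"
  proof (rule P.two_sided_idealI)
    show "\<zero>\<^bsub>P\<^esub> \<in> ?J" using I'.zero_closed by simp
    fix x assume x: "x \<in> ?J"
    show "x \<oplus>\<^bsub>P\<^esub> y \<in> ?J" if "y \<in> ?J" for y
      using x that P.a_closed[of x y] I'.a_closed by (auto simp: push_paths_add)
    show "a \<otimes>\<^bsub>P\<^esub> x \<in> ?J" "x \<otimes>\<^bsub>P\<^esub> a \<in> ?J" if "a \<in> carrier P" for a
      using x that P.m_closed[of a x] P.m_closed[of x a] push_closed(1)[OF that]
        I'.I_l_closed[of "push_paths tilde_path x" "push_paths tilde_path a"]
        I'.I_r_closed[of "push_paths tilde_path x" "push_paths tilde_path a"]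
      by (simp_all add: path_mult_push_tilde)
  qed auto
  moreover have "R \<subseteq> ?J"
    using relations P'.genideal_self[OF tilde_relations]
    unfolding relation_ideal_def tilde_elem_eq by blast
  ultimately have "I \<subseteq> ?J" unfolding relation_ideal_def by (rule P.genideal_minimal)
  then show ?thesis using assms by blast
qed

lemma coeff_maps_closed:
  "x \<in> carrier P' \<Longrightarrow> drop_alpha x \<in> carrier P" "x \<in> carrier P' \<Longrightarrow> strip_alpha x \<in> carrier P"
  "x \<in> carrier P' \<Longrightarrow> new_vertices x \<in> carrier P"
  using keys_coeff_maps[of x G] by simp_all

text \<open>
  Together with the vanishing of \<open>new_vertices\<close>, the two conditions define an ideal that contains the
  relations. The vanishing is what keeps \<open>strip_alpha (x a)\<close> in \<open>I\<close>, as the triangular product has the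
  summand \<open>new_vertices x \<cdot> strip_alpha a\<close>.
\<close>

lemma coeff_maps_I':
  assumes "x \<in> I'"
  shows "drop_alpha x \<in> I" "strip_alpha x \<in> I"
proof -
  let ?J = "{x \<in> carrier P'. drop_alpha x \<in> I \<and> strip_alpha x \<in> I \<and> new_vertices x = 0}"
  note mult = coeff_maps_path_mult[where Q = G]
  note Il = I.I_l_closed[simplified path_algebra_simps(2)] and Ir = I.I_r_closed[simplified path_algebra_simps(2)]
  note Ia = I.a_closed[simplified path_algebra_simps(5)]
  have "ideal ?J P'"
  proof (rule P'.two_sided_idealI)
    show "\<zero>\<^bsub>P'\<^esub> \<in> ?J" using I.zero_closed by simp
    fix x assume x: "x \<in> ?J"
    show "x \<oplus>\<^bsub>P'\<^esub> y \<in> ?J" if "y \<in> ?J" for y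
      using x that P'.a_closed[of x y] by (auto simp: coeff_maps_add Ia)
    fix a assume a: "a \<in> carrier P'"
    have keys: "Poly_Mapping.keys x \<subseteq> qpaths (tilde_quiver G)" "Poly_Mapping.keys a \<subseteq> qpaths (tilde_quiver G)"
      using x a by auto
    show "a \<otimes>\<^bsub>P'\<^esub> x \<in> ?J"
      using x P'.m_closed[OF a, of x] coeff_maps_closed[OF a]
      by (auto simp: mult[OF keys(2,1)] Il intro!: Ia simp del: path_algebra_simps(1))
    show "x \<otimes>\<^bsub>P'\<^esub> a \<in> ?J"
      using x P'.m_closed[OF _ a, of x] coeff_maps_closed[OF a]
      by (auto simp: mult[OF keys] Ir intro!: Ia simp del: path_algebra_simps(1))
  qed auto
  moreover have "tilde_elem ` R \<subseteq> ?J"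
    using tilde_relations P.genideal_self[OF relations] I.zero_closed
    unfolding relation_ideal_def tilde_elem_eq by (auto simp del: path_algebra_simps(1))
  ultimately have "I' \<subseteq> ?J" unfolding relation_ideal_def by (rule P'.genideal_minimal)
  then show "drop_alpha x \<in> I" "strip_alpha x \<in> I" using assms by blast+
qed

sublocale A: field_algebra A
  unfolding quiver_algebra_def by (rule P.quotient_field_algebra) (rule I_ideal)

sublocale A': field_algebra A'
  unfolding tilde_algebra_def quiver_algebra_def by (rule P'.quotient_field_algebra) (rule I'_ideal)

abbreviation cls :: "(('v, 'a) qpath \<Rightarrow>\<^sub>0 'k) \<Rightarrow> (('v, 'a) qpath \<Rightarrow>\<^sub>0 'k) set" where
  "cls x \<equiv> I +>\<^bsub>P\<^esub> x"

abbreviation cls' :: "(('v + 'v, 'a + 'v) qpath \<Rightarrow>\<^sub>0 'k) \<Rightarrow> (('v + 'v, 'a + 'v) qpath \<Rightarrow>\<^sub>0 'k) set" where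
  "cls' x \<equiv> I' +>\<^bsub>P'\<^esub> x"

lemma A_simps:
  "carrier A = cls ` carrier P"
  "one A = cls (one P)" "zero A = I"
  "x \<in> carrier P \<Longrightarrow> y \<in> carrier P \<Longrightarrow> cls x \<oplus>\<^bsub>A\<^esub> cls y = cls (x + y)"
  "x \<in> carrier P \<Longrightarrow> y \<in> carrier P \<Longrightarrow> cls x \<otimes>\<^bsub>A\<^esub> cls y = cls (path_mult x y)"
  "x \<in> carrier P \<Longrightarrow> c \<odot>\<^bsub>A\<^esub> cls x = cls (Poly_Mapping.map ((*) c) x)"
  using I.a_rcos_sum[of x y] I.rcoset_mult_add[of x y]
    P.left_ideal_smult_coset[OF P.ideal_left_ideal[OF I_ideal], of x c]
  by (simp_all add: quiver_algebra_def a_rcosets_eq del: path_algebra_simps(1,3))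

lemma A'_simps:
  "carrier A' = cls' ` carrier P'"
  "one A' = cls' (one P')" "zero A' = I'"
  "x \<in> carrier P' \<Longrightarrow> y \<in> carrier P' \<Longrightarrow> cls' x \<oplus>\<^bsub>A'\<^esub> cls' y = cls' (x + y)"
  "x \<in> carrier P' \<Longrightarrow> y \<in> carrier P' \<Longrightarrow> cls' x \<otimes>\<^bsub>A'\<^esub> cls' y = cls' (path_mult x y)"
  "x \<in> carrier P' \<Longrightarrow> c \<odot>\<^bsub>A'\<^esub> cls' x = cls' (Poly_Mapping.map ((*) c) x)"
  using I'.a_rcos_sum[of x y] I'.rcoset_mult_add[of x y]
    P'.left_ideal_smult_coset[OF P'.ideal_left_ideal[OF I'_ideal], of x c]
  by (simp_all add: tilde_algebra_def quiver_algebra_def a_rcosets_eq del: path_algebra_simps(1,3))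

text \<open>
  The map \<open>incl_A\<close> embeds \<open>A\<close> as a subalgebra with an identity of its own; \<open>proj_A\<close> is the algebra
  homomorphism whose kernel is spanned by the paths that end at a new vertex, and \<open>strip_A\<close> removes a
  final new arrow and kills all other paths.
\<close>

definition incl_A :: "(('v, 'a) qpath \<Rightarrow>\<^sub>0 'k) set \<Rightarrow> ('v, 'a, 'k) tilde_alg_elem" where
  "incl_A = coset_map P' I' (push_paths tilde_path)"

definition proj_A :: "('v, 'a, 'k) tilde_alg_elem \<Rightarrow> (('v, 'a) qpath \<Rightarrow>\<^sub>0 'k) set" where
  "proj_A = coset_map P I drop_alpha"

definition strip_A :: "('v, 'a, 'k) tilde_alg_elem \<Rightarrow> ('v, 'a, 'k) tilde_alg_elem" where
  "strip_A = coset_map P' I' (\<lambda>x. push_paths tilde_path (strip_alpha x))"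

lemma coset_maps:
  "x \<in> carrier P \<Longrightarrow> incl_A (cls x) = cls' (push_paths tilde_path x)"
  "y \<in> carrier P' \<Longrightarrow> proj_A (cls' y) = cls (drop_alpha y)"
  "y \<in> carrier P' \<Longrightarrow> strip_A (cls' y) = cls' (push_paths tilde_path (strip_alpha y))"
  unfolding incl_A_def proj_A_def strip_A_def
  by (rule coset_map_coset[OF I.abelian_subgroup_axioms I'.abelian_subgroup_axioms]
      coset_map_coset[OF I'.abelian_subgroup_axioms I.abelian_subgroup_axioms]
      coset_map_coset[OF I'.abelian_subgroup_axioms I'.abelian_subgroup_axioms];
    use push_closed coeff_maps_closed push_I coeff_maps_I' in
      \<open>simp add: push_paths_add coeff_maps_add del: path_algebra_simps(1)\<close>)+

lemma sum_new_closed: "sum_new_vertices G \<in> carrier P'" "sum_new_arrows G \<in> carrier P'"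
  using keys_sum_new by auto

text \<open>
  A spanning list of \<open>A\<close>, its multiples by the new arrows, and the new vertices span \<open>A'\<close>, one part for
  each kind of path.
\<close>

lemma finite_dim_tilde:
  assumes "finite_dim_alg A"
  obtains cs where "set cs \<subseteq> carrier A'" "carrier A' \<subseteq> A'.list_span cs"
proof -
  obtain bs where bs: "set bs \<subseteq> carrier A" "carrier A \<subseteq> A.list_span bs"
    using A.finite_dim_list_span[OF assms] .
  obtain vs where vs: "set vs = verts G" using finite_list[OF finite_verts] by blast
  define \<alpha> where "\<alpha> = cls' (sum_new_arrows G)"
  define cs where "cs = map incl_A bs @ map (\<lambda>b. \<alpha> \<otimes>\<^bsub>A'\<^esub> incl_A b) bs
    @ map (\<lambda>v. cls' (Poly_Mapping.single (Inr v, [], Inr v) 1)) vs"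
  have incl: "incl_A X \<in> carrier A'" "incl_A (X \<oplus>\<^bsub>A\<^esub> Y) = incl_A X \<oplus>\<^bsub>A'\<^esub> incl_A Y"
    "incl_A (c \<odot>\<^bsub>A\<^esub> X) = c \<odot>\<^bsub>A'\<^esub> incl_A X"
    if XY: "X \<in> carrier A" "Y \<in> carrier A" for X Y c
  proof -
    obtain x where x: "x \<in> carrier P" "X = cls x" using XY(1) unfolding A_simps by blast
    obtain y where y: "y \<in> carrier P" "Y = cls y" using XY(2) unfolding A_simps by blast
    from x y show "incl_A X \<in> carrier A'" "incl_A (X \<oplus>\<^bsub>A\<^esub> Y) = incl_A X \<oplus>\<^bsub>A'\<^esub> incl_A Y"
      "incl_A (c \<odot>\<^bsub>A\<^esub> X) = c \<odot>\<^bsub>A'\<^esub> incl_A X"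
      using push_closed P.a_closed[of x y] P.smult_closed[of x c]
      by (simp_all add: A_simps A'_simps coset_maps push_paths_add push_paths_scale del: path_algebra_simps(1))
  qed
  have \<alpha>: "\<alpha> \<in> carrier A'" unfolding \<alpha>_def A'_simps using sum_new_closed by blast
  have triv: "Poly_Mapping.single (Inr v, [], Inr v) c \<in> carrier P'" if "v \<in> verts G" for v and c :: 'k
    using trivial_tilde_qpath[OF that] by simp
  have cs: "set cs \<subseteq> carrier A'"
  proof -
    have "cls' (Poly_Mapping.single (Inr v, [], Inr v) 1) \<in> carrier A'" if "v \<in> verts G" for v
      unfolding A'_simps using triv[OF that] by blast
    then show ?thesis using bs(1) vs incl(1) \<alpha> unfolding cs_def by auto
  qed
  have spans: "incl_A X \<in> A'.list_span cs" "\<alpha> \<otimes>\<^bsub>A'\<^esub> incl_A X \<in> A'.list_span cs"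
    if X: "X \<in> carrier A" for X
  proof -
    have "X \<in> A.list_span bs" using X bs(2) by blast
    then show "incl_A X \<in> A'.list_span cs"
      by (rule A.list_span_image[OF A'.field_algebra_axioms incl(1,2,3) bs(1) cs, rotated -1])
        (auto simp: cs_def)
    show "\<alpha> \<otimes>\<^bsub>A'\<^esub> incl_A X \<in> A'.list_span cs"
      by (rule A.list_span_image[OF A'.field_algebra_axioms _ _ _ bs(1) cs _ \<open>X \<in> A.list_span bs\<close>])
        (use \<alpha> incl in \<open>auto simp: cs_def A'.r_distr A'.smult_mult_right\<close>)
  qed
  have "cls' x \<in> A'.list_span cs" if "x \<in> carrier P'" for x
  proof -
    have "Poly_Mapping.keys x \<subseteq> qpaths (tilde_quiver G)" using that by simp
    then have "x \<in> carrier P' \<and> cls' x \<in> A'.list_span cs"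
    proof (induction x rule: poly_mapping_keys_induct)
      case zero
      then show ?case using A'.zero_in_list_span[OF cs] I'.a_rcos_const[OF I'.zero_closed] P'.zero_closed
        by (simp add: A'_simps)
    next
      case (add x y)
      then show ?case using A'.list_span_add[OF cs, of "cls' x" "cls' y"] P'.a_closed[of x y]
        by (simp add: A'_simps del: path_algebra_simps(1))
    next
      case (single p c)
      from single have pc: "Poly_Mapping.single p c \<in> carrier P'" by simp
      from single show ?case
      proof (cases rule: qpaths_tilde_quiver_cases)
        case (tilde q)
        then have q: "Poly_Mapping.single q c \<in> carrier P" by simp
        then have "incl_A (cls (Poly_Mapping.single q c)) = cls' (Poly_Mapping.single p c)"
          using tilde by (simp add: coset_maps)
        then show ?thesis using spans(1)[of "cls (Poly_Mapping.single q c)"] q pc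
          by (simp add: A_simps(1) del: path_algebra_simps(1))
      next
        case (alpha q)
        then have q: "Poly_Mapping.single q c \<in> carrier P" by simp
        obtain u w v where uwv: "q = (u, w, v)" by (cases q)
        then have "v \<in> verts G" using alpha qpaths_verts by blast
        then have "path_mult (sum_new_arrows G) (Poly_Mapping.single (tilde_path q) c) = Poly_Mapping.single p c"
          by (simp add: alpha uwv sum_new_arrows_def path_mult_sum_left path_mult_single)
        then have "\<alpha> \<otimes>\<^bsub>A'\<^esub> incl_A (cls (Poly_Mapping.single q c)) = cls' (Poly_Mapping.single p c)"
          using q push_closed(1)[OF q] sum_new_closed unfolding \<alpha>_def
          by (simp add: coset_maps A'_simps del: path_algebra_simps(1))
        then show ?thesis using spans(2)[of "cls (Poly_Mapping.single q c)"] q pc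
          by (simp add: A_simps(1) del: path_algebra_simps(1))
      next
        case (trivial v)
        have "cls' (Poly_Mapping.single (Inr v, [], Inr v) 1) \<in> A'.list_span cs"
          using A'.set_subset_list_span[OF cs] trivial vs by (auto simp: cs_def)
        then have "c \<odot>\<^bsub>A'\<^esub> cls' (Poly_Mapping.single (Inr v, [], Inr v) 1) \<in> A'.list_span cs"
          by (rule A'.list_span_smult[OF cs])
        moreover have "c \<odot>\<^bsub>A'\<^esub> cls' (Poly_Mapping.single (Inr v, [], Inr v) 1) = cls' (Poly_Mapping.single p c)"
          using triv[of v 1] trivial by (simp add: A'_simps del: path_algebra_simps(1))
        ultimately show ?thesis using pc by simp
      qed
    qed
    then show ?thesis by blast
  qed
  then show ?thesis using that[OF cs] unfolding A'_simps by blast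
qed

lemma proj_A_hom: "ring_hom_ring A' A proj_A"
proof (rule ring_hom_ringI2)
  show "ring A'" "ring A" by (rule A'.ring_axioms A.ring_axioms)+
  have "drop_alpha (one P') = one P"
  proof -
    have "drop_alpha (Poly_Mapping.single (Inl v, [], Inl v) (1 :: 'k)) = (Poly_Mapping.single (v, [], v) 1 :: ('v, 'a) qpath \<Rightarrow>\<^sub>0 'k)" for v
      using coeff_maps_single(1)[of "(v, [], v)" 1] by simp
    then have "drop_alpha (\<Sum>v\<in>verts G. Poly_Mapping.single (Inl v, [], Inl v) 1) = one P"
      by (simp add: coeff_maps_sum)
    moreover have "one P' = (\<Sum>v\<in>verts G. Poly_Mapping.single (Inl v, [], Inl v) 1) + sum_new_vertices G"
      by (simp add: sum_new_vertices_def)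
        (subst sum.union_disjoint, auto simp: sum.reindex inj_on_def)
    ultimately show ?thesis by (simp add: coeff_maps_add coeff_maps_sum_new_vertices del: path_algebra_simps)
  qed
  moreover have "drop_alpha (path_mult x y) = path_mult (drop_alpha x) (drop_alpha y)"
    if "x \<in> carrier P'" "y \<in> carrier P'" for x y
    using that by (simp add: coeff_maps_path_mult)
  ultimately show "proj_A \<in> ring_hom A' A"
    using coeff_maps_closed P'.a_closed P'.m_closed P'.one_closed
    by (intro ring_hom_memI)
      (auto simp: A'_simps A_simps coset_maps coeff_maps_add simp del: path_algebra_simps(1,3))
qed

text \<open>
  The element \<open>\<epsilon>\<close> of the general result is the sum of the new vertices, \<open>\<alpha>\<close> is the sum of the new arrows,
  and \<open>\<sigma>\<close> removes a final new arrow.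
\<close>

theorem alg_isomorphic_quotient:
  assumes "finite_dim_alg A"
  shows "A \<cong>\<^sub>a\<^sub>l\<^sub>g alg_quot (corner (frakD G R) (unit_at G R i))
    (corner_ideal (frakD G R) (unit_at G R i) (tilde_idem G R i))"
proof -
  let ?e = "vertex_idem (tilde_quiver G) (tilde_elem ` R)"
  obtain cs where cs: "set cs \<subseteq> carrier A'" "carrier A' \<subseteq> A'.list_span cs"
    using finite_dim_tilde[OF assms] .
  have single: "Poly_Mapping.single (v, [], v) 1 \<in> carrier P'" if "v \<in> verts (tilde_quiver G)" for v
    using T.trivial_qpath[OF that] by simp
  have e: "?e v \<in> carrier A'" if "v \<in> verts (tilde_quiver G)" for v
    unfolding vertex_idem_def A'_simps using single[OF that] by blast
  have finsum_P': "finsum P' x S = sum x S" if "finite S" "\<And>k. k \<in> S \<Longrightarrow> x k \<in> carrier P'"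
    for x :: "'c \<Rightarrow> ('v + 'v, 'a + 'v) qpath \<Rightarrow>\<^sub>0 'k" and S
    using that by (induction S) (auto simp: P'.finsum_insert Pi_def simp del: path_algebra_simps(1))
  have finsum_e: "finsum A' (\<lambda>k. ?e (f k)) S = cls' (\<Sum>k\<in>S. Poly_Mapping.single (f k, [], f k) 1)"
    if "finite S" "f ` S \<subseteq> verts (tilde_quiver G)" for f :: "'c \<Rightarrow> 'v + 'v" and S
  proof -
    have s: "Poly_Mapping.single (f k, [], f k) 1 \<in> carrier P'" if "k \<in> S" for k
      using single[of "f k"] that \<open>f ` S \<subseteq> verts (tilde_quiver G)\<close> by blast
    let ?x = "\<lambda>k. Poly_Mapping.single (f k, [], f k) 1"
    have "finsum (alg_quot P' I') (\<lambda>k. cls' (?x k)) S = cls' (finsum P' ?x S)"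
      using I'_ideal that(1) s by (rule finsum_coset)
    also have "finsum P' ?x S = sum ?x S"
      using that(1) s by (rule finsum_P')
    finally show ?thesis by (simp only: vertex_idem_def tilde_algebra_def quiver_algebra_def)
  qed
  interpret D: idempotent_decomposition A' "verts (tilde_quiver G)" ?e
  proof unfold_locales
    show "Rad_power A' (Rad_nilpotency A') = {\<zero>\<^bsub>A'\<^esub>}" using cs by (rule A'.Rad_power_Rad_nilpotency)
    show "finite (verts (tilde_quiver G))" by (rule T.finite_verts)
    show "finsum A' ?e (verts (tilde_quiver G)) = \<one>\<^bsub>A'\<^esub>"
      using finsum_e[of "verts (tilde_quiver G)" "\<lambda>v. v"] T.finite_verts by (simp add: A'_simps)
  qed (rule e)
  have D_eq: "frakD G R = D.triv"
    by (simp add: frakD_def frakC_def matrix_idem_def)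
  have unit: "unit_at G R i = D.unit_pair i"
    using D.finsum_to_triv_ext_diag[of "verts (tilde_quiver G)" ?e i] e D.finite_V D.sum_e
    by (simp add: unit_at_def D_eq D.unit_pair_def matrix_idem_def del: tilde_quiver_simps)
  have "finsum A' (\<lambda>k. ?e (Inr k)) (verts G) = cls' (sum_new_vertices G)"
    using finsum_e[of "verts G" Inr] by (simp add: sum_new_vertices_def)
  then have tilde: "tilde_idem G R i = to_triv_ext (D.diag i (cls' (sum_new_vertices G)))"
    using D.finsum_to_triv_ext_diag[of "verts G" "\<lambda>k. ?e (Inr k)" i] e
    by (simp add: tilde_idem_def D_eq matrix_idem_def)
  show ?thesis
    unfolding D_eq unit tilde
  proof (rule D.alg_isomorphic_corner_quotient[where \<pi> = proj_A and \<alpha> = "cls' (sum_new_arrows G)" and \<sigma> = strip_A])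
    show "ring_hom_ring A' A proj_A" by (rule proj_A_hom)
    show "proj_A ` carrier A' = carrier A"
    proof
      show "proj_A ` carrier A' \<subseteq> carrier A"
        using coeff_maps_closed by (auto simp: A_simps A'_simps coset_maps simp del: path_algebra_simps(1))
      show "carrier A \<subseteq> proj_A ` carrier A'"
      proof
        fix X assume "X \<in> carrier A"
        then obtain x where x: "x \<in> carrier P" "X = cls x" unfolding A_simps by blast
        then have "proj_A (cls' (push_paths tilde_path x)) = X"
          using push_closed(1) by (simp add: coset_maps del: path_algebra_simps(1))
        then show "X \<in> proj_A ` carrier A'" using x push_closed(1) unfolding A'_simps by blast
      qed
    qed
    show "cls' (sum_new_vertices G) \<in> carrier A'" "cls' (sum_new_arrows G) \<in> carrier A'"
      unfolding A'_simps using sum_new_closed by blast+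
    show "proj_A (cls' (sum_new_vertices G)) = \<zero>\<^bsub>A\<^esub>"
      using sum_new_closed I.a_rcos_const[OF I.zero_closed]
      by (simp add: coset_maps A_simps coeff_maps_sum_new_vertices del: path_algebra_simps(1))
    have split: "cls' x \<ominus>\<^bsub>A'\<^esub> cls' (sum_new_vertices G) \<otimes>\<^bsub>A'\<^esub> cls' x = cls' (push_paths tilde_path (drop_alpha x))"
      if x: "x \<in> carrier P'" for x
    proof -
      have c: "push_paths tilde_path (drop_alpha x) \<in> carrier P'" "path_mult (sum_new_vertices G) x \<in> carrier P'"
        using push_closed(1) coeff_maps_closed(1)[OF x] P'.m_closed[OF sum_new_closed(1) x] by simp_all
      have "Poly_Mapping.keys x \<subseteq> qpaths (tilde_quiver G)" using x by simp
      then have "cls' x = cls' (push_paths tilde_path (drop_alpha x)) \<oplus>\<^bsub>A'\<^esub> cls' (path_mult (sum_new_vertices G) x)"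
        using c split_new_vertices[of x] by (simp add: A'_simps del: path_algebra_simps(1))
      moreover have "cls' (push_paths tilde_path (drop_alpha x)) \<in> carrier A'" "cls' (path_mult (sum_new_vertices G) x) \<in> carrier A'"
        unfolding A'_simps using c by blast+
      moreover have "u \<oplus>\<^bsub>A'\<^esub> v \<ominus>\<^bsub>A'\<^esub> v = u" if "u \<in> carrier A'" "v \<in> carrier A'" for u v
        using that by (simp add: a_minus_def A'.a_assoc A'.r_neg)
      ultimately show ?thesis
        unfolding A'_simps(5)[OF sum_new_closed(1) x] by metis
    qed
    fix X assume "X \<in> carrier A'"
    then obtain x where x: "x \<in> carrier P'" "X = cls' x" unfolding A'_simps by blast
    have \<epsilon>x: "cls' (sum_new_vertices G) \<otimes>\<^bsub>A'\<^esub> X \<in> carrier A'"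
      using \<open>X \<in> carrier A'\<close> \<open>cls' (sum_new_vertices G) \<in> carrier A'\<close> by simp
    show "proj_A (c \<odot>\<^bsub>A'\<^esub> X) = c \<odot>\<^bsub>A\<^esub> proj_A X" for c
      using x coeff_maps_closed P'.smult_closed[OF x(1), of c]
      by (simp add: A_simps A'_simps coset_maps coeff_maps_scale del: path_algebra_simps(1))
    show "strip_A X \<in> carrier A'"
      unfolding x(2) coset_maps(3)[OF x(1)] A'_simps using push_closed(1) coeff_maps_closed(2)[OF x(1)] by blast
    show "strip_A (c \<odot>\<^bsub>A'\<^esub> X) = c \<odot>\<^bsub>A'\<^esub> strip_A X" for c
      using x coeff_maps_closed push_closed P'.smult_closed[OF x(1), of c]
      by (simp add: A'_simps coset_maps coeff_maps_scale push_paths_scale del: path_algebra_simps(1))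
    show "cls' (sum_new_vertices G) \<otimes>\<^bsub>A'\<^esub> X = X" if "proj_A X = \<zero>\<^bsub>A\<^esub>"
    proof -
      have "drop_alpha x \<in> I"
        using that x coeff_maps_closed(1)[OF x(1)] I.a_rcos_self[of "drop_alpha x"]
        by (simp add: coset_maps A_simps del: path_algebra_simps(1))
      then have "cls' (push_paths tilde_path (drop_alpha x)) = \<zero>\<^bsub>A'\<^esub>"
        using push_I I'.a_rcos_const by (simp add: A'_simps)
      then have "X \<ominus>\<^bsub>A'\<^esub> cls' (sum_new_vertices G) \<otimes>\<^bsub>A'\<^esub> X = \<zero>\<^bsub>A'\<^esub>" using split[OF x(1)] x(2) by simp
      then have "X \<ominus>\<^bsub>A'\<^esub> (cls' (sum_new_vertices G) \<otimes>\<^bsub>A'\<^esub> X) \<oplus>\<^bsub>A'\<^esub> cls' (sum_new_vertices G) \<otimes>\<^bsub>A'\<^esub> X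
          = cls' (sum_new_vertices G) \<otimes>\<^bsub>A'\<^esub> X" using \<epsilon>x by simp
      then show ?thesis using \<epsilon>x \<open>X \<in> carrier A'\<close> by (simp add: a_minus_def A'.a_assoc A'.l_neg)
    qed
    show "strip_A (cls' (sum_new_vertices G) \<otimes>\<^bsub>A'\<^esub> (cls' (sum_new_arrows G) \<otimes>\<^bsub>A'\<^esub> X))
        = X \<ominus>\<^bsub>A'\<^esub> cls' (sum_new_vertices G) \<otimes>\<^bsub>A'\<^esub> X"
    proof -
      have "path_mult (sum_new_arrows G) x \<in> carrier P'"
        "path_mult (sum_new_vertices G) (path_mult (sum_new_arrows G) x) \<in> carrier P'"
        using P'.m_closed[OF sum_new_closed(2) x(1)] P'.m_closed[OF sum_new_closed(1), of "path_mult (sum_new_arrows G) x"]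
        by simp_all
      moreover have "Poly_Mapping.keys x \<subseteq> qpaths (tilde_quiver G)" using x by simp
      ultimately show ?thesis
        using x sum_new_closed split[OF x(1)] strip_alpha_mult_new[of x]
        by (simp add: A'_simps(5) coset_maps del: path_algebra_simps(1))
    qed
    fix Y assume "Y \<in> carrier A'"
    then obtain y where y: "y \<in> carrier P'" "Y = cls' y" unfolding A'_simps by blast
    show "strip_A (X \<oplus>\<^bsub>A'\<^esub> Y) = strip_A X \<oplus>\<^bsub>A'\<^esub> strip_A Y"
      using x y coeff_maps_closed push_closed P'.a_closed[OF x(1) y(1)]
      by (simp add: A'_simps coset_maps coeff_maps_add push_paths_add del: path_algebra_simps(1))
  qed
qed

end

theorem proposition10:
  fixes n :: nat
    and Q :: "(nat, 'a) pre_digraph"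
    and R :: "((nat, 'a) qpath \<Rightarrow>\<^sub>0 'k::alg_closed_field) set"
    and i :: int
  assumes "fin_digraph Q" and "verts Q = {1..n}"
    and "R \<subseteq> carrier (path_algebra Q)"
    and "finite_dim_alg (quiver_algebra Q R)"
  shows "quiver_algebra Q R \<cong>\<^sub>a\<^sub>l\<^sub>g
           alg_quot (corner (frakD Q R) (unit_at Q R i))
                    (corner_ideal (frakD Q R) (unit_at Q R i) (tilde_idem Q R i))"
  using assms
  by (intro quiver_with_relations.alg_isomorphic_quotient quiver_with_relations.intro
      quiver_with_relations_axioms.intro)

end
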